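(* Let $M$ be a smooth manifold of dimension $2n+1$ with $n\ge 1$, equipped with a sub-Riemannian contact structure $(H,g)$. Then there is a unique partial connection $\nabla_H:\Lambda^1\to\Lambda^1_H\otimes\Lambda^1$ on the cotangent bundle $\Lambda^1=T^*M$ such that, for every local contact form $\theta$ normalised by $\|\Omega\|^2=2n$ (where $\Omega=d\theta|_H$), with associated Reeb field $T$, the following hold on the domain of $\theta$: (1) $\nabla_H T=0$; (2) $\nabla_H\theta=(d\theta)_H$; (3) $\nabla_H$ is free from partial torsion; (4) $\nabla_H g=0$.
   Context: A contact distribution on a smooth manifold $M$ of dimension $2n+1$ is a smooth corank-one subbundle $H\subset TM$ with annihilator line bundle $L\subset\Lambda^1=T^*M$, whose Levi form is non-degenerate. Equivalently, every nowhere vanishing local section $\theta$ of $L$ satisfies $\theta\wedge(d\theta)^n\neq 0$ everywhere. Such a $\theta$ is called a (local) contact form. A sub-Riemannian contact structure is a contact distribution $H$ together with a smooth positive-definite symmetric bilinear form $g$ on $H$. No compatibility between $g$ and the Levi form is assumed. Notation: $\Lambda^0$ is the trivial line bundle, whose sections are the smooth functions. $\Lambda^1_H=H^*=\Lambda^1/L$ and $\Lambda^2_H=\Lambda^2(\Lambda^1_H)$. For a 1-form $\omega$, $\omega_H$ denotes its image in $\Lambda^1_H$. $d_H$ denotes $d$ followed by restriction to $H$, both as $\Lambda^0\to\Lambda^1_H$ and as $\Lambda^1\to\Lambda^2\to\Lambda^2_H$. Partial connection: a partial connection on a vector bundle $V$ is a linear differential operator $\nabla_H:V\to\Lambda^1_H\otimes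 V$ with $\nabla_H(f\sigma)=f\nabla_H\sigma+d_Hf\otimes\sigma$ for smooth functions $f$ and sections $\sigma$. A partial connection on $\Lambda^1$ induces one on the dual bundle $TM$ and on tensor bundles by the usual Leibniz rules. Partial torsion: the partial torsion of a partial connection $\nabla_H$ on $\Lambda^1$ is the bundle homomorphism $\Lambda^1\to\Lambda^2_H$ given by the difference between $d_H:\Lambda^1\to\Lambda^2_H$ and the composition $\Lambda^1\xrightarrow{\nabla_H}\Lambda^1_H\otimes\Lambda^1\to\Lambda^1_H\otimes\Lambda^1_H\to\Lambda^2_H$, where the last map is $\phi\otimes\psi\mapsto\phi\wedge\psi$. Reeb field: for a contact form $\theta$, the Reeb field $T$ is the unique vector field with $\theta(T)=1$ and $d\theta(T,\cdot)=0$. It splits $\Lambda^1=\Lambda^1_H\oplus\Lambda^0$, where $\Lambda^1_H$ is identified with $\{\omega\in\Lambda^1:\omega(T)=0\}$. The condition $\nabla_HT=0$ implies that $\nabla_H$ preserves this subbundle, so $\nabla_Hg$ makes sense for $g\in\Gamma(\bigodot^2\Lambda^1_H)$. $(d\theta)_H$: this is the image of $d\theta$ under $\Lambda^2\hookrightarrow\Lambda^1\otimes\Lambda^1\to\Lambda^1_H\otimes\Lambda^1$, where the inclusion is normalised as a right inverse of the wedge map $\phi\otimes\psi\mapsto\phi\wedge\psi$, i.e. $\phi\wedge\psi\mapsto\frac12(\phi\otimes\psi-\psi\otimes\phi)$. Norm of $\Omega$: for a contact form $\theta$, let $\Omega=d\theta|_H\in\Gamma(\Lambda^2_H)$. In a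 $g$-orthonormal frame $X_1,\dots,X_{2n}$ of $H$, $\|\Omega\|^2=\sum_{i,j}\Omega(X_i,X_j)^2$. So if $\Omega$ is in block form with $2\times2$ skew blocks having entries $\pm\lambda_1,\dots,\pm\lambda_n$, then $\|\Omega\|^2=2(\lambda_1^2+\cdots+\lambda_n^2)$. Locally a contact form with $\|\Omega\|^2=2n$ exists and is unique up to sign. *)

theory Defs
  imports "HOL-Analysis.Analysis" "HOL-Library.Function_Algebras"
begin

(* Tangent vectors, covectors and tensors are functions that vanish outside their natural
   domain, so that the pointwise operations are the vector space operations. *)
instantiation "fun" :: (type, scaleR) scaleR
begin
definition scaleR_fun_def: "r *\<^sub>R f = (\<lambda>x. r *\<^sub>R f x)"
instance ..
end

instance "fun" :: (type, real_vector) real_vector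
  by standard (auto simp: scaleR_fun_def fun_eq_iff algebra_simps)


section \<open>Smooth manifolds\<close>

(* C^k on an open set S. *)
primrec Ck_on :: "nat \<Rightarrow> 'e::real_normed_vector set \<Rightarrow> ('e \<Rightarrow> 'f::real_normed_vector) \<Rightarrow> bool" where
  "Ck_on 0 = (\<lambda>S f. continuous_on S f)"
| "Ck_on (Suc k) = (\<lambda>S f. (\<forall>x\<in>S. f differentiable (at x)) \<and>
     (\<forall>v. Ck_on k S (\<lambda>x. frechet_derivative f (at x) v)))"

definition smooth_on :: "'e::real_normed_vector set \<Rightarrow> ('e \<Rightarrow> 'f::real_normed_vector) \<Rightarrow> bool" where
  "smooth_on S f \<longleftrightarrow> (\<forall>k. Ck_on k S f)"

(* A chart is its domain together with the coordinate map. *)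
type_synonym ('a, 'e) chart = "'a set \<times> ('a \<Rightarrow> 'e)"

definition chart_inv :: "('a, 'e) chart \<Rightarrow> 'e \<Rightarrow> 'a" where
  "chart_inv c = inv_into (fst c) (snd c)"

(* The atlas need not be maximal. *)
record ('a, 'e) manifold =
  mtop :: "'a topology"
  atlas :: "('a, 'e) chart set"

definition charts_at :: "('a, 'e) manifold \<Rightarrow> 'a \<Rightarrow> ('a, 'e) chart set" where
  "charts_at M p = {c \<in> atlas M. p \<in> fst c}"

definition smooth_manifold :: "('a, 'e::euclidean_space) manifold \<Rightarrow> bool" where
  "smooth_manifold M \<longleftrightarrow>
     Hausdorff_space (mtop M) \<and> second_countable (mtop M) \<and>
     (\<forall>p\<in>topspace (mtop M). charts_at M p \<noteq> {}) \<and>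
     (\<forall>c\<in>atlas M. openin (mtop M) (fst c) \<and> open (snd c ` fst c) \<and>
        homeomorphic_map (subtopology (mtop M) (fst c)) (top_of_set (snd c ` fst c)) (snd c)) \<and>
     (\<forall>c\<in>atlas M. \<forall>c'\<in>atlas M.
        smooth_on (snd c ` (fst c \<inter> fst c')) (snd c' \<circ> chart_inv c))"

(* An arbitrary chart around p, used in coordinate formulas that do not depend on the choice. *)
definition chart_at :: "('a, 'e) manifold \<Rightarrow> 'a \<Rightarrow> ('a, 'e) chart" where
  "chart_at M p = (SOME c. c \<in> charts_at M p)"

definition smooth_fun :: "('a, 'e::euclidean_space) manifold \<Rightarrow> 'a set \<Rightarrow> ('a \<Rightarrow> real) \<Rightarrow> bool" where
  "smooth_fun M U f \<longleftrightarrow> (\<forall>c\<in>atlas M. smooth_on (snd c ` (U \<inter> fst c)) (f \<circ> chart_inv c))"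


section \<open>Vector fields and forms\<close>

(* A tangent vector is the family of its coordinate vectors in all charts around the point,
   related by the Jacobians of the coordinate changes. *)
type_synonym ('a, 'e) tvec = "('a, 'e) chart \<Rightarrow> 'e"
type_synonym ('a, 'e) vfield = "'a \<Rightarrow> ('a, 'e) tvec"
type_synonym ('a, 'e) covec = "('a, 'e) tvec \<Rightarrow> real"
type_synonym ('a, 'e) oneform = "'a \<Rightarrow> ('a, 'e) covec"
type_synonym ('a, 'e) bilin = "'a \<Rightarrow> ('a, 'e) tvec \<Rightarrow> ('a, 'e) tvec \<Rightarrow> real"

definition jacobian :: "('a, 'e) chart \<Rightarrow> ('a, 'e) chart \<Rightarrow> 'a \<Rightarrow> 'e::euclidean_space \<Rightarrow> 'e" where
  "jacobian c c' p = frechet_derivative (snd c' \<circ> chart_inv c) (at (snd c p))"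

definition tangent :: "('a, 'e::euclidean_space) manifold \<Rightarrow> 'a \<Rightarrow> ('a, 'e) tvec set" where
  "tangent M p = {v. (\<forall>c. c \<notin> charts_at M p \<longrightarrow> v c = 0) \<and>
     (\<forall>c\<in>charts_at M p. \<forall>c'\<in>charts_at M p. v c' = jacobian c c' p (v c))}"

(* The tangent vector at p whose coordinate vector in the chart c is e. *)
definition coord_vec :: "('a, 'e::euclidean_space) manifold \<Rightarrow> ('a, 'e) chart \<Rightarrow> 'e \<Rightarrow> ('a, 'e) vfield" where
  "coord_vec M c e p = (\<lambda>c'. if c' \<in> charts_at M p then jacobian c c' p e else 0)"

definition dir_deriv :: "('a, 'e::euclidean_space) manifold \<Rightarrow> 'a \<Rightarrow> ('a, 'e) tvec \<Rightarrow> ('a \<Rightarrow> real) \<Rightarrow> real" where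
  "dir_deriv M p v f =
     (let c = chart_at M p in frechet_derivative (f \<circ> chart_inv c) (at (snd c p)) (v c))"

definition vfields :: "('a, 'e::euclidean_space) manifold \<Rightarrow> 'a set \<Rightarrow> ('a, 'e) vfield set" where
  "vfields M U = {X. (\<forall>p\<in>U. X p \<in> tangent M p) \<and> (\<forall>p. p \<notin> U \<longrightarrow> X p = 0) \<and>
     (\<forall>c\<in>atlas M. smooth_on (snd c ` (U \<inter> fst c)) (\<lambda>x. X (chart_inv c x) c))}"

definition lie_bracket :: "('a, 'e::euclidean_space) manifold \<Rightarrow> ('a, 'e) vfield \<Rightarrow> ('a, 'e) vfield \<Rightarrow> ('a, 'e) vfield" where
  "lie_bracket M X Y p = (let c = chart_at M p;
       X' = (\<lambda>x. X (chart_inv c x) c); Y' = (\<lambda>x. Y (chart_inv c x) c)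
     in coord_vec M c (frechet_derivative Y' (at (snd c p)) (X p c) -
                       frechet_derivative X' (at (snd c p)) (Y p c)) p)"

definition linear_on :: "'v::real_vector set \<Rightarrow> ('v \<Rightarrow> real) \<Rightarrow> bool" where
  "linear_on V f \<longleftrightarrow> (\<forall>u\<in>V. \<forall>v\<in>V. \<forall>a b. f (a *\<^sub>R u + b *\<^sub>R v) = a * f u + b * f v)"

definition cotangent :: "('a, 'e::euclidean_space) manifold \<Rightarrow> 'a \<Rightarrow> ('a, 'e) covec set" where
  "cotangent M p = {\<phi>. (\<forall>v. v \<notin> tangent M p \<longrightarrow> \<phi> v = 0) \<and> linear_on (tangent M p) \<phi>}"

definition one_forms :: "('a, 'e::euclidean_space) manifold \<Rightarrow> 'a set \<Rightarrow> ('a, 'e) oneform set" where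
  "one_forms M U = {\<omega>. (\<forall>p\<in>U. \<omega> p \<in> cotangent M p) \<and> (\<forall>p. p \<notin> U \<longrightarrow> \<omega> p = 0) \<and>
     (\<forall>V Y. openin (mtop M) V \<and> V \<subseteq> U \<and> Y \<in> vfields M V \<longrightarrow> smooth_fun M V (\<lambda>p. \<omega> p (Y p)))}"

(* d\<omega>(u,v) in coordinates, normalised by d\<omega>(X,Y) = X \<omega>(Y) - Y \<omega>(X) - \<omega>([X,Y]), in accordance
   with (\<phi> \<and> \<psi>)(u,v) = \<phi>(u) \<psi>(v) - \<phi>(v) \<psi>(u). *)
definition ext_deriv :: "('a, 'e::euclidean_space) manifold \<Rightarrow> ('a, 'e) oneform \<Rightarrow> ('a, 'e) bilin" where
  "ext_deriv M \<omega> p u v = (let c = chart_at M p in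
     dir_deriv M p u (\<lambda>q. \<omega> q (coord_vec M c (v c) q)) -
     dir_deriv M p v (\<lambda>q. \<omega> q (coord_vec M c (u c) q)))"


section \<open>Sub-Riemannian contact structures\<close>

definition smooth_subbundle :: "('a, 'e::euclidean_space) manifold \<Rightarrow> nat \<Rightarrow> ('a \<Rightarrow> ('a, 'e) tvec set) \<Rightarrow> bool" where
  "smooth_subbundle M k H \<longleftrightarrow> (\<forall>p\<in>topspace (mtop M).
     subspace (H p) \<and> H p \<subseteq> tangent M p \<and> dim (H p) = k \<and>
     (\<exists>U X. openin (mtop M) U \<and> p \<in> U \<and> (\<forall>i<k. X i \<in> vfields M U) \<and>
        (\<forall>q\<in>U. span ((\<lambda>i. X i q) ` {..<k}) = H q)))"

definition H_fields :: "('a, 'e::euclidean_space) manifold \<Rightarrow> ('a \<Rightarrow> ('a, 'e) tvec set) \<Rightarrow> 'a set \<Rightarrow> ('a, 'e) vfield set" where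
  "H_fields M H U = {X \<in> vfields M U. \<forall>p\<in>U. X p \<in> H p}"

(* The Levi form H x H \<rightarrow> TM/H is induced by (X,Y) \<mapsto> [X,Y] mod H on local sections of H. *)
definition contact_distribution :: "('a, 'e::euclidean_space) manifold \<Rightarrow> ('a \<Rightarrow> ('a, 'e) tvec set) \<Rightarrow> bool" where
  "contact_distribution M H \<longleftrightarrow> smooth_subbundle M (DIM('e) - 1) H \<and>
     (\<forall>p\<in>topspace (mtop M). \<forall>u\<in>H p. u \<noteq> 0 \<longrightarrow>
        (\<exists>U X Y. openin (mtop M) U \<and> p \<in> U \<and> X \<in> H_fields M H U \<and> Y \<in> H_fields M H U \<and>
           X p = u \<and> lie_bracket M X Y p \<notin> H p))"

(* Only the values of g p on H p x H p matter. *)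
definition metric_on :: "('a, 'e::euclidean_space) manifold \<Rightarrow> ('a \<Rightarrow> ('a, 'e) tvec set) \<Rightarrow> ('a, 'e) bilin \<Rightarrow> bool" where
  "metric_on M H g \<longleftrightarrow>
     (\<forall>p\<in>topspace (mtop M). \<forall>u\<in>H p. linear_on (H p) (g p u) \<and>
        (\<forall>v\<in>H p. g p u v = g p v u) \<and> (u \<noteq> 0 \<longrightarrow> g p u u > 0)) \<and>
     (\<forall>U X Y. openin (mtop M) U \<and> X \<in> H_fields M H U \<and> Y \<in> H_fields M H U \<longrightarrow>
        smooth_fun M U (\<lambda>p. g p (X p) (Y p)))"

definition sub_riemannian_contact :: "('a, 'e::euclidean_space) manifold \<Rightarrow> ('a \<Rightarrow> ('a, 'e) tvec set) \<Rightarrow> ('a, 'e) bilin \<Rightarrow> bool" where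
  "sub_riemannian_contact M H g \<longleftrightarrow> contact_distribution M H \<and> metric_on M H g"

(* Local contact forms on U: the nowhere vanishing sections over U of the annihilator of H. *)
definition contact_form :: "('a, 'e::euclidean_space) manifold \<Rightarrow> ('a \<Rightarrow> ('a, 'e) tvec set) \<Rightarrow> 'a set \<Rightarrow> ('a, 'e) oneform \<Rightarrow> bool" where
  "contact_form M H U \<theta> \<longleftrightarrow> openin (mtop M) U \<and> \<theta> \<in> one_forms M U \<and>
     (\<forall>p\<in>U. \<theta> p \<noteq> 0 \<and> (\<forall>u\<in>H p. \<theta> p u = 0))"

definition orthonormal_basis :: "('a \<Rightarrow> ('a, 'e::euclidean_space) tvec set) \<Rightarrow> ('a, 'e) bilin \<Rightarrow> 'a \<Rightarrow> ('a, 'e) tvec set \<Rightarrow> bool" where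
  "orthonormal_basis H g p B \<longleftrightarrow> finite B \<and> span B = H p \<and>
     (\<forall>u\<in>B. \<forall>v\<in>B. g p u v = (if u = v then 1 else 0))"

(* The squared norm of \<Omega> = d\<theta> restricted to H at p; it does not depend on the chosen basis. *)
definition Omega_norm_sq :: "('a, 'e::euclidean_space) manifold \<Rightarrow> ('a \<Rightarrow> ('a, 'e) tvec set) \<Rightarrow> ('a, 'e) bilin \<Rightarrow> ('a, 'e) oneform \<Rightarrow> 'a \<Rightarrow> real" where
  "Omega_norm_sq M H g \<theta> p = (let B = (SOME B. orthonormal_basis H g p B) in
     \<Sum>u\<in>B. \<Sum>v\<in>B. (ext_deriv M \<theta> p u v)\<^sup>2)"

definition reeb_field :: "('a, 'e::euclidean_space) manifold \<Rightarrow> 'a set \<Rightarrow> ('a, 'e) oneform \<Rightarrow> ('a, 'e) vfield \<Rightarrow> bool" where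
  "reeb_field M U \<theta> T \<longleftrightarrow> T \<in> vfields M U \<and>
     (\<forall>p\<in>U. \<theta> p (T p) = 1 \<and> (\<forall>v\<in>tangent M p. ext_deriv M \<theta> p (T p) v = 0))"


section \<open>Partial connections\<close>

(* Sections over U of the tensor product of Lambda^1_H with Lambda^1, viewed as bilinear
   functions on H x TM; (\<phi> \<otimes> \<psi>)(u,v) = \<phi>(u) \<psi>(v). *)
definition H_tensors :: "('a, 'e::euclidean_space) manifold \<Rightarrow> ('a \<Rightarrow> ('a, 'e) tvec set) \<Rightarrow> 'a set \<Rightarrow> ('a, 'e) bilin set" where
  "H_tensors M H U = {S.
     (\<forall>p u v. \<not> (p \<in> U \<and> u \<in> H p \<and> v \<in> tangent M p) \<longrightarrow> S p u v = 0) \<and>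
     (\<forall>p\<in>U. (\<forall>u\<in>H p. linear_on (tangent M p) (\<lambda>v. S p u v)) \<and>
             (\<forall>v\<in>tangent M p. linear_on (H p) (\<lambda>u. S p u v))) \<and>
     (\<forall>V X Y. openin (mtop M) V \<and> V \<subseteq> U \<and> X \<in> H_fields M H V \<and> Y \<in> vfields M V \<longrightarrow>
        smooth_fun M V (\<lambda>p. S p (X p) (Y p)))}"

definition restr :: "'a set \<Rightarrow> ('a \<Rightarrow> 'b::zero) \<Rightarrow> 'a \<Rightarrow> 'b" where
  "restr V s = (\<lambda>p. if p \<in> V then s p else 0)"

(* A differential operator acts on the sections over every open set and commutes with
   restriction; D U is its action over U. *)
type_synonym ('a, 'e) form_operator = "'a set \<Rightarrow> ('a, 'e) oneform \<Rightarrow> ('a, 'e) bilin"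

(* The first two clauses fix the irrelevant values of D, so that operators with the same action
   on sections are equal; the following ones are: values in sections, compatibility with
   restriction, linearity and the Leibniz rule. *)
definition partial_connection :: "('a, 'e::euclidean_space) manifold \<Rightarrow> ('a \<Rightarrow> ('a, 'e) tvec set) \<Rightarrow> ('a, 'e) form_operator \<Rightarrow> bool" where
  "partial_connection M H D \<longleftrightarrow>
     (\<forall>U. \<not> openin (mtop M) U \<longrightarrow> D U = 0) \<and>
     (\<forall>U \<sigma>. \<sigma> \<notin> one_forms M U \<longrightarrow> D U \<sigma> = 0) \<and>
     (\<forall>U. openin (mtop M) U \<longrightarrow>
        (\<forall>\<sigma>\<in>one_forms M U. D U \<sigma> \<in> H_tensors M H U) \<and>
        (\<forall>\<sigma>\<in>one_forms M U. \<forall>V. openin (mtop M) V \<and> V \<subseteq> U \<longrightarrow>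
           D V (restr V \<sigma>) = restr V (D U \<sigma>)) \<and>
        (\<forall>\<sigma>\<in>one_forms M U. \<forall>\<tau>\<in>one_forms M U. \<forall>a b.
           D U (a *\<^sub>R \<sigma> + b *\<^sub>R \<tau>) = a *\<^sub>R D U \<sigma> + b *\<^sub>R D U \<tau>) \<and>
        (\<forall>\<sigma>\<in>one_forms M U. \<forall>f. smooth_fun M U f \<longrightarrow>
           (\<forall>p\<in>U. \<forall>u\<in>H p. \<forall>v\<in>tangent M p.
              D U (\<lambda>q. f q *\<^sub>R \<sigma> q) p u v = f p * D U \<sigma> p u v + dir_deriv M p u f * \<sigma> p v)))"

(* The partial torsion as a map from 1-forms \<omega> over U to sections of Lambda^2_H. *)
definition partial_torsion :: "('a, 'e::euclidean_space) manifold \<Rightarrow> ('a, 'e) form_operator \<Rightarrow> 'a set \<Rightarrow> ('a, 'e) oneform \<Rightarrow> ('a, 'e) bilin" where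
  "partial_torsion M D U \<omega> p u v = ext_deriv M \<omega> p u v - (D U \<omega> p u v - D U \<omega> p v u)"

(* The induced partial connection on TM: for a vector field Y on U, p in U and u in H p, the
   vector w = \<nabla>_u Y is determined by u(\<omega>(Y)) = (\<nabla>_u \<omega>)(Y) + \<omega>(w) for all local 1-forms \<omega>. *)
definition induced_TM :: "('a, 'e::euclidean_space) manifold \<Rightarrow> ('a, 'e) form_operator \<Rightarrow> 'a set \<Rightarrow> ('a, 'e) vfield \<Rightarrow> 'a \<Rightarrow> ('a, 'e) tvec \<Rightarrow> ('a, 'e) tvec" where
  "induced_TM M D U Y p u = (THE w. w \<in> tangent M p \<and>
     (\<forall>V \<omega>. openin (mtop M) V \<and> p \<in> V \<and> V \<subseteq> U \<and> \<omega> \<in> one_forms M V \<longrightarrow>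
        dir_deriv M p u (\<lambda>q. \<omega> q (Y q)) = D V \<omega> p u (Y p) + \<omega> p w))"

(* The induced partial connection on covariant 2-tensors B, evaluated on vector fields Y and Z
   on U: (\<nabla>_u B)(Y,Z). *)
definition induced_bilin :: "('a, 'e::euclidean_space) manifold \<Rightarrow> ('a, 'e) form_operator \<Rightarrow> 'a set \<Rightarrow> ('a, 'e) bilin \<Rightarrow> ('a, 'e) vfield \<Rightarrow> ('a, 'e) vfield \<Rightarrow> 'a \<Rightarrow> ('a, 'e) tvec \<Rightarrow> real" where
  "induced_bilin M D U B Y Z p u = dir_deriv M p u (\<lambda>q. B q (Y q) (Z q))
     - B p (induced_TM M D U Y p u) (Z p) - B p (Y p) (induced_TM M D U Z p u)"

(* g as a section of the symmetric square of {\<omega>. \<omega>(T) = 0}, the copy of Lambda^1_H inside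
   Lambda^1 given by the Reeb field: compose g with the projection of TM to H along T. *)
definition reeb_extend :: "('a, 'e::euclidean_space) oneform \<Rightarrow> ('a, 'e) vfield \<Rightarrow> ('a, 'e) bilin \<Rightarrow> ('a, 'e) bilin" where
  "reeb_extend \<theta> T g p v w = g p (v - \<theta> p v *\<^sub>R T p) (w - \<theta> p w *\<^sub>R T p)"

definition reeb_parallel :: "('a, 'e::euclidean_space) manifold \<Rightarrow> ('a \<Rightarrow> ('a, 'e) tvec set) \<Rightarrow> ('a, 'e) form_operator \<Rightarrow> 'a set \<Rightarrow> ('a, 'e) vfield \<Rightarrow> bool" where
  "reeb_parallel M H D U T \<longleftrightarrow> (\<forall>p\<in>U. \<forall>u\<in>H p. induced_TM M D U T p u = 0)"

(* The factor 1/2 comes from the inclusion \<phi> \<and> \<psi> \<mapsto> (\<phi> \<otimes> \<psi> - \<psi> \<otimes> \<phi>) / 2 of Lambda^2. *)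
definition contact_form_eq :: "('a, 'e::euclidean_space) manifold \<Rightarrow> ('a \<Rightarrow> ('a, 'e) tvec set) \<Rightarrow> ('a, 'e) form_operator \<Rightarrow> 'a set \<Rightarrow> ('a, 'e) oneform \<Rightarrow> bool" where
  "contact_form_eq M H D U \<theta> \<longleftrightarrow>
     (\<forall>p\<in>U. \<forall>u\<in>H p. \<forall>v\<in>tangent M p. D U \<theta> p u v = 1/2 * ext_deriv M \<theta> p u v)"

definition torsion_free :: "('a, 'e::euclidean_space) manifold \<Rightarrow> ('a \<Rightarrow> ('a, 'e) tvec set) \<Rightarrow> ('a, 'e) form_operator \<Rightarrow> 'a set \<Rightarrow> bool" where
  "torsion_free M H D U \<longleftrightarrow> (\<forall>V \<omega>. openin (mtop M) V \<and> V \<subseteq> U \<and> \<omega> \<in> one_forms M V \<longrightarrow>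
     (\<forall>p\<in>V. \<forall>u\<in>H p. \<forall>v\<in>H p. partial_torsion M D V \<omega> p u v = 0))"

definition metric_parallel :: "('a, 'e::euclidean_space) manifold \<Rightarrow> ('a \<Rightarrow> ('a, 'e) tvec set) \<Rightarrow> ('a, 'e) bilin \<Rightarrow> ('a, 'e) form_operator \<Rightarrow> 'a set \<Rightarrow> ('a, 'e) oneform \<Rightarrow> ('a, 'e) vfield \<Rightarrow> bool" where
  "metric_parallel M H g D U \<theta> T \<longleftrightarrow>
     (\<forall>V Y Z. openin (mtop M) V \<and> V \<subseteq> U \<and> Y \<in> vfields M V \<and> Z \<in> vfields M V \<longrightarrow>
        (\<forall>p\<in>V. \<forall>u\<in>H p. induced_bilin M D V (reeb_extend \<theta> T g) Y Z p u = 0))"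

end

theory Submission
  imports Defs
begin

text \<open>
  Near every point a contact form \<open>\<theta>\<close> with \<open>\<parallel>\<Omega>\<parallel>\<^sup>2 = 2n\<close> exists and is unique up to sign, and its Reeb
  field together with an orthonormal frame of H is a frame of the tangent bundle. By the Leibniz rule a
  partial connection is determined by its values on the dual coframe. The conditions \<open>\<nabla>T = 0\<close> and
  \<open>\<nabla>\<theta> = d\<theta>/2\<close> fix all of these except the components inside H; these are skew because of
  \<open>\<nabla>g = 0\<close>, the torsion condition gives their alternating part, and, as for the Levi-Civita connection,
  the Koszul formula is the only solution. All conditions are conditions at one point, so uniqueness at a point makes the
  local solutions agree; replacing \<open>\<theta>\<close> by \<open>-\<theta>\<close> replaces T by \<open>-T\<close> and does not change the formula.
\<close>

section \<open>Calculus of C^k functions\<close>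

text \<open>The factor 1/2 in condition (2) is what makes the conditions compatible. Applied to
  \<theta>, vanishing torsion asks that the antisymmetrised derivative of \<theta> on
  \<open>H\<close> be d\<theta>, and half of the skew form d\<theta> satisfies this; it also agrees
  with (1), since the Reeb field lies in the kernel of d\<theta>. The norm condition is what ties
  the local solutions together. Multiplying \<theta> by \<open>f\<close> multiplies the squared norm
  by the square of \<open>f\<close>, so two normalised forms differ by a function with square 1,
  whose derivative vanishes; a general factor would change d\<theta> by terms with df and would tilt
  the Reeb field. No partition of unity occurs. An operator acts over every open set, so the global
  one may be defined point by point from arbitrarily chosen local solutions, and its smoothness is
  checked near each point, where a single frame describes it. Much of the work is to obtain smooth
  objects: the contact form, the Reeb field and the frame all come from one abstract Gram-Schmidt
  process, used once with \<open>g\<close> on fields of \<open>H\<close> and once with the Euclidean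
  product on coordinate vectors.\<close>

lemma frechet_derivative_cong_open:
  assumes "open S" "x \<in> S" "\<And>y. y \<in> S \<Longrightarrow> f y = g y"
  shows "frechet_derivative f (at x) = frechet_derivative g (at x)"
    and "f differentiable (at x) \<longleftrightarrow> g differentiable (at x)"
proof -
  have "(f has_derivative D) (at x) \<longleftrightarrow> (g has_derivative D) (at x)" for D
    using has_derivative_transform_within_open[of f D x UNIV S g]
      has_derivative_transform_within_open[of g D x UNIV S f] assms by auto
  then show "frechet_derivative f (at x) = frechet_derivative g (at x)"
    and "f differentiable (at x) \<longleftrightarrow> g differentiable (at x)"
    by (auto simp: frechet_derivative_def differentiable_def)
qed

lemma Ck_on_cong:
  assumes "open S" "\<And>x. x \<in> S \<Longrightarrow> f x = g x"
  shows "Ck_on k S f \<longleftrightarrow> Ck_on k S g"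
  using assms(2)
proof (induction k arbitrary: f g)
  case 0
  then show ?case by (auto intro: continuous_on_cong)
next
  case (Suc k)
  show ?case
    using frechet_derivative_cong_open[OF assms(1) _ Suc.prems]
      Suc.IH[of "\<lambda>x. frechet_derivative f (at x) v" "\<lambda>x. frechet_derivative g (at x) v" for v]
    by auto
qed

lemma Ck_on_subset: "Ck_on k S f \<Longrightarrow> T \<subseteq> S \<Longrightarrow> Ck_on k T f"
  by (induction k arbitrary: f) (auto intro: continuous_on_subset)

text \<open>Derivatives are taken \<open>at x\<close> in the whole space and not within
  \<open>S\<close>, so the condition at a point does not refer to \<open>S\<close>; the same
  neighbourhood \<open>T\<close> serves every order in the induction.\<close>

lemma Ck_on_local:
  assumes "\<And>x. x \<in> S \<Longrightarrow> \<exists>T. open T \<and> x \<in> T \<and> Ck_on k T f"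
  shows "Ck_on k S f"
  using assms
proof (induction k arbitrary: f)
  case 0
  then show ?case
    by (metis Ck_on.simps(1) continuous_at_imp_continuous_on continuous_on_eq_continuous_at)
next
  case (Suc k)
  have "f differentiable (at x)" if "x \<in> S" for x
    using Suc.prems[OF that] by auto
  moreover have "Ck_on k S (\<lambda>x. frechet_derivative f (at x) v)" for v
  proof (rule Suc.IH)
    fix x assume "x \<in> S"
    with Suc.prems[OF this] show "\<exists>T. open T \<and> x \<in> T \<and> Ck_on k T (\<lambda>x. frechet_derivative f (at x) v)"
      by auto
  qed
  ultimately show ?case by simp
qed

lemma Ck_on_continuous: "Ck_on k S f \<Longrightarrow> continuous_on S f"
  by (cases k) (auto intro!: continuous_at_imp_continuous_on differentiable_imp_continuous_within)

lemma Ck_on_Suc_imp: "Ck_on (Suc k) S f \<Longrightarrow> Ck_on k S f"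
proof (induction k arbitrary: f)
  case 0
  then show ?case by (auto intro!: continuous_at_imp_continuous_on differentiable_imp_continuous_within)
qed auto

text \<open>Lets the derivative be supplied by a formula. Openness of \<open>S\<close> makes the
  formula agree with \<open>frechet_derivative\<close> on a neighbourhood, which is what the higher
  derivatives see.\<close>

lemma Ck_on_SucI:
  assumes "open S" "\<And>x. x \<in> S \<Longrightarrow> (f has_derivative f' x) (at x)" "\<And>v. Ck_on k S (\<lambda>x. f' x v)"
  shows "Ck_on (Suc k) S f"
proof -
  have "frechet_derivative f (at x) = f' x" if "x \<in> S" for x
    using assms(2)[OF that] frechet_derivative_at by metis
  then have "Ck_on k S (\<lambda>x. frechet_derivative f (at x) v)" for v
    using Ck_on_cong[OF assms(1), of "\<lambda>x. frechet_derivative f (at x) v" "\<lambda>x. f' x v" k] assms(3) by simp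
  then show ?thesis using assms(2) by (auto simp: differentiable_def)
qed

lemma Ck_on_has_derivative:
  "Ck_on (Suc k) S f \<Longrightarrow> x \<in> S \<Longrightarrow> (f has_derivative frechet_derivative f (at x)) (at x)"
  by (simp add: frechet_derivative_works)

lemma Ck_on_const: "open S \<Longrightarrow> Ck_on k S (\<lambda>x. c)"
proof (induction k arbitrary: c)
  case (Suc k)
  show ?case by (rule Ck_on_SucI[of _ _ "\<lambda>x v. 0"]) (use Suc in auto)
qed simp

lemma Ck_on_add: "open S \<Longrightarrow> Ck_on k S f \<Longrightarrow> Ck_on k S g \<Longrightarrow> Ck_on k S (\<lambda>x. f x + g x)"
proof (induction k arbitrary: f g)
  case (Suc k)
  show ?case
    by (rule Ck_on_SucI[of _ _ "\<lambda>x v. frechet_derivative f (at x) v + frechet_derivative g (at x) v"])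
      (use Suc in \<open>auto intro!: has_derivative_add Ck_on_has_derivative\<close>)
qed (auto intro: continuous_on_add)

text \<open>By the product rule the derivative is a sum of two terms of the same shape, each pairing
  one factor with a derivative of the other; hence the generalisation over \<open>f\<close> and
  \<open>g\<close> and the weakening of both to order \<open>k\<close>.\<close>

lemma Ck_on_bilinear:
  assumes "bounded_bilinear B" "open S"
  shows "Ck_on k S f \<Longrightarrow> Ck_on k S g \<Longrightarrow> Ck_on k S (\<lambda>x. B (f x) (g x))"
proof (induction k arbitrary: f g)
  case 0
  then show ?case using bounded_bilinear.continuous_on[OF assms(1)] by auto
next
  case (Suc k)
  have "Ck_on k S f" "Ck_on k S g"
    using Suc.prems Ck_on_Suc_imp by blast+
  show ?case
    by (rule Ck_on_SucI[of _ _ "\<lambda>x v. B (f x) (frechet_derivative g (at x) v) + B (frechet_derivative f (at x) v) (g x)"])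
      (use Suc \<open>Ck_on k S f\<close> \<open>Ck_on k S g\<close> assms(2) in
        \<open>auto intro!: bounded_bilinear.FDERIV[OF assms(1)] Ck_on_has_derivative Ck_on_add\<close>)
qed

lemma Ck_on_sum:
  "open S \<Longrightarrow> (\<And>i. i \<in> I \<Longrightarrow> Ck_on k S (f i)) \<Longrightarrow> Ck_on k S (\<lambda>x. \<Sum>i\<in>I. f i x)"
  by (induction I rule: infinite_finite_induct) (auto intro: Ck_on_const Ck_on_add)

text \<open>Turns a derivative along a varying direction into a finite combination of derivatives
  along fixed vectors, the kind that \<open>Ck_on\<close> controls.\<close>

lemma linear_basis_expansion:
  fixes L :: "'e::euclidean_space \<Rightarrow> 'f::real_vector"
  assumes "linear L"
  shows "L v = (\<Sum>b\<in>Basis. (v \<bullet> b) *\<^sub>R L b)"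
proof -
  have "L v = L (\<Sum>b\<in>Basis. (v \<bullet> b) *\<^sub>R b)" by (simp add: euclidean_representation)
  then show ?thesis by (simp add: linear_sum[OF assms] linear_scale[OF assms])
qed

text \<open>In the chain rule the inner derivative is a direction that varies with \<open>x\<close>,
  so the outer derivative is expanded over \<open>Basis\<close>; this is why the middle space is
  Euclidean. Each summand multiplies a component of the derivative of \<open>f\<close> by a
  composite to which the induction hypothesis applies.\<close>

lemma Ck_on_compose:
  fixes f :: "'d::real_normed_vector \<Rightarrow> 'e::euclidean_space" and g :: "'e \<Rightarrow> 'f::real_normed_vector"
  assumes "open S" "open T" "f ` S \<subseteq> T"
  shows "Ck_on k S f \<Longrightarrow> Ck_on k T g \<Longrightarrow> Ck_on k S (\<lambda>x. g (f x))"
proof (induction k arbitrary: g)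
  case 0
  then show ?case using assms(3) by (auto intro: continuous_on_compose2)
next
  case (Suc k)
  have fk: "Ck_on k S f" using Suc.prems Ck_on_Suc_imp by blast
  show ?case
  proof (rule Ck_on_SucI[OF assms(1)])
    show "((\<lambda>x. g (f x)) has_derivative
        (\<lambda>v. \<Sum>b\<in>Basis. (frechet_derivative f (at x) v \<bullet> b) *\<^sub>R frechet_derivative g (at (f x)) b)) (at x)"
      if "x \<in> S" for x
    proof -
      have gd: "(g has_derivative frechet_derivative g (at (f x))) (at (f x))"
        using Ck_on_has_derivative[OF Suc.prems(2)] assms(3) that by auto
      then have "linear (frechet_derivative g (at (f x)))"
        by (simp add: has_derivative_linear)
      then have "(\<Sum>b\<in>Basis. (w \<bullet> b) *\<^sub>R frechet_derivative g (at (f x)) b) = frechet_derivative g (at (f x)) w" for w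
        using linear_basis_expansion by metis
      then show ?thesis
        using diff_chain_at[OF Ck_on_has_derivative[OF Suc.prems(1) that] gd] by (simp add: o_def)
    qed
    have "Ck_on k S (\<lambda>x. frechet_derivative g (at (f x)) b)" for b
      using Suc.IH[of "\<lambda>y. frechet_derivative g (at y) b"] Suc.prems fk by simp
    then show "Ck_on k S (\<lambda>x. \<Sum>b\<in>Basis. (frechet_derivative f (at x) v \<bullet> b) *\<^sub>R frechet_derivative g (at (f x)) b)" for v
      using Suc.prems fk assms
      by (intro Ck_on_sum Ck_on_bilinear[OF bounded_bilinear_scaleR] Ck_on_bilinear[OF bounded_bilinear_inner]
          Ck_on_const) auto
  qed
qed

text \<open>The derivative is a product of the function itself with itself and a constant, so the
  induction on the order closes.\<close>

lemma Ck_on_inverse: "Ck_on k (- {0}) (inverse :: real \<Rightarrow> real)"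
proof (induction k)
  case 0
  show ?case by (auto intro!: continuous_intros)
next
  case (Suc k)
  show ?case
  proof (rule Ck_on_SucI[of _ _ "\<lambda>x v. - (inverse x * v * inverse x)"])
    show "Ck_on k (- {0::real}) (\<lambda>x. - (inverse x * v * inverse x))" for v :: real
      using Ck_on_bilinear[OF bounded_bilinear_mult, of "- {0}" k
          "\<lambda>x. inverse x * (- v)" inverse]
        Ck_on_bilinear[OF bounded_bilinear_mult, of "- {0}" k inverse "\<lambda>x. - v"]
        Suc by (auto simp: Ck_on_const)
  qed (auto intro!: has_derivative_inverse')
qed

text \<open>The derivative is a constant multiple of the inverse of \<open>sqrt\<close>, to which
  the induction hypothesis composed with \<open>Ck_on_inverse\<close> applies.\<close>

lemma Ck_on_sqrt: "Ck_on k {0<..} sqrt"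
proof (induction k)
  case 0
  show ?case by (auto intro!: continuous_intros)
next
  case (Suc k)
  show ?case
  proof (rule Ck_on_SucI[of _ _ "\<lambda>x v. v * (inverse (sqrt x) / 2)"])
    show "(sqrt has_derivative (\<lambda>v. v * (inverse (sqrt x) / 2))) (at x)" if "x \<in> {0<..}" for x
      using that DERIV_real_sqrt[of x] unfolding has_field_derivative_def
      by (metis greaterThan_iff mult.commute mult_commute_abs)
    have "Ck_on k {0<..} (\<lambda>x. inverse (sqrt x))"
      by (rule Ck_on_compose[OF _ _ _ Suc Ck_on_inverse]) auto
    then show "Ck_on k {0<..} (\<lambda>x. v * (inverse (sqrt x) / 2))" for v :: real
      using Ck_on_bilinear[OF bounded_bilinear_mult, of "{0<..}" k "\<lambda>x. v / 2" "\<lambda>x. inverse (sqrt x)"]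
      by (auto simp: Ck_on_const)
  qed auto
qed

section \<open>Smooth functions\<close>

lemma smooth_on_cong:
  "open S \<Longrightarrow> (\<And>x. x \<in> S \<Longrightarrow> f x = g x) \<Longrightarrow> smooth_on S f \<longleftrightarrow> smooth_on S g"
  by (simp add: smooth_on_def Ck_on_cong[of S f g])

lemma smooth_on_subset: "smooth_on S f \<Longrightarrow> T \<subseteq> S \<Longrightarrow> smooth_on T f"
  by (auto simp: smooth_on_def intro: Ck_on_subset)

lemma smooth_on_local:
  assumes "\<And>x. x \<in> S \<Longrightarrow> \<exists>T. open T \<and> x \<in> T \<and> smooth_on T f"
  shows "smooth_on S f"
  unfolding smooth_on_def using Ck_on_local[of S _ f] assms smooth_on_def by metis

lemma smooth_on_continuous: "smooth_on S f \<Longrightarrow> continuous_on S f"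
  using Ck_on_continuous smooth_on_def by blast

lemma smooth_on_differentiable: "smooth_on S f \<Longrightarrow> x \<in> S \<Longrightarrow> f differentiable (at x)"
  unfolding smooth_on_def by (metis Ck_on.simps(2))

lemma smooth_on_has_derivative:
  "smooth_on S f \<Longrightarrow> x \<in> S \<Longrightarrow> (f has_derivative frechet_derivative f (at x)) (at x)"
  using smooth_on_differentiable frechet_derivative_works by blast

lemma smooth_on_frechet: "smooth_on S f \<Longrightarrow> smooth_on S (\<lambda>x. frechet_derivative f (at x) v)"
  unfolding smooth_on_def by (metis Ck_on.simps(2))

lemma smooth_on_const: "open S \<Longrightarrow> smooth_on S (\<lambda>x. c)"
  by (simp add: smooth_on_def Ck_on_const)

lemma smooth_on_add: "open S \<Longrightarrow> smooth_on S f \<Longrightarrow> smooth_on S g \<Longrightarrow> smooth_on S (\<lambda>x. f x + g x)"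
  by (simp add: smooth_on_def Ck_on_add)

lemma smooth_on_bilinear:
  "bounded_bilinear B \<Longrightarrow> open S \<Longrightarrow> smooth_on S f \<Longrightarrow> smooth_on S g \<Longrightarrow> smooth_on S (\<lambda>x. B (f x) (g x))"
  by (simp add: smooth_on_def Ck_on_bilinear)

lemmas smooth_on_scaleR = smooth_on_bilinear[OF bounded_bilinear_scaleR]
  and smooth_on_inner = smooth_on_bilinear[OF bounded_bilinear_inner]
  and smooth_on_mult = smooth_on_bilinear[OF bounded_bilinear_mult]

lemma smooth_on_sum:
  "open S \<Longrightarrow> (\<And>i. i \<in> I \<Longrightarrow> smooth_on S (f i)) \<Longrightarrow> smooth_on S (\<lambda>x. \<Sum>i\<in>I. f i x)"
  by (simp add: smooth_on_def Ck_on_sum)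

lemma smooth_on_compose:
  fixes f :: "'d::real_normed_vector \<Rightarrow> 'e::euclidean_space" and g :: "'e \<Rightarrow> 'f::real_normed_vector"
  shows "open S \<Longrightarrow> open T \<Longrightarrow> f ` S \<subseteq> T \<Longrightarrow> smooth_on S f \<Longrightarrow> smooth_on T g \<Longrightarrow> smooth_on S (\<lambda>x. g (f x))"
  by (simp add: smooth_on_def Ck_on_compose[of S T f])

lemma smooth_on_inverse:
  fixes f :: "'d::real_normed_vector \<Rightarrow> real"
  assumes "open S" "smooth_on S f" "\<And>x. x \<in> S \<Longrightarrow> f x \<noteq> 0"
  shows "smooth_on S (\<lambda>x. inverse (f x))"
  by (rule smooth_on_compose[of S "- {0}" f inverse]) (use assms Ck_on_inverse in \<open>auto simp: smooth_on_def\<close>)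

lemma smooth_on_sqrt:
  fixes f :: "'d::real_normed_vector \<Rightarrow> real"
  assumes "open S" "smooth_on S f" "\<And>x. x \<in> S \<Longrightarrow> f x > 0"
  shows "smooth_on S (\<lambda>x. sqrt (f x))"
  by (rule smooth_on_compose[of S "{0<..}" f sqrt]) (use assms Ck_on_sqrt in \<open>auto simp: smooth_on_def\<close>)

text \<open>The direction \<open>h x\<close> varies, hence the expansion over \<open>Basis\<close>.
  It serves the change of coordinates of vector fields and the differentiation of functions along
  them.\<close>

lemma smooth_on_frechet_apply:
  fixes f :: "'d::euclidean_space \<Rightarrow> 'e::real_normed_vector"
  assumes "open S" "smooth_on S f" "smooth_on S h"
  shows "smooth_on S (\<lambda>x. frechet_derivative f (at x) (h x))"
proof -
  have "frechet_derivative f (at x) (h x) = (\<Sum>b\<in>Basis. (h x \<bullet> b) *\<^sub>R frechet_derivative f (at x) b)" if "x \<in> S" for x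
    using smooth_on_has_derivative[OF assms(2) that] has_derivative_linear linear_basis_expansion by blast
  moreover have "smooth_on S (\<lambda>x. \<Sum>b\<in>Basis. (h x \<bullet> b) *\<^sub>R frechet_derivative f (at x) b)"
    using assms by (intro smooth_on_sum smooth_on_scaleR smooth_on_inner smooth_on_const smooth_on_frechet)
  ultimately show ?thesis using smooth_on_cong[OF assms(1)] by (metis (no_types, lifting))
qed

section \<open>Symmetry of second derivatives\<close>

text \<open>Two applications of the mean value theorem to the second difference of f along u and v.\<close>

lemma second_difference_mvt:
  fixes f :: "'e::real_normed_vector \<Rightarrow> real"
  assumes "h > 0" and sub: "\<And>s t. 0 \<le> s \<Longrightarrow> s \<le> h \<Longrightarrow> 0 \<le> t \<Longrightarrow> t \<le> h \<Longrightarrow> x + s *\<^sub>R u + t *\<^sub>R v \<in> S"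
    and sm: "smooth_on S f"
  shows "\<exists>s t. 0 < s \<and> s < h \<and> 0 < t \<and> t < h \<and>
    f (x + h *\<^sub>R u + h *\<^sub>R v) - f (x + h *\<^sub>R u) - f (x + h *\<^sub>R v) + f x =
    h * h * frechet_derivative (\<lambda>y. frechet_derivative f (at y) u) (at (x + s *\<^sub>R u + t *\<^sub>R v)) v"
proof -
  define fu where "fu = (\<lambda>y. frechet_derivative f (at y) u)"
  have line: "((\<lambda>s. F (y + s *\<^sub>R w)) has_real_derivative frechet_derivative F (at (y + s *\<^sub>R w)) w) (at s)"
    if "smooth_on S F" "y + s *\<^sub>R w \<in> S" for F y w s
  proof -
    have "((\<lambda>s. y + s *\<^sub>R w) has_derivative (\<lambda>r. r *\<^sub>R w)) (at s)"
      by (auto intro!: derivative_eq_intros)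
    from diff_chain_at[OF this smooth_on_has_derivative[OF that]]
    have "((\<lambda>s. F (y + s *\<^sub>R w)) has_derivative (\<lambda>r. frechet_derivative F (at (y + s *\<^sub>R w)) (r *\<^sub>R w))) (at s)"
      by (simp add: o_def)
    moreover have "(\<lambda>r. frechet_derivative F (at (y + s *\<^sub>R w)) (r *\<^sub>R w)) = (*) (frechet_derivative F (at (y + s *\<^sub>R w)) w)"
      using has_derivative_linear[OF smooth_on_has_derivative[OF that]] by (simp add: fun_eq_iff linear_scale)
    ultimately show ?thesis unfolding has_field_derivative_def by simp
  qed
  \<comment> \<open>The first difference along \<open>v\<close>, so that the second difference is
    \<open>\<phi> h - \<phi> 0\<close>; the mean value theorem is applied to it along
    \<open>u\<close>, and afterwards to \<open>fu\<close> along \<open>v\<close>.\<close>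
  define \<phi> where "\<phi> s = f ((x + h *\<^sub>R v) + s *\<^sub>R u) - f (x + s *\<^sub>R u)" for s
  have "\<exists>s. 0 < s \<and> s < h \<and> \<phi> h - \<phi> 0 = (h - 0) * (fu ((x + h *\<^sub>R v) + s *\<^sub>R u) - fu (x + s *\<^sub>R u))"
  proof (rule MVT2[OF \<open>h > 0\<close>])
    fix s assume s: "0 \<le> s" "s \<le> h"
    have 1: "(x + h *\<^sub>R v) + s *\<^sub>R u \<in> S" "x + s *\<^sub>R u \<in> S"
      using sub[OF s, of h] sub[OF s, of 0] \<open>h > 0\<close> by (auto simp: algebra_simps)
    show "(\<phi> has_real_derivative (fu ((x + h *\<^sub>R v) + s *\<^sub>R u) - fu (x + s *\<^sub>R u))) (at s)"
      unfolding \<phi>_def fu_def by (rule DERIV_diff[OF line[OF sm 1(1)] line[OF sm 1(2)]])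
  qed
  then obtain s where s: "0 < s" "s < h" "\<phi> h - \<phi> 0 = h * (fu ((x + s *\<^sub>R u) + h *\<^sub>R v) - fu ((x + s *\<^sub>R u) + 0 *\<^sub>R v))"
    by (auto simp: algebra_simps)
  have fusm: "smooth_on S fu" unfolding fu_def by (rule smooth_on_frechet[OF sm])
  have "\<exists>t. 0 < t \<and> t < h \<and> fu ((x + s *\<^sub>R u) + h *\<^sub>R v) - fu ((x + s *\<^sub>R u) + 0 *\<^sub>R v)
      = (h - 0) * frechet_derivative fu (at ((x + s *\<^sub>R u) + t *\<^sub>R v)) v"
  proof (rule MVT2[OF \<open>h > 0\<close>])
    fix t assume t: "0 \<le> t" "t \<le> h"
    show "((\<lambda>t. fu ((x + s *\<^sub>R u) + t *\<^sub>R v)) has_real_derivative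
        frechet_derivative fu (at ((x + s *\<^sub>R u) + t *\<^sub>R v)) v) (at t)"
      by (rule line[OF fusm sub]) (use s t in auto)
  qed
  then obtain t where t: "0 < t" "t < h" "fu ((x + s *\<^sub>R u) + h *\<^sub>R v) - fu ((x + s *\<^sub>R u) + 0 *\<^sub>R v)
      = h * frechet_derivative fu (at ((x + s *\<^sub>R u) + t *\<^sub>R v)) v" by auto
  have "f (x + h *\<^sub>R u + h *\<^sub>R v) - f (x + h *\<^sub>R u) - f (x + h *\<^sub>R v) + f x = \<phi> h - \<phi> 0"
    by (simp add: \<phi>_def algebra_simps)
  then show ?thesis using s t unfolding fu_def
    by (intro exI[of _ s] exI[of _ t]) (auto simp: algebra_simps)
qed

text \<open>The second difference is symmetric in \<open>u\<close> and \<open>v\<close>, so a value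
  of one mixed derivative equals a value of the other, at points that may differ but both lie near
  \<open>x\<close>; continuity then excludes a gap at \<open>x\<close>.\<close>

lemma second_derivative_symmetric_real:
  fixes f :: "'e::real_normed_vector \<Rightarrow> real"
  assumes "open S" "x \<in> S" and sm: "smooth_on S f"
  shows "frechet_derivative (\<lambda>y. frechet_derivative f (at y) u) (at x) v =
    frechet_derivative (\<lambda>y. frechet_derivative f (at y) v) (at x) u" (is "?A x = ?B x")
proof (rule ccontr)
  assume ne: "?A x \<noteq> ?B x"
  \<comment> \<open>Half of the supposed gap: a value of \<open>?A\<close> and a value of
    \<open>?B\<close>, each strictly within \<open>e\<close> of its value at \<open>x\<close>,
    cannot be equal.\<close>
  define e where "e = \<bar>?A x - ?B x\<bar> / 2"
  have "e > 0" using ne by (simp add: e_def)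
  have cA: "continuous_on S ?A" and cB: "continuous_on S ?B"
    by (auto intro!: smooth_on_continuous smooth_on_frechet sm)
  obtain d0 where d0: "d0 > 0" "ball x d0 \<subseteq> S" using assms(1,2) openE by blast
  obtain d1 where d1: "d1 > 0" "\<And>y. y \<in> S \<Longrightarrow> dist y x < d1 \<Longrightarrow> dist (?A y) (?A x) < e"
    using cA \<open>x \<in> S\<close> \<open>e > 0\<close> unfolding continuous_on_iff by metis
  obtain d2 where d2: "d2 > 0" "\<And>y. y \<in> S \<Longrightarrow> dist y x < d2 \<Longrightarrow> dist (?B y) (?B x) < e"
    using cB \<open>x \<in> S\<close> \<open>e > 0\<close> unfolding continuous_on_iff by metis
  define d where "d = min d0 (min d1 d2)"
  \<comment> \<open>The summand 1 keeps \<open>c\<close> positive even if both vectors vanish; with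
    \<open>h = d / (2 * c)\<close> the parallelogram with sides \<open>h *\<^sub>R u\<close> and
    \<open>h *\<^sub>R v\<close> at \<open>x\<close> stays within distance
    \<open>d / 2\<close>.\<close>
  define c where "c = norm u + norm v + 1"
  define h where "h = d / (2 * c)"
  have "d > 0" using d0 d1 d2 by (simp add: d_def)
  have nn: "c > 0" unfolding c_def by (smt (verit) norm_ge_zero)
  have "h > 0" using \<open>d > 0\<close> nn by (simp add: h_def)
  have near: "dist (x + s *\<^sub>R u + t *\<^sub>R v) x < d" if "0 \<le> s" "s \<le> h" "0 \<le> t" "t \<le> h" for s t
  proof -
    have "dist (x + s *\<^sub>R u + t *\<^sub>R v) x = norm (s *\<^sub>R u + t *\<^sub>R v)" by (simp add: dist_norm)
    also have "\<dots> \<le> s * norm u + t * norm v" using that norm_triangle_ineq[of "s *\<^sub>R u" "t *\<^sub>R v"] by simp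
    also have "\<dots> \<le> h * norm u + h * norm v" using that by (intro add_mono mult_right_mono) auto
    also have "\<dots> \<le> h * (norm u + norm v + 1)" using \<open>h > 0\<close> by (simp add: algebra_simps)
    also have "\<dots> = d / 2" using nn unfolding h_def c_def[symmetric] by simp
    finally show ?thesis using \<open>d > 0\<close> by simp
  qed
  have inS: "x + s *\<^sub>R u + t *\<^sub>R v \<in> S" if "0 \<le> s" "s \<le> h" "0 \<le> t" "t \<le> h" for s t
    using near[OF that] d0 by (auto simp: d_def dist_commute subset_iff)
  have inS': "x + s *\<^sub>R v + t *\<^sub>R u \<in> S" if "0 \<le> s" "s \<le> h" "0 \<le> t" "t \<le> h" for s t
    using inS[OF that(3,4,1,2)] by (simp add: algebra_simps)
  obtain s t where st: "0 < s" "s < h" "0 < t" "t < h"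
     "f (x + h *\<^sub>R u + h *\<^sub>R v) - f (x + h *\<^sub>R u) - f (x + h *\<^sub>R v) + f x = h * h * ?A (x + s *\<^sub>R u + t *\<^sub>R v)"
    using second_difference_mvt[OF \<open>h > 0\<close> inS sm] by auto
  obtain s' t' where st': "0 < s'" "s' < h" "0 < t'" "t' < h"
     "f (x + h *\<^sub>R v + h *\<^sub>R u) - f (x + h *\<^sub>R v) - f (x + h *\<^sub>R u) + f x = h * h * ?B (x + s' *\<^sub>R v + t' *\<^sub>R u)"
    using second_difference_mvt[OF \<open>h > 0\<close> inS' sm] by auto
  have "h * h * ?A (x + s *\<^sub>R u + t *\<^sub>R v) = h * h * ?B (x + t' *\<^sub>R u + s' *\<^sub>R v)"
    using st(5) st'(5) by (simp add: algebra_simps)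
  then have eq: "?A (x + s *\<^sub>R u + t *\<^sub>R v) = ?B (x + t' *\<^sub>R u + s' *\<^sub>R v)" using \<open>h > 0\<close> by simp
  have "dist (?A (x + s *\<^sub>R u + t *\<^sub>R v)) (?A x) < e"
    using near[of s t] inS[of s t] st by (intro d1) (auto simp: d_def)
  moreover have "dist (?B (x + t' *\<^sub>R u + s' *\<^sub>R v)) (?B x) < e"
    using near[of t' s'] inS[of t' s'] st' by (intro d2) (auto simp: d_def)
  ultimately show False using eq by (simp add: dist_real_def e_def) (smt (verit, best) field_sum_of_halves)
qed

text \<open>The mean value argument needs real values, so it is applied to every coordinate; the
  inner product with a fixed \<open>b\<close> commutes with the derivative.\<close>

lemma second_derivative_symmetric:
  fixes f :: "'e::real_normed_vector \<Rightarrow> 'f::euclidean_space"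
  assumes "open S" "x \<in> S" and sm: "smooth_on S f"
  shows "frechet_derivative (\<lambda>y. frechet_derivative f (at y) u) (at x) v =
    frechet_derivative (\<lambda>y. frechet_derivative f (at y) v) (at x) u"
proof (rule euclidean_eqI)
  fix b :: 'f assume "b \<in> Basis"
  have comp: "frechet_derivative (\<lambda>z. F z \<bullet> b) (at y) w = frechet_derivative F (at y) w \<bullet> b"
    if "smooth_on S F" "y \<in> S" for F :: "'e \<Rightarrow> 'f" and y w
    using frechet_derivative_at[OF has_derivative_inner_left[OF smooth_on_has_derivative[OF that], of b]]
    by metis
  have two: "frechet_derivative (\<lambda>y. frechet_derivative f (at y) u) (at x) v \<bullet> b =
     frechet_derivative (\<lambda>y. frechet_derivative (\<lambda>z. f z \<bullet> b) (at y) u) (at x) v" for u v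
  proof -
    have "frechet_derivative (\<lambda>y. frechet_derivative f (at y) u) (at x) v \<bullet> b =
      frechet_derivative (\<lambda>y. frechet_derivative f (at y) u \<bullet> b) (at x) v"
      by (simp add: comp[OF smooth_on_frechet[OF sm] \<open>x \<in> S\<close>])
    also have "\<dots> = frechet_derivative (\<lambda>y. frechet_derivative (\<lambda>z. f z \<bullet> b) (at y) u) (at x) v"
      by (rule fun_cong[OF frechet_derivative_cong_open(1)[OF assms(1,2)]]) (simp add: comp[OF sm])
    finally show ?thesis .
  qed
  have "smooth_on S (\<lambda>z. f z \<bullet> b)"
    by (intro smooth_on_inner smooth_on_const sm assms)
  then show "frechet_derivative (\<lambda>y. frechet_derivative f (at y) u) (at x) v \<bullet> b =
    frechet_derivative (\<lambda>y. frechet_derivative f (at y) v) (at x) u \<bullet> b"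
    unfolding two using second_derivative_symmetric_real[OF assms(1,2)] by blast
qed

section \<open>Charts, tangent vectors and smooth functions\<close>

lemma scaleR_fun_apply [simp]: "(r *\<^sub>R f) x = r *\<^sub>R f x"
  by (simp add: scaleR_fun_def)

lemma sum_fun_apply: "(\<Sum>i\<in>A. f i) x = (\<Sum>i\<in>A. f i x)"
  by (induction A rule: infinite_finite_induct) auto

lemma restr_apply [simp]: "p \<in> V \<Longrightarrow> restr V s p = s p" "p \<notin> V \<Longrightarrow> restr V s p = 0"
  by (auto simp: restr_def)

locale smooth_mfd =
  fixes M :: "('a, 'e::euclidean_space) manifold"
  assumes smooth_manifold: "smooth_manifold M"
begin

lemma openin_point: "openin (mtop M) U \<Longrightarrow> p \<in> U \<Longrightarrow> p \<in> topspace (mtop M)"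
  using openin_subset by blast

lemma charts_atD: "c \<in> charts_at M p \<Longrightarrow> c \<in> atlas M" "c \<in> charts_at M p \<Longrightarrow> p \<in> fst c"
  by (auto simp: charts_at_def)

lemma charts_atI: "c \<in> atlas M \<Longrightarrow> p \<in> fst c \<Longrightarrow> c \<in> charts_at M p"
  by (auto simp: charts_at_def)

lemma chart_at: "p \<in> topspace (mtop M) \<Longrightarrow> chart_at M p \<in> charts_at M p"
  using smooth_manifold unfolding chart_at_def by (auto simp: smooth_manifold_def intro: someI)

lemma chart_at_charts_at: "c \<in> charts_at M p \<Longrightarrow> chart_at M p \<in> charts_at M p"
  unfolding chart_at_def by (rule someI)

lemma chart_domain_open: "c \<in> atlas M \<Longrightarrow> openin (mtop M) (fst c)"
  and chart_range_open: "c \<in> atlas M \<Longrightarrow> open (snd c ` fst c)"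
  and chart_homeo: "c \<in> atlas M \<Longrightarrow>
    homeomorphic_map (subtopology (mtop M) (fst c)) (top_of_set (snd c ` fst c)) (snd c)"
  and transition_smooth: "c \<in> atlas M \<Longrightarrow> c' \<in> atlas M \<Longrightarrow>
    smooth_on (snd c ` (fst c \<inter> fst c')) (snd c' \<circ> chart_inv c)"
  using smooth_manifold by (simp_all add: smooth_manifold_def)

lemma charts_at_topspace: "c \<in> charts_at M p \<Longrightarrow> p \<in> topspace (mtop M)"
  using charts_atD[of c p] openin_subset[OF chart_domain_open[of c]] by blast

lemma chart_inj: "c \<in> atlas M \<Longrightarrow> inj_on (snd c) (fst c)"
  using chart_homeo[of c] chart_domain_open[of c]
  by (metis homeomorphic_imp_injective_map openin_subset topspace_subtopology_subset)

lemma chart_inv_left [simp]: "c \<in> atlas M \<Longrightarrow> p \<in> fst c \<Longrightarrow> chart_inv c (snd c p) = p"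
  by (simp add: chart_inv_def chart_inj)

lemma chart_inv_left_pair [simp]: "(A, \<phi>) \<in> atlas M \<Longrightarrow> p \<in> A \<Longrightarrow> chart_inv (A, \<phi>) (\<phi> p) = p"
  using chart_inv_left[of "(A, \<phi>)" p] by simp

lemma chart_image_open:
  assumes "c \<in> atlas M" "openin (mtop M) U"
  shows "open (snd c ` (U \<inter> fst c))"
proof -
  have "open_map (subtopology (mtop M) (fst c)) (top_of_set (snd c ` fst c)) (snd c)"
    using chart_homeo[OF assms(1)] homeomorphic_imp_open_map by blast
  moreover have "openin (subtopology (mtop M) (fst c)) (U \<inter> fst c)"
    using assms(2) by (rule openin_subtopology_Int)
  ultimately show ?thesis
    using openin_open_eq[OF chart_range_open[OF assms(1)]] unfolding open_map_def by blast
qed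

lemma chart_preimage_open:
  assumes "c \<in> atlas M" "open A"
  shows "openin (mtop M) {p \<in> fst c. snd c p \<in> A}"
proof -
  have "continuous_map (subtopology (mtop M) (fst c)) (top_of_set (snd c ` fst c)) (snd c)"
    using chart_homeo[OF assms(1)] homeomorphic_imp_continuous_map by blast
  then have "continuous_map (subtopology (mtop M) (fst c)) euclidean (snd c)"
    using continuous_map_into_fulltopology by blast
  then have "openin (subtopology (mtop M) (fst c)) {p \<in> topspace (subtopology (mtop M) (fst c)). snd c p \<in> A}"
    using assms(2) by (intro openin_continuous_map_preimage) auto
  moreover have "topspace (subtopology (mtop M) (fst c)) = fst c"
    using openin_subset[OF chart_domain_open[OF assms(1)]] by (rule topspace_subtopology_subset)
  ultimately show ?thesis
    using chart_domain_open[OF assms(1)] by (metis openin_trans_full)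
qed

section \<open>Jacobians of coordinate changes and tangent spaces\<close>

lemma jacobian_has_derivative:
  assumes "c \<in> charts_at M p" "c' \<in> charts_at M p"
  shows "((snd c' \<circ> chart_inv c) has_derivative jacobian c c' p) (at (snd c p))"
  unfolding jacobian_def
  by (rule smooth_on_has_derivative[OF transition_smooth[of c c']]) (use assms in \<open>auto simp: charts_at_def\<close>)

lemma jacobian_linear: "c \<in> charts_at M p \<Longrightarrow> c' \<in> charts_at M p \<Longrightarrow> linear (jacobian c c' p)"
  using jacobian_has_derivative has_derivative_linear by blast

text \<open>The function read in \<open>c\<close> equals the composite through \<open>c'\<close>
  only over the overlap of the two charts, but the image of the overlap is open, which suffices for
  the derivative.\<close>

lemma chart_change_has_derivative:
  assumes "c \<in> charts_at M p" "c' \<in> charts_at M p"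
    and "(f \<circ> chart_inv c' has_derivative D) (at (snd c' p))"
  shows "(f \<circ> chart_inv c has_derivative D \<circ> jacobian c c' p) (at (snd c p))"
proof -
  note cs = charts_atD[OF assms(1)] charts_atD[OF assms(2)]
  have "((f \<circ> chart_inv c') \<circ> (snd c' \<circ> chart_inv c) has_derivative D \<circ> jacobian c c' p) (at (snd c p))"
    by (rule diff_chain_at[OF jacobian_has_derivative[OF assms(1,2)]]) (use assms cs in simp)
  then show ?thesis
  proof (rule has_derivative_transform_within_open)
    show "open (snd c ` (fst c' \<inter> fst c))"
      by (rule chart_image_open) (use cs chart_domain_open in auto)
  qed (use cs in auto)
qed

lemma jacobian_compose:
  assumes "c \<in> charts_at M p" "c' \<in> charts_at M p" "c'' \<in> charts_at M p"
  shows "jacobian c' c'' p (jacobian c c' p e) = jacobian c c'' p e"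
proof -
  have "(snd c'' \<circ> chart_inv c has_derivative jacobian c' c'' p \<circ> jacobian c c' p) (at (snd c p))"
    by (rule chart_change_has_derivative[OF assms(1,2) jacobian_has_derivative[OF assms(2,3)]])
  then have "jacobian c' c'' p \<circ> jacobian c c' p = jacobian c c'' p"
    by (rule has_derivative_unique[OF _ jacobian_has_derivative[OF assms(1,3)]])
  then show ?thesis by (metis comp_apply)
qed

lemma jacobian_self:
  assumes "c \<in> charts_at M p"
  shows "jacobian c c p e = e"
proof -
  note cs = charts_atD[OF assms(1)]
  have "(snd c \<circ> chart_inv c has_derivative id) (at (snd c p))"
  proof (rule has_derivative_transform_within_open[OF has_derivative_id])
    show "open (snd c ` fst c)" by (rule chart_range_open[OF cs(1)])
  qed (use cs in auto)
  from has_derivative_unique[OF jacobian_has_derivative[OF assms assms] this] show ?thesis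
    by simp
qed

lemma tangent_jacobian:
  "v \<in> tangent M p \<Longrightarrow> c \<in> charts_at M p \<Longrightarrow> c' \<in> charts_at M p \<Longrightarrow> v c' = jacobian c c' p (v c)"
  unfolding tangent_def by blast

lemma tangent_off_charts: "v \<in> tangent M p \<Longrightarrow> c \<notin> charts_at M p \<Longrightarrow> v c = 0"
  unfolding tangent_def by blast

lemma tangentI:
  "(\<And>c. c \<notin> charts_at M p \<Longrightarrow> v c = 0) \<Longrightarrow>
    (\<And>c c'. c \<in> charts_at M p \<Longrightarrow> c' \<in> charts_at M p \<Longrightarrow> v c' = jacobian c c' p (v c)) \<Longrightarrow> v \<in> tangent M p"
  unfolding tangent_def by blast

lemma coord_vec_tangent: "c \<in> charts_at M p \<Longrightarrow> coord_vec M c e p \<in> tangent M p"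
  by (rule tangentI) (auto simp: coord_vec_def jacobian_compose)

lemma coord_vec_self [simp]: "c \<in> charts_at M p \<Longrightarrow> coord_vec M c e p c = e"
  by (simp add: coord_vec_def jacobian_self)

text \<open>A tangent vector stores its coordinates in all charts, but the Jacobians recover them
  from a single one, and at charts not around \<open>p\<close> the value is 0.\<close>

lemma tangent_eqI:
  assumes "v \<in> tangent M p" "w \<in> tangent M p" "c \<in> charts_at M p" "v c = w c"
  shows "v = w"
proof
  fix c'
  show "v c' = w c'"
  proof (cases "c' \<in> charts_at M p")
    case True
    then show ?thesis using tangent_jacobian[OF assms(1,3)] tangent_jacobian[OF assms(2,3)] assms(4) by simp
  next
    case False
    then show ?thesis using tangent_off_charts[OF assms(1)] tangent_off_charts[OF assms(2)] by simp
  qed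
qed

lemma coord_vec_of_tangent: "v \<in> tangent M p \<Longrightarrow> c \<in> charts_at M p \<Longrightarrow> coord_vec M c (v c) p = v"
  by (rule tangent_eqI[of _ _ _ c]) (auto simp: coord_vec_tangent)

lemma coord_vec_add: "c \<in> charts_at M p \<Longrightarrow> coord_vec M c (a + b) p = coord_vec M c a p + coord_vec M c b p"
  by (auto simp: coord_vec_def fun_eq_iff linear_add[OF jacobian_linear])

lemma coord_vec_scaleR: "c \<in> charts_at M p \<Longrightarrow> coord_vec M c (r *\<^sub>R a) p = r *\<^sub>R coord_vec M c a p"
  by (auto simp: coord_vec_def fun_eq_iff linear_scale[OF jacobian_linear])

lemma coord_vec_basis:
  assumes "c \<in> charts_at M p"
  shows "coord_vec M c e p = (\<Sum>b\<in>Basis. (e \<bullet> b) *\<^sub>R coord_vec M c b p)"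
proof -
  have "linear (\<lambda>e. coord_vec M c e p)"
    by (rule linearI) (auto simp: coord_vec_add[OF assms] coord_vec_scaleR[OF assms])
  then show ?thesis by (rule linear_basis_expansion)
qed

lemma subspace_tangent: "p \<in> topspace (mtop M) \<Longrightarrow> subspace (tangent M p)"
  unfolding subspace_def
proof (intro conjI ballI allI)
  show "0 \<in> tangent M p"
    by (rule tangentI) (auto simp: linear_0[OF jacobian_linear])
  fix v w and r :: real assume v: "v \<in> tangent M p"
  show "r *\<^sub>R v \<in> tangent M p"
  proof (rule tangentI)
    fix c c' assume "c \<in> charts_at M p" "c' \<in> charts_at M p"
    then show "(r *\<^sub>R v) c' = jacobian c c' p ((r *\<^sub>R v) c)"
      using tangent_jacobian[OF v, of c c'] by (simp add: linear_scale[OF jacobian_linear])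
  qed (simp add: tangent_off_charts[OF v])
  assume w: "w \<in> tangent M p"
  show "v + w \<in> tangent M p"
  proof (rule tangentI)
    fix c c' assume "c \<in> charts_at M p" "c' \<in> charts_at M p"
    then show "(v + w) c' = jacobian c c' p ((v + w) c)"
      using tangent_jacobian[OF v, of c c'] tangent_jacobian[OF w, of c c']
      by (simp add: linear_add[OF jacobian_linear])
  qed (simp add: tangent_off_charts[OF v] tangent_off_charts[OF w])
qed

lemma tangent_sum:
  "p \<in> topspace (mtop M) \<Longrightarrow> (\<And>i. i \<in> I \<Longrightarrow> v i \<in> tangent M p) \<Longrightarrow> (\<Sum>i\<in>I. r i *\<^sub>R v i) \<in> tangent M p"
  using subspace_tangent by (intro subspace_sum subspace_scale) auto

subsection \<open>Smooth functions\<close>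

lemma smooth_fun_differentiable:
  assumes "openin (mtop M) U" "smooth_fun M U f" "p \<in> U" "c \<in> charts_at M p"
  shows "(f \<circ> chart_inv c has_derivative frechet_derivative (f \<circ> chart_inv c) (at (snd c p))) (at (snd c p))"
  using assms unfolding smooth_fun_def
  by (intro smooth_on_has_derivative[of "snd c ` (U \<inter> fst c)"]) (auto simp: charts_at_def)

text \<open>Smoothness in one chart near each point passes to any chart through the smooth
  transition maps. This is how computations in one chart yield \<open>smooth_fun\<close>, which
  ranges over the whole atlas.\<close>

lemma smooth_in_chartI:
  fixes f :: "'a \<Rightarrow> 'f::euclidean_space"
  assumes "\<And>p. p \<in> U \<Longrightarrow> \<exists>c W. c \<in> charts_at M p \<and> openin (mtop M) W \<and> p \<in> W \<and> smooth_on (snd c ` (W \<inter> fst c)) (f \<circ> chart_inv c)"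
    and "c' \<in> atlas M"
  shows "smooth_on (snd c' ` (U \<inter> fst c')) (f \<circ> chart_inv c')"
proof (rule smooth_on_local)
  fix x assume "x \<in> snd c' ` (U \<inter> fst c')"
  then obtain p where p: "p \<in> U" "p \<in> fst c'" "x = snd c' p" by auto
  then obtain c W where c: "c \<in> charts_at M p" "openin (mtop M) W" "p \<in> W"
      "smooth_on (snd c ` (W \<inter> fst c)) (f \<circ> chart_inv c)" using assms(1) by blast
  note cs = charts_atD[OF c(1)]
  let ?S = "snd c' ` ((W \<inter> fst c) \<inter> fst c')"
  have oS: "open ?S" by (rule chart_image_open[OF assms(2) openin_Int[OF c(2) chart_domain_open[OF cs(1)]]])
  have "smooth_on ?S (\<lambda>x. (f \<circ> chart_inv c) ((snd c \<circ> chart_inv c') x))"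
  proof (rule smooth_on_compose[OF oS _ _ _ c(4)])
    show "open (snd c ` (W \<inter> fst c))" by (rule chart_image_open) (use cs c in auto)
    show "smooth_on ?S (snd c \<circ> chart_inv c')"
      by (rule smooth_on_subset[OF transition_smooth[OF assms(2) cs(1)]]) auto
    show "(snd c \<circ> chart_inv c') ` ?S \<subseteq> snd c ` (W \<inter> fst c)"
      using assms(2) by auto
  qed
  then have "smooth_on ?S (f \<circ> chart_inv c')"
    by (subst smooth_on_cong[OF oS, of _ "\<lambda>x. (f \<circ> chart_inv c) ((snd c \<circ> chart_inv c') x)"]) (use assms(2) cs in auto)
  then show "\<exists>T. open T \<and> x \<in> T \<and> smooth_on T (f \<circ> chart_inv c')"
    using oS p c cs by (intro exI[of _ ?S]) auto
qed

lemma smooth_fun_local: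
  assumes "\<And>p. p \<in> U \<Longrightarrow> \<exists>W. openin (mtop M) W \<and> p \<in> W \<and> smooth_fun M W f"
  shows "smooth_fun M U f"
  unfolding smooth_fun_def
proof (intro ballI smooth_in_chartI)
  fix p assume "p \<in> U"
  with assms obtain W where W: "openin (mtop M) W" "p \<in> W" "smooth_fun M W f" by blast
  then show "\<exists>c W. c \<in> charts_at M p \<and> openin (mtop M) W \<and> p \<in> W \<and> smooth_on (snd c ` (W \<inter> fst c)) (f \<circ> chart_inv c)"
    by (intro exI[of _ "chart_at M p"] exI[of _ W])
      (use chart_at[OF openin_point[OF W(1,2)]] charts_atD in \<open>auto simp: smooth_fun_def\<close>)
qed

lemma smooth_fun_chartI:
  assumes "openin (mtop M) W" "c \<in> atlas M" "W \<subseteq> fst c" "smooth_on (snd c ` W) (f \<circ> chart_inv c)"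
  shows "smooth_fun M W f"
  unfolding smooth_fun_def
proof (intro ballI smooth_in_chartI)
  have "W \<inter> fst c = W" using assms(3) by blast
  then show "\<exists>c W. c \<in> charts_at M p \<and> openin (mtop M) W \<and> p \<in> W \<and> smooth_on (snd c ` (W \<inter> fst c)) (f \<circ> chart_inv c)"
    if "p \<in> W" for p
    using assms that by (intro exI[of _ c] exI[of _ W]) (auto intro: charts_atI)
qed

lemma smooth_fun_cong:
  assumes "openin (mtop M) U" "\<And>p. p \<in> U \<Longrightarrow> f p = g p"
  shows "smooth_fun M U f \<longleftrightarrow> smooth_fun M U g"
proof -
  have "smooth_on (snd c ` (U \<inter> fst c)) (f \<circ> chart_inv c) \<longleftrightarrow> smooth_on (snd c ` (U \<inter> fst c)) (g \<circ> chart_inv c)"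
    if "c \<in> atlas M" for c
    by (rule smooth_on_cong[OF chart_image_open[OF that assms(1)]]) (use assms(2) that in auto)
  then show ?thesis by (simp add: smooth_fun_def)
qed

lemma smooth_fun_subset: "smooth_fun M U f \<Longrightarrow> V \<subseteq> U \<Longrightarrow> smooth_fun M V f"
  unfolding smooth_fun_def by (meson Int_mono image_mono order_refl smooth_on_subset)

context
  fixes U assumes U: "openin (mtop M) U"
begin

lemma smooth_fun_const: "smooth_fun M U (\<lambda>p. r)"
  unfolding smooth_fun_def by (auto simp: comp_def intro!: smooth_on_const chart_image_open U)

lemma smooth_fun_add: "smooth_fun M U f \<Longrightarrow> smooth_fun M U g \<Longrightarrow> smooth_fun M U (\<lambda>p. f p + g p)"
  unfolding smooth_fun_def by (auto simp: comp_def intro!: smooth_on_add chart_image_open U)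

lemma smooth_fun_mult: "smooth_fun M U f \<Longrightarrow> smooth_fun M U g \<Longrightarrow> smooth_fun M U (\<lambda>p. f p * g p)"
  unfolding smooth_fun_def by (auto simp: comp_def intro!: smooth_on_mult chart_image_open U)

lemma smooth_fun_inverse:
  "smooth_fun M U f \<Longrightarrow> (\<And>p. p \<in> U \<Longrightarrow> f p \<noteq> 0) \<Longrightarrow> smooth_fun M U (\<lambda>p. inverse (f p))"
  unfolding smooth_fun_def by (auto simp: comp_def intro!: smooth_on_inverse chart_image_open U)

lemma smooth_fun_sqrt:
  "smooth_fun M U f \<Longrightarrow> (\<And>p. p \<in> U \<Longrightarrow> f p > 0) \<Longrightarrow> smooth_fun M U (\<lambda>p. sqrt (f p))"
  unfolding smooth_fun_def by (auto simp: comp_def intro!: smooth_on_sqrt chart_image_open U)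

lemma smooth_fun_uminus: "smooth_fun M U f \<Longrightarrow> smooth_fun M U (\<lambda>p. - f p)"
  using smooth_fun_mult[OF smooth_fun_const[of "-1"], of f] by simp

lemma smooth_fun_diff: "smooth_fun M U f \<Longrightarrow> smooth_fun M U g \<Longrightarrow> smooth_fun M U (\<lambda>p. f p - g p)"
  using smooth_fun_add[OF _ smooth_fun_uminus, of f g] by simp

lemma smooth_fun_sum: "(\<And>i. i \<in> I \<Longrightarrow> smooth_fun M U (f i)) \<Longrightarrow> smooth_fun M U (\<lambda>p. \<Sum>i\<in>I. f i p)"
  by (induction I rule: infinite_finite_induct) (auto intro: smooth_fun_const smooth_fun_add)

text \<open>Used to shrink a neighbourhood to one on which a constructed section, nonzero at the
  centre, stays nonzero.\<close>

lemma openin_smooth_nonzero: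
  assumes "smooth_fun M U f"
  shows "openin (mtop M) {p \<in> U. f p \<noteq> 0}"
proof (subst openin_subopen, intro ballI)
  fix p assume p: "p \<in> {p \<in> U. f p \<noteq> 0}"
  define c where "c = chart_at M p"
  have c: "c \<in> atlas M" "p \<in> fst c"
    using charts_atD[OF chart_at[OF openin_point[OF U, of p]]] p by (auto simp: c_def)
  let ?S = "snd c ` (U \<inter> fst c)"
  have oS: "open ?S" by (rule chart_image_open[OF c(1) U])
  have "continuous_on ?S (f \<circ> chart_inv c)"
    using assms c unfolding smooth_fun_def by (blast intro: smooth_on_continuous)
  then have oA: "open (?S \<inter> (f \<circ> chart_inv c) -` (- {0}))"
    using oS by (intro continuous_open_preimage) auto
  let ?W = "{q \<in> fst c. snd c q \<in> ?S \<inter> (f \<circ> chart_inv c) -` (- {0})}"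
  have "?W \<subseteq> {p \<in> U. f p \<noteq> 0}"
    using c chart_inj[OF c(1)] by (auto simp: inj_on_def)
  then show "\<exists>T. openin (mtop M) T \<and> p \<in> T \<and> T \<subseteq> {p \<in> U. f p \<noteq> 0}"
    using chart_preimage_open[OF c(1) oA] p c by (intro exI[of _ ?W]) auto
qed

end

subsection \<open>Directional derivatives\<close>

text \<open>\<open>dir_deriv\<close> uses the chosen chart at \<open>p\<close>; the chain rule and
  the Jacobian relation between the coordinates of \<open>v\<close> make the choice
  immaterial.\<close>

lemma dir_deriv_chart:
  assumes "openin (mtop M) U" "smooth_fun M U f" "p \<in> U" "c \<in> charts_at M p" "v \<in> tangent M p"
  shows "dir_deriv M p v f = frechet_derivative (f \<circ> chart_inv c) (at (snd c p)) (v c)"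
proof -
  let ?c = "chart_at M p"
  have c': "?c \<in> charts_at M p" by (rule chart_at_charts_at[OF assms(4)])
  have "(f \<circ> chart_inv ?c has_derivative frechet_derivative (f \<circ> chart_inv c) (at (snd c p)) \<circ> jacobian ?c c p) (at (snd ?c p))"
    by (rule chart_change_has_derivative[OF c' assms(4) smooth_fun_differentiable[OF assms(1-4)]])
  then show ?thesis
    using tangent_jacobian[OF assms(5) c' assms(4)]
    by (simp add: dir_deriv_def Let_def frechet_derivative_at[symmetric])
qed

lemma dir_deriv_cong:
  assumes "openin (mtop M) U" "p \<in> U" "\<And>q. q \<in> U \<Longrightarrow> f q = g q"
  shows "dir_deriv M p v f = dir_deriv M p v g"
proof -
  let ?c = "chart_at M p"
  note c = charts_atD[OF chart_at[OF openin_point[OF assms(1,2)]]]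
  have "frechet_derivative (f \<circ> chart_inv ?c) (at (snd ?c p)) = frechet_derivative (g \<circ> chart_inv ?c) (at (snd ?c p))"
    by (rule frechet_derivative_cong_open[OF chart_image_open[OF c(1) assms(1)]]) (use assms c in auto)
  then show ?thesis by (simp add: dir_deriv_def)
qed

lemma dir_deriv_const [simp]: "dir_deriv M p v (\<lambda>q. r) = 0"
  by (simp add: dir_deriv_def comp_def frechet_derivative_const)

lemma dir_deriv_eq_const:
  "openin (mtop M) U \<Longrightarrow> p \<in> U \<Longrightarrow> (\<And>q. q \<in> U \<Longrightarrow> f q = r) \<Longrightarrow> dir_deriv M p v f = 0"
  using dir_deriv_cong[of U p f "\<lambda>q. r" v] by simp

context
  fixes U p assumes U: "openin (mtop M) U" "p \<in> U"
begin

lemma dir_deriv_has_derivative: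
  assumes "smooth_fun M U f"
  shows "((\<lambda>x. f (chart_inv (chart_at M p) x)) has_derivative
    frechet_derivative (f \<circ> chart_inv (chart_at M p)) (at (snd (chart_at M p) p))) (at (snd (chart_at M p) p))"
  using smooth_fun_differentiable[OF U(1) assms U(2) chart_at[OF openin_point[OF U]]] by (simp add: o_def)

lemma dir_deriv_linear: "smooth_fun M U f \<Longrightarrow> linear (\<lambda>v. dir_deriv M p v f)"
  using has_derivative_linear[OF dir_deriv_has_derivative[of f]]
  by (auto simp: dir_deriv_def Let_def linear_iff)

lemma dir_deriv_add:
  assumes "smooth_fun M U f" "smooth_fun M U g"
  shows "dir_deriv M p v (\<lambda>q. f q + g q) = dir_deriv M p v f + dir_deriv M p v g"
  using frechet_derivative_at[OF has_derivative_add[OF dir_deriv_has_derivative[OF assms(1)]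
    dir_deriv_has_derivative[OF assms(2)]], symmetric]
  by (simp add: dir_deriv_def Let_def comp_def)

lemma dir_deriv_mult:
  assumes "smooth_fun M U f" "smooth_fun M U g"
  shows "dir_deriv M p v (\<lambda>q. f q * g q) = f p * dir_deriv M p v g + dir_deriv M p v f * g p"
proof -
  note c = charts_atD[OF chart_at[OF openin_point[OF U]]]
  show ?thesis
  using frechet_derivative_at[OF has_derivative_mult[OF dir_deriv_has_derivative[OF assms(1)]
    dir_deriv_has_derivative[OF assms(2)]], symmetric] c
  by (simp add: dir_deriv_def Let_def comp_def)
qed

lemma dir_deriv_cmult:
  "smooth_fun M U f \<Longrightarrow> dir_deriv M p v (\<lambda>q. r * f q) = r * dir_deriv M p v f"
  using dir_deriv_mult[OF smooth_fun_const[OF U(1)], of f v r] by simp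

lemma dir_deriv_sum:
  "(\<And>i. i \<in> I \<Longrightarrow> smooth_fun M U (f i)) \<Longrightarrow> dir_deriv M p v (\<lambda>q. \<Sum>i\<in>I. f i q) = (\<Sum>i\<in>I. dir_deriv M p v (f i))"
proof (induction I rule: infinite_finite_induct)
  case (insert i I)
  then show ?case by (simp add: dir_deriv_add smooth_fun_sum[OF U(1)])
qed auto

lemma dir_deriv_sum_mult:
  assumes "\<And>i. i \<in> I \<Longrightarrow> smooth_fun M U (f i)" "\<And>i. i \<in> I \<Longrightarrow> smooth_fun M U (g i)"
  shows "dir_deriv M p v (\<lambda>q. \<Sum>i\<in>I. f i q * g i q) =
    (\<Sum>i\<in>I. f i p * dir_deriv M p v (g i) + dir_deriv M p v (f i) * g i p)"
  by (subst dir_deriv_sum) (auto intro!: smooth_fun_mult[OF U(1)] sum.cong simp: assms dir_deriv_mult)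

end

subsection \<open>Vector fields\<close>

lemma vfields_tangent: "X \<in> vfields M U \<Longrightarrow> p \<in> U \<Longrightarrow> X p \<in> tangent M p"
  and vfields_zero: "X \<in> vfields M U \<Longrightarrow> p \<notin> U \<Longrightarrow> X p = 0"
  and vfields_smooth: "X \<in> vfields M U \<Longrightarrow> c \<in> atlas M \<Longrightarrow>
    smooth_on (snd c ` (U \<inter> fst c)) (\<lambda>x. X (chart_inv c x) c)"
  by (auto simp: vfields_def)

text \<open>The coordinates of \<open>X\<close> in another chart are the derivative of the
  transition map applied to the known coordinates, and so are smooth too; one chart around each
  point is therefore enough.\<close>

lemma vfieldsI:
  assumes U: "openin (mtop M) U" and tan: "\<And>p. p \<in> U \<Longrightarrow> X p \<in> tangent M p"
    and zero: "\<And>p. p \<notin> U \<Longrightarrow> X p = 0"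
    and chart: "\<And>p. p \<in> U \<Longrightarrow> \<exists>c W. c \<in> charts_at M p \<and> openin (mtop M) W \<and> p \<in> W \<and>
      smooth_on (snd c ` (W \<inter> fst c)) (\<lambda>x. X (chart_inv c x) c)"
  shows "X \<in> vfields M U"
proof -
  have "smooth_on (snd c' ` (U \<inter> fst c')) (\<lambda>x. X (chart_inv c' x) c')" if c': "c' \<in> atlas M" for c'
  proof (rule smooth_on_local)
    fix x assume "x \<in> snd c' ` (U \<inter> fst c')"
    then obtain p where p: "p \<in> U" "p \<in> fst c'" "x = snd c' p" by auto
    then obtain c W where c: "c \<in> charts_at M p" "openin (mtop M) W" "p \<in> W"
        "smooth_on (snd c ` (W \<inter> fst c)) (\<lambda>x. X (chart_inv c x) c)" using chart by blast
    note cs = charts_atD[OF c(1)]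
    let ?V = "W \<inter> U \<inter> fst c \<inter> fst c'"
    have oV: "openin (mtop M) ?V"
      using U c cs c' chart_domain_open by (intro openin_Int) auto
    have oS: "open (snd c' ` (?V \<inter> fst c'))" and oS2: "open (snd c ` (?V \<inter> fst c))"
      by (rule chart_image_open[OF c' oV], rule chart_image_open[OF cs(1) oV])
    have eqs: "snd c' ` (?V \<inter> fst c') = snd c' ` ?V" "snd c ` (?V \<inter> fst c) = snd c ` ?V"
      by (rule arg_cong[of _ _ "image _"], blast)+
    have G: "smooth_on (snd c ` ?V) (\<lambda>y. frechet_derivative (snd c' \<circ> chart_inv c) (at y) (X (chart_inv c y) c))"
    proof (rule smooth_on_frechet_apply)
      show "open (snd c ` ?V)" using oS2 eqs by simp
      show "smooth_on (snd c ` ?V) (snd c' \<circ> chart_inv c)"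
        by (rule smooth_on_subset[OF transition_smooth[OF cs(1) c']]) auto
      show "smooth_on (snd c ` ?V) (\<lambda>y. X (chart_inv c y) c)"
        by (rule smooth_on_subset[OF c(4)]) auto
    qed
    have "smooth_on (snd c' ` ?V) (\<lambda>x. (\<lambda>y. frechet_derivative (snd c' \<circ> chart_inv c) (at y) (X (chart_inv c y) c))
        ((snd c \<circ> chart_inv c') x))"
    proof (rule smooth_on_compose[OF _ _ _ _ G])
      show "open (snd c' ` ?V)" "open (snd c ` ?V)" using oS oS2 eqs by simp_all
      show "smooth_on (snd c' ` ?V) (snd c \<circ> chart_inv c')"
        by (rule smooth_on_subset[OF transition_smooth[OF c' cs(1)]]) auto
      show "(snd c \<circ> chart_inv c') ` snd c' ` ?V \<subseteq> snd c ` ?V" using c' by auto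
    qed
    moreover have "frechet_derivative (snd c' \<circ> chart_inv c) (at ((snd c \<circ> chart_inv c') y)) (X (chart_inv c ((snd c \<circ> chart_inv c') y)) c)
      = X (chart_inv c' y) c'" if "y \<in> snd c' ` ?V" for y
    proof -
      from that obtain q where q: "y = snd c' q" "q \<in> ?V" by (rule imageE)
      then have "X q c' = jacobian c c' q (X q c)"
        by (intro tangent_jacobian[OF tan] charts_atI cs c') auto
      then show ?thesis using q cs c' by (simp add: jacobian_def)
    qed
    ultimately have "smooth_on (snd c' ` ?V) (\<lambda>x. X (chart_inv c' x) c')"
      using smooth_on_cong[OF oS, of "\<lambda>x. X (chart_inv c' x) c'"] eqs by (metis (no_types, lifting))
    then show "\<exists>T. open T \<and> x \<in> T \<and> smooth_on T (\<lambda>x. X (chart_inv c' x) c')"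
      using oS p c cs unfolding eqs by (intro exI[of _ "snd c' ` ?V"]) auto
  qed
  then show ?thesis using tan zero by (auto simp: vfields_def)
qed

lemma vfields_component:
  assumes "openin (mtop M) U" "X \<in> vfields M U" "c \<in> atlas M" "U \<subseteq> fst c"
  shows "smooth_fun M U (\<lambda>p. X p c \<bullet> b)"
proof (rule smooth_fun_chartI[OF assms(1,3,4)])
  have "U \<inter> fst c = U" using assms(4) by blast
  then show "smooth_on (snd c ` U) ((\<lambda>p. X p c \<bullet> b) \<circ> chart_inv c)"
    using vfields_smooth[OF assms(2,3)] chart_image_open[OF assms(3,1)]
    by (auto simp: comp_def intro!: smooth_on_inner smooth_on_const)
qed

lemma vfields_componentI:
  assumes U: "openin (mtop M) U" and c: "c \<in> atlas M" "U \<subseteq> fst c"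
    and tan: "\<And>p. p \<in> U \<Longrightarrow> X p \<in> tangent M p" and zero: "\<And>p. p \<notin> U \<Longrightarrow> X p = 0"
    and comp: "\<And>b. b \<in> Basis \<Longrightarrow> smooth_fun M U (\<lambda>p. X p c \<bullet> b)"
  shows "X \<in> vfields M U"
proof (rule vfieldsI[OF U tan zero])
  fix p assume p: "p \<in> U"
  have o: "open (snd c ` (U \<inter> fst c))" by (rule chart_image_open[OF c(1) U])
  have "smooth_on (snd c ` (U \<inter> fst c)) (\<lambda>x. \<Sum>b\<in>Basis. (X (chart_inv c x) c \<bullet> b) *\<^sub>R b)"
    using comp c unfolding smooth_fun_def comp_def
    by (intro smooth_on_sum smooth_on_scaleR smooth_on_const o) auto
  then have "smooth_on (snd c ` (U \<inter> fst c)) (\<lambda>x. X (chart_inv c x) c)"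
    by (simp add: euclidean_representation)
  then show "\<exists>c W. c \<in> charts_at M p \<and> openin (mtop M) W \<and> p \<in> W \<and>
      smooth_on (snd c ` (W \<inter> fst c)) (\<lambda>x. X (chart_inv c x) c)"
    using p c U by (intro exI[of _ c] exI[of _ U]) (auto intro: charts_atI)
qed

lemma vfields_coord:
  assumes "openin (mtop M) U" "c \<in> atlas M" "U \<subseteq> fst c" "\<And>b. b \<in> Basis \<Longrightarrow> smooth_fun M U (\<lambda>p. N p \<bullet> b)"
  shows "restr U (\<lambda>p. coord_vec M c (N p) p) \<in> vfields M U"
proof (rule vfields_componentI[OF assms(1-3)])
  have c: "c \<in> charts_at M p" if "p \<in> U" for p using that assms by (auto intro: charts_atI)
  show "restr U (\<lambda>p. coord_vec M c (N p) p) p \<in> tangent M p" if "p \<in> U" for p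
    using c[OF that] that by (simp add: coord_vec_tangent)
  show "smooth_fun M U (\<lambda>p. restr U (\<lambda>p. coord_vec M c (N p) p) p c \<bullet> b)" if "b \<in> Basis" for b
    by (rule iffD1[OF smooth_fun_cong[OF assms(1)] assms(4)[OF that]]) (use c in auto)
qed auto

lemma vfields_restr:
  assumes "X \<in> vfields M U" "openin (mtop M) V" "V \<subseteq> U"
  shows "restr V X \<in> vfields M V"
proof -
  have "smooth_on (snd c ` (V \<inter> fst c)) (\<lambda>x. restr V X (chart_inv c x) c)" if c: "c \<in> atlas M" for c
  proof (rule iffD1[OF smooth_on_cong[OF chart_image_open[OF c assms(2)]]])
    show "smooth_on (snd c ` (V \<inter> fst c)) (\<lambda>x. X (chart_inv c x) c)"
      by (rule smooth_on_subset[OF vfields_smooth[OF assms(1) c]]) (use assms in auto)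
  qed (use c in auto)
  then show ?thesis using assms by (auto simp: vfields_def)
qed

context
  fixes U assumes U: "openin (mtop M) U"
begin

lemma vfields_add:
  assumes "X \<in> vfields M U" "Y \<in> vfields M U"
  shows "(\<lambda>p. X p + Y p) \<in> vfields M U"
  unfolding vfields_def
  using assms vfields_smooth[OF assms(1)] vfields_smooth[OF assms(2)] subspace_tangent openin_point[OF U]
  by (auto intro!: smooth_on_add chart_image_open U simp: vfields_tangent vfields_zero subspace_add)

lemma vfields_scale:
  assumes "smooth_fun M U f" "X \<in> vfields M U"
  shows "(\<lambda>p. f p *\<^sub>R X p) \<in> vfields M U"
  unfolding vfields_def
  using assms vfields_smooth[OF assms(2)] subspace_tangent openin_point[OF U]
  by (auto intro!: smooth_on_scaleR chart_image_open U simp: vfields_tangent vfields_zero subspace_scale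
     smooth_fun_def comp_def)

lemma vfields_diff:
  assumes "X \<in> vfields M U" "Y \<in> vfields M U"
  shows "(\<lambda>p. X p - Y p) \<in> vfields M U"
  using vfields_add[OF assms(1) vfields_scale[OF smooth_fun_const[OF U, of "-1"] assms(2)]] by simp

lemma smooth_fun_dir_deriv:
  assumes "smooth_fun M U f" "X \<in> vfields M U"
  shows "smooth_fun M U (\<lambda>p. dir_deriv M p (X p) f)"
  unfolding smooth_fun_def
proof
  fix c assume c: "c \<in> atlas M"
  have o: "open (snd c ` (U \<inter> fst c))" by (rule chart_image_open[OF c U])
  have "smooth_on (snd c ` (U \<inter> fst c)) (\<lambda>x. frechet_derivative (f \<circ> chart_inv c) (at x) (X (chart_inv c x) c))"
    using assms(1) c unfolding smooth_fun_def
    by (intro smooth_on_frechet_apply o vfields_smooth[OF assms(2)]) auto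
  then show "smooth_on (snd c ` (U \<inter> fst c)) ((\<lambda>p. dir_deriv M p (X p) f) \<circ> chart_inv c)"
    by (rule iffD1[OF smooth_on_cong[OF o], rotated])
      (use c in \<open>auto simp: dir_deriv_chart[OF U assms(1) _ charts_atI vfields_tangent[OF assms(2)]]\<close>)
qed

end

subsection \<open>One-forms\<close>

lemma one_forms_cotangent: "\<omega> \<in> one_forms M U \<Longrightarrow> p \<in> U \<Longrightarrow> \<omega> p \<in> cotangent M p"
  and one_forms_zero: "\<omega> \<in> one_forms M U \<Longrightarrow> p \<notin> U \<Longrightarrow> \<omega> p = 0"
  and one_forms_smooth: "\<omega> \<in> one_forms M U \<Longrightarrow> openin (mtop M) V \<Longrightarrow> V \<subseteq> U \<Longrightarrow> Y \<in> vfields M V \<Longrightarrow>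
    smooth_fun M V (\<lambda>p. \<omega> p (Y p))"
  unfolding one_forms_def by blast+

lemma one_forms_off_tangent: "\<omega> \<in> one_forms M U \<Longrightarrow> v \<notin> tangent M p \<Longrightarrow> \<omega> p v = 0"
  using one_forms_cotangent[of \<omega> U p] one_forms_zero[of \<omega> U p] by (cases "p \<in> U") (auto simp: cotangent_def)

lemma one_forms_smooth_restr:
  assumes "\<omega> \<in> one_forms M U" "Y \<in> vfields M W" "openin (mtop M) V" "V \<subseteq> U" "V \<subseteq> W"
  shows "smooth_fun M V (\<lambda>p. \<omega> p (Y p))"
  by (rule iffD1[OF smooth_fun_cong[OF assms(3)]
        one_forms_smooth[OF assms(1,3,4) vfields_restr[OF assms(2,3,5)]]]) auto

lemma one_forms_smooth_coord:
  assumes "\<omega> \<in> one_forms M U" "c \<in> atlas M" "openin (mtop M) V" "V \<subseteq> U" "V \<subseteq> fst c"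
  shows "smooth_fun M V (\<lambda>q. \<omega> q (coord_vec M c e q))"
proof -
  have "restr V (coord_vec M c e) \<in> vfields M V"
    using vfields_coord[OF assms(3,2,5), of "\<lambda>p. e"] smooth_fun_const[OF assms(3)] by simp
  from one_forms_smooth[OF assms(1,3,4) this] show ?thesis
    by (rule iffD1[OF smooth_fun_cong[OF assms(3)], rotated]) auto
qed

lemma one_forms_lincomb:
  "\<omega> \<in> one_forms M U \<Longrightarrow> p \<in> U \<Longrightarrow> u \<in> tangent M p \<Longrightarrow> v \<in> tangent M p \<Longrightarrow>
    \<omega> p (a *\<^sub>R u + b *\<^sub>R v) = a * \<omega> p u + b * \<omega> p v"
  using one_forms_cotangent[of \<omega> U p] by (auto simp: cotangent_def linear_on_def)

lemma one_forms_sum: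
  assumes "\<omega> \<in> one_forms M U" "p \<in> U" "p \<in> topspace (mtop M)"
  shows "(\<And>i. i \<in> I \<Longrightarrow> v i \<in> tangent M p) \<Longrightarrow> \<omega> p (\<Sum>i\<in>I. r i *\<^sub>R v i) = (\<Sum>i\<in>I. r i * \<omega> p (v i))"
proof (induction I rule: infinite_finite_induct)
  case (insert i I)
  have t: "v i \<in> tangent M p" "(\<Sum>i\<in>I. r i *\<^sub>R v i) \<in> tangent M p"
    using insert.prems tangent_sum[OF assms(3), of I v r] by auto
  have IH: "\<omega> p (\<Sum>i\<in>I. r i *\<^sub>R v i) = (\<Sum>i\<in>I. r i * \<omega> p (v i))"
    by (rule insert.IH) (use insert.prems in blast)
  have "\<omega> p (\<Sum>i\<in>insert i I. r i *\<^sub>R v i) = \<omega> p (r i *\<^sub>R v i + 1 *\<^sub>R (\<Sum>i\<in>I. r i *\<^sub>R v i))"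
    by (simp only: sum.insert[OF insert.hyps(1,2)] scaleR_one)
  also have "\<dots> = r i * \<omega> p (v i) + 1 * \<omega> p (\<Sum>i\<in>I. r i *\<^sub>R v i)"
    by (rule one_forms_lincomb[OF assms(1,2) t])
  also have "\<dots> = (\<Sum>i\<in>insert i I. r i * \<omega> p (v i))"
    by (simp only: IH mult_1 sum.insert[OF insert.hyps(1,2)])
  finally show ?case .
qed (use one_forms_lincomb[OF assms(1,2), of 0 0 0 0] subspace_0[OF subspace_tangent[OF assms(3)]] in auto)

lemma one_forms_coord_sum:
  assumes "\<omega> \<in> one_forms M U" "p \<in> U" "c \<in> charts_at M p"
  shows "\<omega> p (coord_vec M c e p) = (\<Sum>b\<in>Basis. (e \<bullet> b) * \<omega> p (coord_vec M c b p))"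
  by (subst coord_vec_basis[OF assms(3)])
    (simp add: one_forms_sum[OF assms(1,2) charts_at_topspace[OF assms(3)]] coord_vec_tangent[OF assms(3)])

lemma one_forms_restr:
  assumes "\<omega> \<in> one_forms M U" "openin (mtop M) V" "V \<subseteq> U"
  shows "restr V \<omega> \<in> one_forms M V"
proof -
  have "smooth_fun M W (\<lambda>p. restr V \<omega> p (Y p))" if "openin (mtop M) W" "W \<subseteq> V" "Y \<in> vfields M W" for W Y
  proof (rule iffD1[OF smooth_fun_cong[OF that(1)]])
    show "smooth_fun M W (\<lambda>p. \<omega> p (Y p))" using one_forms_smooth[OF assms(1) that(1) _ that(3)] that assms by auto
  qed (use that in auto)
  then show ?thesis using assms one_forms_cotangent[OF assms(1)] unfolding one_forms_def by auto
qed

context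
  fixes U assumes U: "openin (mtop M) U"
begin

lemma one_forms_scale:
  assumes "smooth_fun M U f" "\<omega> \<in> one_forms M U"
  shows "(\<lambda>p. f p *\<^sub>R \<omega> p) \<in> one_forms M U"
proof -
  have "f p *\<^sub>R \<omega> p \<in> cotangent M p" if "p \<in> U" for p
    using one_forms_cotangent[OF assms(2) that] by (auto simp: cotangent_def linear_on_def algebra_simps)
  moreover have "smooth_fun M V (\<lambda>p. (f p *\<^sub>R \<omega> p) (Y p))" if "openin (mtop M) V" "V \<subseteq> U" "Y \<in> vfields M V" for V Y
    using that smooth_fun_mult[OF that(1) smooth_fun_subset[OF assms(1) that(2)] one_forms_smooth[OF assms(2) that]]
    by simp
  ultimately show ?thesis using one_forms_zero[OF assms(2)] unfolding one_forms_def by auto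
qed

lemma one_forms_add:
  assumes "\<omega> \<in> one_forms M U" "\<eta> \<in> one_forms M U"
  shows "(\<lambda>p. \<omega> p + \<eta> p) \<in> one_forms M U"
proof -
  have "\<omega> p + \<eta> p \<in> cotangent M p" if "p \<in> U" for p
    using one_forms_cotangent[OF assms(1) that] one_forms_cotangent[OF assms(2) that]
    by (auto simp: cotangent_def linear_on_def algebra_simps)
  moreover have "smooth_fun M V (\<lambda>p. (\<omega> p + \<eta> p) (Y p))" if "openin (mtop M) V" "V \<subseteq> U" "Y \<in> vfields M V" for V Y
    using that smooth_fun_add[OF that(1) one_forms_smooth[OF assms(1) that] one_forms_smooth[OF assms(2) that]]
    by simp
  ultimately show ?thesis using one_forms_zero[OF assms(1)] one_forms_zero[OF assms(2)] unfolding one_forms_def by auto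
qed

lemma one_forms_zero_form: "(\<lambda>p. 0) \<in> one_forms M U"
proof -
  have "smooth_fun M V (\<lambda>p. (0 :: ('a, 'e) covec) (Y p))" if "openin (mtop M) V" for V Y
    using smooth_fun_const[OF that, of 0] by simp
  then show ?thesis unfolding one_forms_def cotangent_def linear_on_def by auto
qed

lemma one_forms_sum_form:
  "(\<And>i. i \<in> I \<Longrightarrow> \<omega> i \<in> one_forms M U) \<Longrightarrow> (\<lambda>p. \<Sum>i\<in>I. \<omega> i p) \<in> one_forms M U"
  by (induction I rule: infinite_finite_induct) (auto intro: one_forms_zero_form one_forms_add)

end

subsection \<open>The exterior derivative\<close>

text \<open>The Jacobian is a first derivative of the transition map, so differentiating its entries
  gives second derivatives of that map: the terms that have to cancel in
  \<open>ext_deriv_chart\<close>.\<close>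

lemma dir_deriv_jacobian:
  assumes "c \<in> charts_at M p" "c' \<in> charts_at M p" "v \<in> tangent M p"
  shows "dir_deriv M p v (\<lambda>q. jacobian c c' q e \<bullet> b) =
      frechet_derivative (\<lambda>x. frechet_derivative (snd c' \<circ> chart_inv c) (at x) e) (at (snd c p)) (v c) \<bullet> b"
    and "smooth_fun M (fst c \<inter> fst c') (\<lambda>q. jacobian c c' q e \<bullet> b)"
proof -
  note cs = charts_atD[OF assms(1)] charts_atD[OF assms(2)]
  let ?V = "fst c \<inter> fst c'" and ?\<phi> = "snd c' \<circ> chart_inv c"
  have oV: "openin (mtop M) ?V" using cs by (intro openin_Int chart_domain_open)
  have eq: "?V \<inter> fst c = ?V" by blast
  have oS: "open (snd c ` ?V)" using chart_image_open[OF cs(1) oV] eq by simp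
  have sm: "smooth_on (snd c ` ?V) (\<lambda>x. frechet_derivative ?\<phi> (at x) e)"
    by (rule smooth_on_frechet[OF transition_smooth[OF cs(1) cs(3)]])
  have comp: "((\<lambda>q. jacobian c c' q e \<bullet> b) \<circ> chart_inv c) x = frechet_derivative ?\<phi> (at x) e \<bullet> b"
    if "x \<in> snd c ` ?V" for x using that cs by (auto simp: jacobian_def)
  have smb: "smooth_on (snd c ` ?V) (\<lambda>x. frechet_derivative ?\<phi> (at x) e \<bullet> b)"
    by (intro smooth_on_inner smooth_on_const oS sm)
  show sf: "smooth_fun M ?V (\<lambda>q. jacobian c c' q e \<bullet> b)"
    by (rule smooth_fun_chartI[OF oV cs(1) _ iffD2[OF smooth_on_cong[OF oS comp] smb]]) auto
  have p: "p \<in> ?V" using cs by auto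
  have "dir_deriv M p v (\<lambda>q. jacobian c c' q e \<bullet> b) =
    frechet_derivative ((\<lambda>q. jacobian c c' q e \<bullet> b) \<circ> chart_inv c) (at (snd c p)) (v c)"
    by (rule dir_deriv_chart[OF oV sf p assms(1,3)])
  also have "\<dots> = frechet_derivative (\<lambda>x. frechet_derivative ?\<phi> (at x) e \<bullet> b) (at (snd c p)) (v c)"
    by (subst frechet_derivative_cong_open(1)[OF oS _ comp]) (use p in auto)
  also have "\<dots> = frechet_derivative (\<lambda>x. frechet_derivative ?\<phi> (at x) e) (at (snd c p)) (v c) \<bullet> b"
    using fun_cong[OF frechet_derivative_at[OF has_derivative_inner_left[OF smooth_on_has_derivative[OF sm imageI[OF p]]]],
        of "v c" b] by simp
  finally show "dir_deriv M p v (\<lambda>q. jacobian c c' q e \<bullet> b) =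
      frechet_derivative (\<lambda>x. frechet_derivative ?\<phi> (at x) e) (at (snd c p)) (v c) \<bullet> b" .
qed

text \<open>In the difference defining \<open>d\<omega>\<close> the second derivatives of the coordinate change cancel.\<close>

lemma ext_deriv_chart:
  assumes \<omega>: "\<omega> \<in> one_forms M U" and U: "openin (mtop M) U" "p \<in> U" and c: "c \<in> charts_at M p"
    and u: "u \<in> tangent M p" and v: "v \<in> tangent M p"
  shows "ext_deriv M \<omega> p u v = dir_deriv M p u (\<lambda>q. \<omega> q (coord_vec M c (v c) q)) -
    dir_deriv M p v (\<lambda>q. \<omega> q (coord_vec M c (u c) q))"
proof -
  define c0 where "c0 = chart_at M p"
  have c0: "c0 \<in> charts_at M p" unfolding c0_def by (rule chart_at_charts_at[OF c])
  note cs = charts_atD[OF c0] charts_atD[OF c]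
  let ?V = "U \<inter> (fst c0 \<inter> fst c)"
  have V: "openin (mtop M) ?V" "p \<in> ?V" using U cs by (auto intro!: openin_Int chart_domain_open)
  have chV: "c0 \<in> charts_at M q" "c \<in> charts_at M q" if "q \<in> ?V" for q using cs that by (auto intro: charts_atI)
  define w where "w b q = \<omega> q (coord_vec M c b q)" for b q
  \<comment> \<open>Second derivative of the coordinate change at \<open>p\<close>, along
    \<open>e\<close> first and then along \<open>x\<close>.\<close>
  define D2 where "D2 x e = frechet_derivative (\<lambda>x. frechet_derivative (snd c \<circ> chart_inv c0) (at x) e) (at (snd c0 p)) x" for x e
  have smw: "smooth_fun M ?V (w b)" for b
    unfolding w_def using one_forms_smooth_coord[OF \<omega> cs(3) V(1)] by auto
  have expand: "\<omega> q (coord_vec M c e q) = (\<Sum>b\<in>Basis. (e \<bullet> b) * w b q)" if "q \<in> ?V" for q e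
    unfolding w_def by (rule one_forms_coord_sum[OF \<omega> _ chV(2)[OF that]]) (use that in blast)
  have smJ: "smooth_fun M ?V (\<lambda>q. jacobian c0 c q e \<bullet> b)" for e b
    by (rule smooth_fun_subset[OF dir_deriv_jacobian(2)[OF c0 c u]]) auto
  \<comment> \<open>A field that is constant in the chart \<open>c0\<close> has varying coefficients
    in the chart \<open>c\<close>; the product rule therefore adds a term with \<open>D2\<close> to
    the expression of the chart \<open>c\<close>.\<close>
  have in0: "dir_deriv M p x (\<lambda>q. \<omega> q (coord_vec M c0 (y c0) q)) =
     (\<Sum>b\<in>Basis. (y c \<bullet> b) * dir_deriv M p x (w b) + (D2 (x c0) (y c0) \<bullet> b) * w b p)"
    if x: "x \<in> tangent M p" and y: "y \<in> tangent M p" for x y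
  proof -
    have "\<omega> q (coord_vec M c0 (y c0) q) = (\<Sum>b\<in>Basis. (jacobian c0 c q (y c0) \<bullet> b) * w b q)" if q: "q \<in> ?V" for q
    proof -
      have "coord_vec M c0 (y c0) q = coord_vec M c (jacobian c0 c q (y c0)) q"
        using chV[OF q] tangent_jacobian[OF coord_vec_tangent[OF chV(1)[OF q]] chV(1)[OF q] chV(2)[OF q]]
        by (intro tangent_eqI[of _ _ _ c]) (auto simp: coord_vec_tangent)
      then show ?thesis by (simp only: expand[OF q])
    qed
    then have "dir_deriv M p x (\<lambda>q. \<omega> q (coord_vec M c0 (y c0) q)) =
      dir_deriv M p x (\<lambda>q. \<Sum>b\<in>Basis. (jacobian c0 c q (y c0) \<bullet> b) * w b q)"
      by (rule dir_deriv_cong[OF V])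
    also have "\<dots> = (\<Sum>b\<in>Basis. (jacobian c0 c p (y c0) \<bullet> b) * dir_deriv M p x (w b) +
        dir_deriv M p x (\<lambda>q. jacobian c0 c q (y c0) \<bullet> b) * w b p)"
      by (rule dir_deriv_sum_mult[OF V smJ smw])
    finally show ?thesis
      by (simp add: dir_deriv_jacobian(1)[OF c0 c x] tangent_jacobian[OF y c0 c] D2_def)
  qed
  have in1: "dir_deriv M p x (\<lambda>q. \<omega> q (coord_vec M c (y c) q)) = (\<Sum>b\<in>Basis. (y c \<bullet> b) * dir_deriv M p x (w b))" for x y
  proof -
    have "dir_deriv M p x (\<lambda>q. \<omega> q (coord_vec M c (y c) q)) = dir_deriv M p x (\<lambda>q. \<Sum>b\<in>Basis. (y c \<bullet> b) * w b q)"
      by (rule dir_deriv_cong[OF V expand])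
    also have "\<dots> = (\<Sum>b\<in>Basis. (y c \<bullet> b) * dir_deriv M p x (w b))"
      by (subst dir_deriv_sum[OF V]) (auto intro!: smooth_fun_mult smooth_fun_const V smw simp: dir_deriv_cmult[OF V smw])
    finally show ?thesis .
  qed
  have "D2 (u c0) (v c0) = D2 (v c0) (u c0)"
    unfolding D2_def
  proof (rule second_derivative_symmetric)
    show "open (snd c0 ` (?V \<inter> fst c0))" by (rule chart_image_open[OF cs(1) V(1)])
    show "smooth_on (snd c0 ` (?V \<inter> fst c0)) (snd c \<circ> chart_inv c0)"
      by (rule smooth_on_subset[OF transition_smooth[OF cs(1,3)]]) auto
  qed (use V cs in auto)
  moreover have "ext_deriv M \<omega> p u v = dir_deriv M p u (\<lambda>q. \<omega> q (coord_vec M c0 (v c0) q)) -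
    dir_deriv M p v (\<lambda>q. \<omega> q (coord_vec M c0 (u c0) q))"
    by (simp add: ext_deriv_def Let_def c0_def)
  ultimately show ?thesis
    unfolding in0[OF u v] in0[OF v u] in1 by (simp add: sum.distrib)
qed

lemma ext_deriv_antisym: "ext_deriv M \<omega> p u v = - ext_deriv M \<omega> p v u"
  by (simp add: ext_deriv_def Let_def)

context
  fixes U p assumes U: "openin (mtop M) U" "p \<in> U"
begin

lemma chart_at_U: "chart_at M p \<in> charts_at M p"
  by (rule chart_at[OF openin_point[OF U]])

lemma ext_deriv_cong:
  assumes "\<And>q. q \<in> U \<Longrightarrow> \<omega> q = \<eta> q"
  shows "ext_deriv M \<omega> p u v = ext_deriv M \<eta> p u v"
  unfolding ext_deriv_def Let_def
  by (rule arg_cong2[of _ _ _ _ "(-)"]; rule dir_deriv_cong[OF U]; simp add: assms)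

text \<open>Linear on the whole function space and not just on the tangent space, because each
  argument enters only through its coordinates in \<open>chart_at M p\<close>.\<close>

lemma ext_deriv_linear:
  assumes \<omega>: "\<omega> \<in> one_forms M U"
  shows "linear (\<lambda>u. ext_deriv M \<omega> p u v)" "linear (\<lambda>v. ext_deriv M \<omega> p u v)"
proof -
  let ?c = "chart_at M p"
  note cs = charts_atD[OF chart_at_U]
  let ?V = "U \<inter> fst ?c"
  have V: "openin (mtop M) ?V" "p \<in> ?V" using U cs by (auto intro!: openin_Int chart_domain_open)
  have ch: "?c \<in> charts_at M q" if "q \<in> ?V" for q using cs that by (auto intro: charts_atI)
  have sm: "smooth_fun M ?V (\<lambda>q. \<omega> q (coord_vec M ?c e q))" for e
    by (rule one_forms_smooth_coord[OF \<omega> cs(1) V(1)]) auto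
  have 1: "linear (\<lambda>u. dir_deriv M p u (\<lambda>q. \<omega> q (coord_vec M ?c (v ?c) q)))" for v
    by (rule dir_deriv_linear[OF V sm])
  have "\<omega> q (coord_vec M ?c (a + b) q) = \<omega> q (coord_vec M ?c a q) + \<omega> q (coord_vec M ?c b q)"
      "\<omega> q (coord_vec M ?c (r *\<^sub>R a) q) = r * \<omega> q (coord_vec M ?c a q)" if q: "q \<in> ?V" for q r a b
    using one_forms_lincomb[OF \<omega> _ coord_vec_tangent[OF ch[OF q]] coord_vec_tangent[OF ch[OF q]], of 1 a 1 b]
      one_forms_lincomb[OF \<omega> _ coord_vec_tangent[OF ch[OF q]] coord_vec_tangent[OF ch[OF q]], of r a 0 b] q
    by (auto simp: coord_vec_add[OF ch[OF q]] coord_vec_scaleR[OF ch[OF q]])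
  then have "dir_deriv M p u (\<lambda>q. \<omega> q (coord_vec M ?c (a + b) q)) =
      dir_deriv M p u (\<lambda>q. \<omega> q (coord_vec M ?c a q) + \<omega> q (coord_vec M ?c b q))"
    "dir_deriv M p u (\<lambda>q. \<omega> q (coord_vec M ?c (r *\<^sub>R a) q)) =
      dir_deriv M p u (\<lambda>q. r * \<omega> q (coord_vec M ?c a q))" for u r a b
    by (auto intro!: dir_deriv_cong[OF V])
  then have 2: "linear (\<lambda>v. dir_deriv M p u (\<lambda>q. \<omega> q (coord_vec M ?c (v ?c) q)))" for u
    by (auto intro!: linearI simp: dir_deriv_add[OF V sm sm] dir_deriv_cmult[OF V sm])
  show "linear (\<lambda>u. ext_deriv M \<omega> p u v)" "linear (\<lambda>v. ext_deriv M \<omega> p u v)"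
    unfolding ext_deriv_def Let_def by (intro linear_compose_sub 1 2)+
qed

lemma ext_deriv_zero_form: "ext_deriv M (\<lambda>q. 0) p u v = 0"
  by (simp add: ext_deriv_def Let_def)

lemma ext_deriv_add:
  assumes "\<omega> \<in> one_forms M U" "\<eta> \<in> one_forms M U"
  shows "ext_deriv M (\<lambda>q. \<omega> q + \<eta> q) p u v = ext_deriv M \<omega> p u v + ext_deriv M \<eta> p u v"
proof -
  let ?c = "chart_at M p"
  note cs = charts_atD[OF chart_at_U]
  let ?V = "U \<inter> fst ?c"
  have V: "openin (mtop M) ?V" "p \<in> ?V" using U cs by (auto intro!: openin_Int chart_domain_open)
  have sm: "smooth_fun M ?V (\<lambda>q. \<omega> q (coord_vec M ?c e q))" "smooth_fun M ?V (\<lambda>q. \<eta> q (coord_vec M ?c e q))" for e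
    by (rule one_forms_smooth_coord[OF assms(1) cs(1) V(1)]; auto)
       (rule one_forms_smooth_coord[OF assms(2) cs(1) V(1)]; auto)
  show ?thesis by (simp add: ext_deriv_def Let_def dir_deriv_add[OF V sm])
qed

lemma ext_deriv_sum:
  "(\<And>i. i \<in> I \<Longrightarrow> \<omega> i \<in> one_forms M U) \<Longrightarrow>
    ext_deriv M (\<lambda>q. \<Sum>i\<in>I. \<omega> i q) p u v = (\<Sum>i\<in>I. ext_deriv M (\<omega> i) p u v)"
proof (induction I rule: infinite_finite_induct)
  case (insert i I)
  have "ext_deriv M (\<lambda>q. \<Sum>i\<in>insert i I. \<omega> i q) p u v = ext_deriv M (\<lambda>q. \<omega> i q + (\<Sum>i\<in>I. \<omega> i q)) p u v"
    by (simp only: sum.insert[OF insert.hyps(1,2)])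
  also have "\<dots> = ext_deriv M (\<omega> i) p u v + ext_deriv M (\<lambda>q. \<Sum>i\<in>I. \<omega> i q) p u v"
    by (rule ext_deriv_add[OF _ one_forms_sum_form[OF U(1)]]) (use insert.prems in auto)
  also have "ext_deriv M (\<lambda>q. \<Sum>i\<in>I. \<omega> i q) p u v = (\<Sum>i\<in>I. ext_deriv M (\<omega> i) p u v)"
    by (rule insert.IH) (use insert.prems in auto)
  finally show ?case by (simp only: sum.insert[OF insert.hyps(1,2)])
qed (simp_all add: ext_deriv_zero_form)

text \<open>The rule d(f\<omega>) = f d\<omega> + df \<and> \<omega>. The two terms with derivatives
  of \<open>f\<close> come from the product rule, after the constant coordinate fields at
  \<open>p\<close> are recognised as \<open>u\<close> and \<open>v\<close>.\<close>

lemma ext_deriv_scale: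
  assumes f: "smooth_fun M U f" and \<omega>: "\<omega> \<in> one_forms M U" and u: "u \<in> tangent M p" and v: "v \<in> tangent M p"
  shows "ext_deriv M (\<lambda>q. f q *\<^sub>R \<omega> q) p u v =
    f p * ext_deriv M \<omega> p u v + dir_deriv M p u f * \<omega> p v - dir_deriv M p v f * \<omega> p u"
proof -
  let ?c = "chart_at M p"
  note cs = charts_atD[OF chart_at_U]
  let ?V = "U \<inter> fst ?c"
  have V: "openin (mtop M) ?V" "p \<in> ?V" using U cs by (auto intro!: openin_Int chart_domain_open)
  have sm: "smooth_fun M ?V (\<lambda>q. \<omega> q (coord_vec M ?c e q))" for e
    by (rule one_forms_smooth_coord[OF \<omega> cs(1) V(1)]) auto
  have f': "smooth_fun M ?V f" by (rule smooth_fun_subset[OF f]) auto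
  show ?thesis
    by (simp add: ext_deriv_def Let_def dir_deriv_mult[OF V f' sm] coord_vec_of_tangent[OF u chart_at_U]
      coord_vec_of_tangent[OF v chart_at_U] algebra_simps)
qed

end

text \<open>\<open>ext_deriv\<close> at \<open>q\<close> is computed in \<open>chart_at M q\<close>,
  which may jump with \<open>q\<close>; near \<open>p\<close>, \<open>ext_deriv_chart\<close>
  replaces it by one fixed chart, where every ingredient is smooth.\<close>

lemma smooth_fun_ext_deriv:
  assumes \<omega>: "\<omega> \<in> one_forms M U" and U: "openin (mtop M) U"
    and X: "X \<in> vfields M U" and Y: "Y \<in> vfields M U"
  shows "smooth_fun M U (\<lambda>q. ext_deriv M \<omega> q (X q) (Y q))"
proof (rule smooth_fun_local)
  fix p assume p: "p \<in> U"
  define c where "c = chart_at M p"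
  note c = charts_atD[OF chart_at_U[OF U p], folded c_def]
  let ?V = "U \<inter> fst c"
  have V: "openin (mtop M) ?V" "p \<in> ?V" using U p c by (auto intro!: openin_Int chart_domain_open)
  have ch: "c \<in> charts_at M q" if "q \<in> ?V" for q using c that by (auto intro: charts_atI)
  define w where "w b q = \<omega> q (coord_vec M c b q)" for b q
  have smw: "smooth_fun M ?V (w b)" for b
    unfolding w_def using one_forms_smooth_coord[OF \<omega> c(1) V(1)] by auto
  have expand: "\<omega> q (coord_vec M c e q) = (\<Sum>b\<in>Basis. (e \<bullet> b) * w b q)" if "q \<in> ?V" for q e
    unfolding w_def by (rule one_forms_coord_sum[OF \<omega> _ ch[OF that]]) (use that in blast)
  have in1: "dir_deriv M q x (\<lambda>q. \<omega> q (coord_vec M c e q)) = (\<Sum>b\<in>Basis. (e \<bullet> b) * dir_deriv M q x (w b))"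
    if q: "q \<in> ?V" for x e q
  proof -
    have "dir_deriv M q x (\<lambda>q. \<omega> q (coord_vec M c e q)) = dir_deriv M q x (\<lambda>q. \<Sum>b\<in>Basis. (e \<bullet> b) * w b q)"
      by (rule dir_deriv_cong[OF V(1) q expand])
    also have "\<dots> = (\<Sum>b\<in>Basis. (e \<bullet> b) * dir_deriv M q x (w b))"
      by (subst dir_deriv_sum[OF V(1) q]) (auto intro!: smooth_fun_mult smooth_fun_const V smw simp: dir_deriv_cmult[OF V(1) q smw])
    finally show ?thesis .
  qed
  have vf: "restr ?V X \<in> vfields M ?V" "restr ?V Y \<in> vfields M ?V"
    using vfields_restr[OF X V(1)] vfields_restr[OF Y V(1)] by auto
  have sc: "smooth_fun M ?V (\<lambda>q. restr ?V X q c \<bullet> b)" "smooth_fun M ?V (\<lambda>q. restr ?V Y q c \<bullet> b)" for b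
    using vfields_component[OF V(1) _ c(1)] vf by auto
  have "smooth_fun M ?V (\<lambda>q. (\<Sum>b\<in>Basis. (restr ?V Y q c \<bullet> b) * dir_deriv M q (restr ?V X q) (w b)) -
     (\<Sum>b\<in>Basis. (restr ?V X q c \<bullet> b) * dir_deriv M q (restr ?V Y q) (w b)))"
    using smooth_fun_dir_deriv[OF V(1) smw] vf
    by (intro smooth_fun_diff smooth_fun_sum smooth_fun_mult V sc) auto
  then have "smooth_fun M ?V (\<lambda>q. ext_deriv M \<omega> q (X q) (Y q))"
    by (rule iffD1[OF smooth_fun_cong[OF V(1)], rotated])
      (use ext_deriv_chart[OF \<omega> U _ ch vfields_tangent[OF X] vfields_tangent[OF Y]] in \<open>auto simp: in1\<close>)
  then show "\<exists>W. openin (mtop M) W \<and> p \<in> W \<and> smooth_fun M W (\<lambda>q. ext_deriv M \<omega> q (X q) (Y q))"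
    using V by blast
qed

text \<open>Cartan's formula. In coordinates the derivative of \<omega>(Y) along X splits into
  derivatives of the coefficients of \<omega>, which make up d\<omega>, and derivatives of the
  components of Y, which after antisymmetrisation make up \<omega>([X,Y]). It links the contact
  condition, stated by brackets, to d\<theta>.\<close>

lemma ext_deriv_lie_bracket:
  assumes \<omega>: "\<omega> \<in> one_forms M U" and U: "openin (mtop M) U" and p: "p \<in> U"
    and X: "X \<in> vfields M U" and Y: "Y \<in> vfields M U"
  shows "ext_deriv M \<omega> p (X p) (Y p) =
    dir_deriv M p (X p) (\<lambda>q. \<omega> q (Y q)) - dir_deriv M p (Y p) (\<lambda>q. \<omega> q (X q)) - \<omega> p (lie_bracket M X Y p)"
proof -
  define c where "c = chart_at M p"
  have cp: "c \<in> charts_at M p" unfolding c_def by (rule chart_at_U[OF U p])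
  note c = charts_atD[OF cp]
  let ?V = "U \<inter> fst c"
  have V: "openin (mtop M) ?V" "p \<in> ?V" using U p c by (auto intro!: openin_Int chart_domain_open)
  have ch: "c \<in> charts_at M q" if "q \<in> ?V" for q using c that by (auto intro: charts_atI)
  define w where "w b q = \<omega> q (coord_vec M c b q)" for b q
  have smw: "smooth_fun M ?V (w b)" for b
    unfolding w_def using one_forms_smooth_coord[OF \<omega> c(1) V(1)] by auto
  have expand: "\<omega> q (coord_vec M c e q) = (\<Sum>b\<in>Basis. (e \<bullet> b) * w b q)" if "q \<in> ?V" for q e
    unfolding w_def by (rule one_forms_coord_sum[OF \<omega> _ ch[OF that]]) (use that in blast)
  have sc: "smooth_fun M ?V (\<lambda>q. Z q c \<bullet> b)" if "Z \<in> vfields M U" for b Z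
    by (rule iffD1[OF smooth_fun_cong[OF V(1)] vfields_component[OF V(1) vfields_restr[OF that V(1)] c(1)]]) auto
  define D where "D Z x = frechet_derivative (\<lambda>x. Z (chart_inv c x) c) (at (snd c p)) x" for Z :: "('a, 'e) vfield" and x
  have Db: "dir_deriv M p x (\<lambda>q. Z q c \<bullet> b) = D Z (x c) \<bullet> b" if Z: "Z \<in> vfields M U" and x: "x \<in> tangent M p" for Z x b
  proof -
    have "dir_deriv M p x (\<lambda>q. Z q c \<bullet> b) = frechet_derivative (\<lambda>y. Z (chart_inv c y) c \<bullet> b) (at (snd c p)) (x c)"
      using dir_deriv_chart[OF V(1) sc[OF Z] V(2) cp x] by (simp add: o_def)
    also have "\<dots> = D Z (x c) \<bullet> b"
      using fun_cong[OF frechet_derivative_at[OF has_derivative_inner_left[OF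
            smooth_on_has_derivative[OF vfields_smooth[OF Z c(1)] imageI[OF V(2)]]]], of "x c" b]
      unfolding D_def by simp
    finally show ?thesis .
  qed
  have in1: "dir_deriv M p x (\<lambda>q. \<omega> q (coord_vec M c e q)) = (\<Sum>b\<in>Basis. (e \<bullet> b) * dir_deriv M p x (w b))" for x e
  proof -
    have "dir_deriv M p x (\<lambda>q. \<omega> q (coord_vec M c e q)) = dir_deriv M p x (\<lambda>q. \<Sum>b\<in>Basis. (e \<bullet> b) * w b q)"
      by (rule dir_deriv_cong[OF V expand])
    also have "\<dots> = (\<Sum>b\<in>Basis. (e \<bullet> b) * dir_deriv M p x (w b))"
      by (subst dir_deriv_sum[OF V]) (auto intro!: smooth_fun_mult smooth_fun_const V smw simp: dir_deriv_cmult[OF V smw])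
    finally show ?thesis .
  qed
  have in2: "dir_deriv M p x (\<lambda>q. \<omega> q (Z q)) = (\<Sum>b\<in>Basis. (Z p c \<bullet> b) * dir_deriv M p x (w b) + (D Z (x c) \<bullet> b) * w b p)"
    if Z: "Z \<in> vfields M U" and x: "x \<in> tangent M p" for Z x
  proof -
    have "\<omega> q (Z q) = (\<Sum>b\<in>Basis. (Z q c \<bullet> b) * w b q)" if q: "q \<in> ?V" for q
      using expand[OF q, of "Z q c"] coord_vec_of_tangent[OF vfields_tangent[OF Z] ch[OF q]] q
      by simp
    then have "dir_deriv M p x (\<lambda>q. \<omega> q (Z q)) = dir_deriv M p x (\<lambda>q. \<Sum>b\<in>Basis. (Z q c \<bullet> b) * w b q)"
      by (rule dir_deriv_cong[OF V])
    also have "\<dots> = (\<Sum>b\<in>Basis. (Z p c \<bullet> b) * dir_deriv M p x (w b) + dir_deriv M p x (\<lambda>q. Z q c \<bullet> b) * w b p)"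
      by (rule dir_deriv_sum_mult[OF V sc[OF Z] smw])
    finally show ?thesis by (simp add: Db[OF Z x])
  qed
  have "\<omega> p (lie_bracket M X Y p) = (\<Sum>b\<in>Basis. ((D Y (X p c) - D X (Y p c)) \<bullet> b) * w b p)"
    unfolding lie_bracket_def Let_def c_def[symmetric] D_def[symmetric] w_def
    by (rule one_forms_coord_sum[OF \<omega> p cp])
  moreover have "ext_deriv M \<omega> p (X p) (Y p) = (\<Sum>b\<in>Basis. (Y p c \<bullet> b) * dir_deriv M p (X p) (w b)) -
     (\<Sum>b\<in>Basis. (X p c \<bullet> b) * dir_deriv M p (Y p) (w b))"
    using ext_deriv_chart[OF \<omega> U p cp vfields_tangent[OF X p] vfields_tangent[OF Y p]] by (simp add: in1)
  ultimately show ?thesis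
    unfolding in2[OF X vfields_tangent[OF Y p]] in2[OF Y vfields_tangent[OF X p]]
    by (simp add: sum.distrib inner_diff_left left_diff_distrib sum_subtractf)
qed

lemma lie_bracket_tangent: "p \<in> topspace (mtop M) \<Longrightarrow> lie_bracket M X Y p \<in> tangent M p"
  by (simp add: lie_bracket_def Let_def coord_vec_tangent chart_at)

end

section \<open>Orthonormal families\<close>

context
  fixes V :: "'v::real_vector set" and f assumes V: "subspace V" and f: "linear_on V f"
begin

lemma linear_on_add: "u \<in> V \<Longrightarrow> v \<in> V \<Longrightarrow> f (u + v) = f u + f v"
  using f[unfolded linear_on_def, rule_format, of u v 1 1] by simp

lemma linear_on_scale: "u \<in> V \<Longrightarrow> f (r *\<^sub>R u) = r * f u"
  using f[unfolded linear_on_def, rule_format, of u u r 0] by simp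

lemma linear_on_0: "f 0 = 0"
  using linear_on_scale[OF subspace_0[OF V], of 0] by simp

lemma linear_on_sum: "(\<And>i. i \<in> I \<Longrightarrow> v i \<in> V) \<Longrightarrow> f (\<Sum>i\<in>I. v i) = (\<Sum>i\<in>I. f (v i))"
proof (induction I rule: infinite_finite_induct)
  case (insert i I)
  then show ?case using linear_on_add[of "v i" "sum v I"] subspace_sum[OF V, of I v] by simp
qed (simp_all add: linear_on_0)

lemma linear_on_sum_scale:
  "(\<And>i. i \<in> I \<Longrightarrow> v i \<in> V) \<Longrightarrow> f (\<Sum>i\<in>I. r i *\<^sub>R v i) = (\<Sum>i\<in>I. r i * f (v i))"
  using linear_on_sum[of I "\<lambda>i. r i *\<^sub>R v i"] subspace_scale[OF V] linear_on_scale by simp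

end

lemma linear_imp_linear_on: "linear f \<Longrightarrow> linear_on V f"
  by (simp add: linear_on_def linear_add linear_scale)

text \<open>All laws are required on \<open>V\<close> only, since the values of \<open>g p\<close>
  are meaningful only on \<open>H p\<close>.\<close>

locale inner_on =
  fixes V :: "'v::real_vector set" and h :: "'v \<Rightarrow> 'v \<Rightarrow> real"
  assumes subspace_V: "subspace V"
    and lin: "u \<in> V \<Longrightarrow> linear_on V (h u)"
    and sym: "u \<in> V \<Longrightarrow> v \<in> V \<Longrightarrow> h u v = h v u"
    and pos: "u \<in> V \<Longrightarrow> u \<noteq> 0 \<Longrightarrow> h u u > 0"
begin

lemma lin_left: "v \<in> V \<Longrightarrow> linear_on V (\<lambda>u. h u v)"
  using lin[of v] sym subspace_V unfolding linear_on_def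
  by (metis (no_types, lifting) subspace_add subspace_scale)

text \<open>The vectors for which the expansion holds form a subspace that contains the family, and
  hence its span.\<close>

lemma orthonormal_expansion:
  assumes "finite I" "\<And>i. i \<in> I \<Longrightarrow> E i \<in> V"
    and on: "\<And>i j. i \<in> I \<Longrightarrow> j \<in> I \<Longrightarrow> h (E i) (E j) = (if i = j then 1 else 0)"
    and "v \<in> span (E ` I)"
  shows "v = (\<Sum>i\<in>I. h v (E i) *\<^sub>R E i)"
proof -
  let ?P = "\<lambda>v. \<Sum>i\<in>I. h v (E i) *\<^sub>R E i"
  have "E j = ?P (E j)" if "j \<in> I" for j
  proof -
    have "?P (E j) = (\<Sum>i\<in>I. (if i = j then E i else 0))"
      by (rule sum.cong) (auto simp: on that)
    then show ?thesis using assms(1) that by simp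
  qed
  then have "E ` I \<subseteq> {v \<in> V. v = ?P v}" using assms(2) by blast
  moreover have "subspace {v \<in> V. v = ?P v}"
    unfolding subspace_def
  proof (intro conjI ballI allI)
    show "0 \<in> {v \<in> V. v = ?P v}"
      using subspace_V assms(2) linear_on_0[OF subspace_V lin_left] by (simp add: subspace_0)
    fix v w and r :: real assume v: "v \<in> {v \<in> V. v = ?P v}"
    have "r *\<^sub>R v = r *\<^sub>R ?P v" using v by simp
    also have "\<dots> = ?P (r *\<^sub>R v)"
      unfolding scaleR_sum_right
      by (rule sum.cong) (use v assms(2) linear_on_scale[OF subspace_V lin_left] in auto)
    finally show "r *\<^sub>R v \<in> {v \<in> V. v = ?P v}" using v subspace_scale[OF subspace_V] by simp
    assume w: "w \<in> {v \<in> V. v = ?P v}"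
    have "v + w = ?P v + ?P w" using v w by simp
    also have "\<dots> = ?P (v + w)"
      unfolding sum.distrib[symmetric]
      by (rule sum.cong) (use v w assms(2) linear_on_add[OF subspace_V lin_left] in \<open>auto simp: scaleR_left_distrib\<close>)
    finally show "v + w \<in> {v \<in> V. v = ?P v}" using v w subspace_add[OF subspace_V] by simp
  qed
  ultimately show ?thesis using span_minimal assms(4) by blast
qed

text \<open>Both sides are the squared norm of the functional \<open>f\<close>: expand over
  \<open>B\<close> and apply Parseval's identity for \<open>A\<close>. Used in one slot of a
  bilinear form at a time, it makes the norm of \<Omega> independent of the basis.\<close>

lemma sum_squares_orthonormal:
  assumes f: "linear_on V f"
    and A: "finite A" "span A = V" "\<And>u v. u \<in> A \<Longrightarrow> v \<in> A \<Longrightarrow> h u v = (if u = v then 1 else 0)"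
    and B: "finite B" "span B = V" "\<And>u v. u \<in> B \<Longrightarrow> v \<in> B \<Longrightarrow> h u v = (if u = v then 1 else 0)"
  shows "(\<Sum>u\<in>A. (f u)\<^sup>2) = (\<Sum>u\<in>B. (f u)\<^sup>2)"
proof -
  have AV: "u \<in> V" if "u \<in> A" for u using that span_base A(2) by blast
  have BV: "u \<in> V" if "u \<in> B" for u using that span_base B(2) by blast
  have expB: "v = (\<Sum>w\<in>B. h v w *\<^sub>R w)" if "v \<in> V" for v
    using orthonormal_expansion[of B "\<lambda>w. w" v] B BV that by simp
  have expA: "v = (\<Sum>w\<in>A. h v w *\<^sub>R w)" if "v \<in> V" for v
    using orthonormal_expansion[of A "\<lambda>w. w" v] A AV that by simp
  have fB: "f v = (\<Sum>w\<in>B. h v w * f w)" if "v \<in> V" for v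
    using arg_cong[OF expB[OF that], of f] linear_on_sum_scale[OF subspace_V f, of B "\<lambda>w. w" "h v"] BV by simp
  \<comment> \<open>Parseval's identity: expand \<open>w\<close> over \<open>A\<close> and pair the
    result with \<open>w'\<close>.\<close>
  have par: "(\<Sum>u\<in>A. h u w * h u w') = h w w'" if "w \<in> B" "w' \<in> B" for w w'
  proof -
    have "h w' w = h w' (\<Sum>u\<in>A. h w u *\<^sub>R u)" using expA[of w] BV that by simp
    also have "\<dots> = (\<Sum>u\<in>A. h w u * h w' u)"
      using linear_on_sum_scale[OF subspace_V lin, of w' A "\<lambda>w. w" "h w"] AV BV that by simp
    also have "\<dots> = (\<Sum>u\<in>A. h u w * h u w')"
      using AV BV that sym by (intro sum.cong) auto
    finally show ?thesis using sym BV that by simp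
  qed
  have "(\<Sum>u\<in>A. (f u)\<^sup>2) = (\<Sum>u\<in>A. (\<Sum>w\<in>B. \<Sum>w'\<in>B. (h u w * h u w') * (f w * f w')))"
    by (intro sum.cong refl) (simp add: fB[OF AV] power2_eq_square sum_product mult_ac)
  also have "\<dots> = (\<Sum>w\<in>B. \<Sum>w'\<in>B. \<Sum>u\<in>A. (h u w * h u w') * (f w * f w'))"
    by (subst sum.swap, rule sum.cong[OF refl], subst sum.swap, rule refl)
  also have "\<dots> = (\<Sum>w\<in>B. \<Sum>w'\<in>B. h w w' * (f w * f w'))"
    by (intro sum.cong refl) (simp add: sum_distrib_right[symmetric] par)
  also have "\<dots> = (\<Sum>w\<in>B. \<Sum>w'\<in>B. if w = w' then f w * f w' else 0)"
    by (intro sum.cong refl) (simp add: B(3))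
  also have "\<dots> = (\<Sum>w\<in>B. (f w)\<^sup>2)" using B(1) by (simp add: power2_eq_square)
  finally show ?thesis .
qed

end

text \<open>\<open>S\<close> is a module of sections and \<open>F\<close> contains the coefficients that Gram-Schmidt needs.\<close>

lemma gram_schmidt_sections:
  fixes X :: "nat \<Rightarrow> 'x \<Rightarrow> 'v::real_vector"
  assumes inn: "\<And>x. x \<in> U \<Longrightarrow> inner_on (B x) (h x)"
    and SB: "\<And>Y x. Y \<in> S \<Longrightarrow> x \<in> U \<Longrightarrow> Y x \<in> B x"
    and Sadd: "\<And>Y Z. Y \<in> S \<Longrightarrow> Z \<in> S \<Longrightarrow> (\<lambda>x. Y x + Z x) \<in> S"
    and Sscale: "\<And>f Y. f \<in> F \<Longrightarrow> Y \<in> S \<Longrightarrow> (\<lambda>x. f x *\<^sub>R Y x) \<in> S"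
    and Fh: "\<And>Y Z. Y \<in> S \<Longrightarrow> Z \<in> S \<Longrightarrow> (\<lambda>x. h x (Y x) (Z x)) \<in> F"
    and Fneg: "\<And>f. f \<in> F \<Longrightarrow> (\<lambda>x. - f x) \<in> F"
    and Finv: "\<And>f. f \<in> F \<Longrightarrow> (\<And>x. x \<in> U \<Longrightarrow> f x > 0) \<Longrightarrow> (\<lambda>x. inverse (sqrt (f x))) \<in> F"
  shows "(\<And>i. i < k \<Longrightarrow> X i \<in> S) \<Longrightarrow>
    (\<And>i x. i < k \<Longrightarrow> x \<in> U \<Longrightarrow> X i x \<notin> span ((\<lambda>j. X j x) ` {..<i})) \<Longrightarrow>
    \<exists>E. (\<forall>i<k. E i \<in> S) \<and>
      (\<forall>x\<in>U. \<forall>i<k. \<forall>j<k. h x (E i x) (E j x) = (if i = j then 1 else 0)) \<and>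
      (\<forall>x\<in>U. span ((\<lambda>j. E j x) ` {..<k}) = span ((\<lambda>j. X j x) ` {..<k}))"
proof (induction k)
  case 0
  then show ?case by simp
next
  case (Suc k)
  have "\<exists>E. (\<forall>i<k. E i \<in> S) \<and>
      (\<forall>x\<in>U. \<forall>i<k. \<forall>j<k. h x (E i x) (E j x) = (if i = j then 1 else 0)) \<and>
      (\<forall>x\<in>U. span ((\<lambda>j. E j x) ` {..<k}) = span ((\<lambda>j. X j x) ` {..<k}))"
    by (rule Suc.IH) (use Suc.prems in auto)
  then obtain E where E: "\<And>i. i < k \<Longrightarrow> E i \<in> S"
      "\<And>x i j. x \<in> U \<Longrightarrow> i < k \<Longrightarrow> j < k \<Longrightarrow> h x (E i x) (E j x) = (if i = j then 1 else 0)"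
      "\<And>x. x \<in> U \<Longrightarrow> span ((\<lambda>j. E j x) ` {..<k}) = span ((\<lambda>j. X j x) ` {..<k})"
    by blast
  \<comment> \<open>The components along the first \<open>m\<close> vectors are subtracted.
    Introducing the partial sums lets membership in \<open>S\<close> follow by induction from
    closure under binary sums.\<close>
  define N where "N m x = X k x + (\<Sum>j<m. (- h x (X k x) (E j x)) *\<^sub>R E j x)" for m x
  have Xk: "X k \<in> S" using Suc.prems by simp
  have NS: "N m \<in> S" if "m \<le> k" for m
    using that
  proof (induction m)
    case 0
    then show ?case using Xk by (simp add: N_def)
  next
    case (Suc m)
    have "N (Suc m) = (\<lambda>x. N m x + (- h x (X k x) (E m x)) *\<^sub>R E m x)"
      by (simp add: N_def fun_eq_iff)
    moreover have "(\<lambda>x. N m x + (- h x (X k x) (E m x)) *\<^sub>R E m x) \<in> S"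
      using Suc by (intro Sadd Sscale Fneg Fh Xk E) auto
    ultimately show ?case by simp
  qed
  have EB: "E i x \<in> B x" if "i < k" "x \<in> U" for i x using SB E(1) that by blast
  have perp: "h x (N k x) (E i x) = 0" if x: "x \<in> U" and i: "i < k" for x i
  proof -
    interpret inner_on "B x" "h x" by (rule inn[OF x])
    have "h x (E i x) (N k x) = h x (E i x) (X k x) + (\<Sum>j<k. (- h x (X k x) (E j x)) * h x (E i x) (E j x))"
    proof -
      have "(\<Sum>j<k. (- h x (X k x) (E j x)) *\<^sub>R E j x) \<in> B x"
        by (intro subspace_sum[OF subspace_V] subspace_scale[OF subspace_V] EB x) auto
      from linear_on_add[OF subspace_V lin[OF EB[OF i x]] SB[OF Xk x] this] show ?thesis
        unfolding N_def
        by (subst (asm) linear_on_sum_scale[OF subspace_V lin[OF EB[OF i x]], of "{..<k}"]) (use EB x in auto)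
    qed
    also have "(\<Sum>j<k. (- h x (X k x) (E j x)) * h x (E i x) (E j x)) = (\<Sum>j<k. if j = i then - h x (X k x) (E j x) else 0)"
      by (rule sum.cong) (auto simp: E(2)[OF x i])
    also have "\<dots> = - h x (X k x) (E i x)" using i by simp
    finally show ?thesis using sym[OF EB[OF i x] SB[OF Xk x]] sym[OF EB[OF i x] SB[OF NS x]] by simp
  qed
  have Ndiff: "X k x - N k x \<in> span ((\<lambda>j. E j x) ` {..<k})" for x
  proof -
    have eq: "X k x - N k x = - (\<Sum>j<k. (- h x (X k x) (E j x)) *\<^sub>R E j x)" by (simp add: N_def)
    show ?thesis unfolding eq by (intro span_neg span_sum span_scale span_base) auto
  qed
  \<comment> \<open>If it vanished, \<open>X k x\<close> would lie in the span of its predecessors,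
    against independence.\<close>
  have N0: "N k x \<noteq> 0" if x: "x \<in> U" for x
    using Ndiff[of x] Suc.prems(2)[of k x] E(3)[OF x] x by auto
  define f where "f x = h x (N k x) (N k x)" for x
  have fpos: "f x > 0" if "x \<in> U" for x
    unfolding f_def by (rule inner_on.pos[OF inn[OF that] SB[OF NS that] N0[OF that]]) simp
  define e where "e x = inverse (sqrt (f x)) *\<^sub>R N k x" for x
  have eS: "e \<in> S" unfolding e_def using fpos by (intro Sscale Finv NS) (auto simp: f_def Fh NS)
  have ee: "h x (e x) (e x) = 1" if x: "x \<in> U" for x
  proof -
    interpret inner_on "B x" "h x" by (rule inn[OF x])
    have NB: "N k x \<in> B x" by (rule SB[OF NS x]) simp
    have "h x (e x) (e x) = inverse (sqrt (f x)) * inverse (sqrt (f x)) * f x"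
      unfolding f_def e_def
      using linear_on_scale[OF subspace_V lin NB, OF subspace_scale[OF subspace_V NB]]
        linear_on_scale[OF subspace_V lin_left[OF NB] NB] by simp
    also have "\<dots> = 1" using fpos[OF x] by (simp add: field_simps)
    finally show ?thesis .
  qed
  have eE: "h x (e x) (E i x) = 0" "h x (E i x) (e x) = 0" if x: "x \<in> U" and i: "i < k" for x i
  proof -
    interpret inner_on "B x" "h x" by (rule inn[OF x])
    show "h x (e x) (E i x) = 0"
      unfolding e_def using linear_on_scale[OF subspace_V lin_left[OF EB[OF i x]] SB[OF NS x]] perp[OF x i] by simp
    then show "h x (E i x) (e x) = 0" using sym[OF SB[OF eS x] EB[OF i x]] by simp
  qed
  \<comment> \<open>Up to earlier vectors, \<open>X k x\<close> and \<open>e x\<close> are nonzero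
    multiples of each other, so either can replace the other in a spanning set.\<close>
  have sp: "span (insert (e x) ((\<lambda>j. E j x) ` {..<k})) = span (insert (X k x) ((\<lambda>j. X j x) ` {..<k}))"
    (is "span (insert _ ?A) = span (insert _ ?C)") if x: "x \<in> U" for x
  proof (rule antisym; rule span_minimal[OF _ subspace_span]; rule insert_subsetI)
    have N1: "N k x \<in> span (insert (X k x) ?C)"
    proof -
      have "X k x - N k x \<in> span (insert (X k x) ?C)"
        using Ndiff[of x] E(3)[OF x] span_mono[OF subset_insertI] by blast
      from span_diff[OF span_base[of "X k x"] this] show ?thesis by simp
    qed
    then show "e x \<in> span (insert (X k x) ?C)" unfolding e_def by (rule span_scale)
    show "?A \<subseteq> span (insert (X k x) ?C)"
      using span_superset[of ?A] E(3)[OF x] span_mono[OF subset_insertI, of ?C "X k x"] by blast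
    have "N k x = sqrt (f x) *\<^sub>R e x" using fpos[OF x] by (simp add: e_def)
    then have "N k x \<in> span (insert (e x) ?A)" by (simp add: span_base span_scale)
    moreover have "X k x - N k x \<in> span (insert (e x) ?A)" using Ndiff[of x] span_mono[OF subset_insertI] by blast
    ultimately show "X k x \<in> span (insert (e x) ?A)" by (metis diff_add_cancel span_add)
    show "?C \<subseteq> span (insert (e x) ?A)"
      using span_superset[of ?C] E(3)[OF x] span_mono[OF subset_insertI, of ?A "e x"] by blast
  qed
  have im: "(\<lambda>j. (E(k := e)) j x) ` {..<Suc k} = insert (e x) ((\<lambda>j. E j x) ` {..<k})"
    "(\<lambda>j. X j x) ` {..<Suc k} = insert (X k x) ((\<lambda>j. X j x) ` {..<k})" for x
    by (auto simp: lessThan_Suc)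
  show ?case
  proof (intro exI[of _ "E(k := e)"] conjI ballI allI impI)
    show "(E(k := e)) i \<in> S" if "i < Suc k" for i using that eS E(1) by auto
    show "h x ((E(k := e)) i x) ((E(k := e)) j x) = (if i = j then 1 else 0)" if "x \<in> U" "i < Suc k" "j < Suc k" for x i j
      using that E(2) ee eE by auto
    show "span ((\<lambda>j. (E(k := e)) j x) ` {..<Suc k}) = span ((\<lambda>j. X j x) ` {..<Suc k})" if "x \<in> U" for x
      unfolding im by (rule sp[OF that])
  qed
qed

text \<open>If one of \<open>k\<close> spanning vectors lay in the span of its predecessors it could
  be dropped, and fewer than \<open>k\<close> vectors would span a space of dimension
  \<open>k\<close>. It provides the independence that Gram-Schmidt asks for.\<close>

lemma not_in_span_of_dim:
  fixes X :: "nat \<Rightarrow> 'v::real_vector"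
  assumes "dim (span (X ` {..<k})) = k" "i < k"
  shows "X i \<notin> span (X ` {..<i})"
proof
  assume *: "X i \<in> span (X ` {..<i})"
  let ?A = "X ` ({..<k} - {i})"
  have "X i \<in> span ?A" using * span_mono[of "X ` {..<i}" ?A] assms(2) by force
  moreover have "X ` {..<k} = insert (X i) ?A" using assms(2) by auto
  ultimately have "span (X ` {..<k}) = span ?A" by (simp add: span_redundant)
  then have "dim (span (X ` {..<k})) \<le> card ?A"
    using dim_le_card[of "span ?A" ?A] by simp
  also have "\<dots> \<le> card ({..<k} - {i})" by (rule card_image_le) simp
  also have "\<dots> < k" using assms(2) by simp
  finally show False using assms(1) by simp
qed

section \<open>Contact forms and adapted frames\<close>

context smooth_mfd
begin

lemma smooth_fun_component_sums:
  assumes U: "openin (mtop M) U"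
    and Y: "\<And>b. b \<in> Basis \<Longrightarrow> smooth_fun M U (\<lambda>q. Y q \<bullet> b)"
    and Z: "\<And>b. b \<in> Basis \<Longrightarrow> smooth_fun M U (\<lambda>q. Z q \<bullet> b)"
  shows "smooth_fun M U (\<lambda>q. (Y q :: 'f::euclidean_space) \<bullet> Z q)"
  by (subst euclidean_inner) (intro smooth_fun_sum smooth_fun_mult U Y Z)

text \<open>Smooth solutions of \<open>k < DIM\<close> independent linear equations without inverting a matrix: both the
  annihilator of H and the Reeb direction are obtained in this way.\<close>

lemma smooth_perp_vector:
  fixes Y :: "nat \<Rightarrow> 'a \<Rightarrow> 'f::euclidean_space"
  assumes U: "openin (mtop M) U" and p: "p \<in> U" and k: "k < DIM('f)"
    and Y: "\<And>i b. i < k \<Longrightarrow> b \<in> Basis \<Longrightarrow> smooth_fun M U (\<lambda>q. Y i q \<bullet> b)"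
    and indep: "\<And>i q. i < k \<Longrightarrow> q \<in> U \<Longrightarrow> Y i q \<notin> span ((\<lambda>j. Y j q) ` {..<i})"
  obtains W N where "openin (mtop M) W" "p \<in> W" "W \<subseteq> U"
    "\<forall>b\<in>Basis. smooth_fun M W (\<lambda>q. N q \<bullet> b)"
    "\<forall>q\<in>W. N q \<noteq> 0" "\<forall>q\<in>W. \<forall>i<k. N q \<bullet> Y i q = 0"
proof -
  let ?S = "{Y :: 'a \<Rightarrow> 'f. \<forall>b\<in>Basis. smooth_fun M U (\<lambda>q. Y q \<bullet> b)}"
  have inn: "inner_on UNIV ((\<bullet>) :: 'f \<Rightarrow> 'f \<Rightarrow> real)"
    by unfold_locales (auto simp: linear_on_def inner_simps inner_commute)
  have "\<exists>E. (\<forall>i<k. E i \<in> ?S) \<and>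
      (\<forall>x\<in>U. \<forall>i<k. \<forall>j<k. E i x \<bullet> E j x = (if i = j then 1 else 0)) \<and>
      (\<forall>x\<in>U. span ((\<lambda>j. E j x) ` {..<k}) = span ((\<lambda>j. Y j x) ` {..<k}))"
  \<comment> \<open>The sections are here the maps into a Euclidean space with smooth components,
    with the standard inner product at every point.\<close>
  proof (rule gram_schmidt_sections[where B = "\<lambda>_. UNIV" and h = "\<lambda>_. (\<bullet>)" and F = "Collect (smooth_fun M U)"])
    show "(\<lambda>x. Y x + Z x) \<in> ?S" if "Y \<in> ?S" "Z \<in> ?S" for Y Z
      using that by (auto simp: inner_add_left intro!: smooth_fun_add U)
    show "(\<lambda>x. f x *\<^sub>R Y x) \<in> ?S" if "f \<in> Collect (smooth_fun M U)" "Y \<in> ?S" for f Y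
      using that by (auto intro!: smooth_fun_mult U)
    show "(\<lambda>x. Y x \<bullet> Z x) \<in> Collect (smooth_fun M U)" if "Y \<in> ?S" "Z \<in> ?S" for Y Z
      using smooth_fun_component_sums[OF U, of Y Z] that by simp
    show "(\<lambda>x. - f x) \<in> Collect (smooth_fun M U)" if "f \<in> Collect (smooth_fun M U)" for f
      using smooth_fun_uminus[OF U] that by simp
    show "(\<lambda>x. inverse (sqrt (f x))) \<in> Collect (smooth_fun M U)"
      if f: "f \<in> Collect (smooth_fun M U)" "\<And>x. x \<in> U \<Longrightarrow> f x > 0" for f
      using smooth_fun_inverse[OF U smooth_fun_sqrt[OF U _ f(2)]] f by force
    show "Y i \<in> ?S" if "i < k" for i using Y that by simp
    show "Y i x \<notin> span ((\<lambda>j. Y j x) ` {..<i})" if "i < k" "x \<in> U" for i x by (rule indep[OF that])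
  qed (use inn in simp_all)
  then obtain E where E: "\<And>i b. i < k \<Longrightarrow> b \<in> Basis \<Longrightarrow> smooth_fun M U (\<lambda>q. E i q \<bullet> b)"
      "\<And>x i j. x \<in> U \<Longrightarrow> i < k \<Longrightarrow> j < k \<Longrightarrow> E i x \<bullet> E j x = (if i = j then 1 else 0)"
      "\<And>x. x \<in> U \<Longrightarrow> span ((\<lambda>j. E j x) ` {..<k}) = span ((\<lambda>j. Y j x) ` {..<k})"
    by blast
  have "span ((\<lambda>j. E j p) ` {..<k}) \<noteq> UNIV"
  proof
    assume "span ((\<lambda>j. E j p) ` {..<k}) = UNIV"
    then have "dim (UNIV :: 'f set) \<le> card ((\<lambda>j. E j p) ` {..<k})"
      by (intro dim_le_card) auto
    also have "\<dots> \<le> k" using card_image_le[of "{..<k}" "\<lambda>j. E j p"] by simp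
    finally show False using k by simp
  qed
  then obtain e where e: "e \<notin> span ((\<lambda>j. E j p) ` {..<k})" by blast
  \<comment> \<open>The part of the fixed vector \<open>e\<close> orthogonal to the span: nonzero at
    \<open>p\<close> by the choice of \<open>e\<close>, hence nonzero near \<open>p\<close>.\<close>
  define N where "N q = e - (\<Sum>j<k. (e \<bullet> E j q) *\<^sub>R E j q)" for q
  have smE: "smooth_fun M U (\<lambda>q. e \<bullet> E j q)" if "j < k" for j
    by (rule smooth_fun_component_sums[OF U]) (use E(1)[OF that] smooth_fun_const[OF U] in auto)
  have smN: "smooth_fun M U (\<lambda>q. N q \<bullet> b)" if "b \<in> Basis" for b
    unfolding N_def inner_diff_left inner_sum_left inner_scaleR_left
    by (rule smooth_fun_diff[OF U smooth_fun_const[OF U] smooth_fun_sum[OF U smooth_fun_mult[OF U smE E(1)[OF _ that]]]]) auto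
  have perpE: "N q \<bullet> E i q = 0" if "q \<in> U" "i < k" for q i
  proof -
    have "N q \<bullet> E i q = e \<bullet> E i q - (\<Sum>j<k. (e \<bullet> E j q) * (E j q \<bullet> E i q))"
      by (simp add: N_def inner_diff_left inner_sum_left)
    also have "(\<Sum>j<k. (e \<bullet> E j q) * (E j q \<bullet> E i q)) = (\<Sum>j<k. if j = i then e \<bullet> E j q else 0)"
      by (rule sum.cong) (use E(2)[OF that(1) _ that(2)] in auto)
    also have "\<dots> = e \<bullet> E i q" using that by simp
    finally show ?thesis by simp
  qed
  let ?W = "{q \<in> U. N q \<bullet> N q \<noteq> 0}"
  show ?thesis
  proof (rule that[of ?W N])
    show "openin (mtop M) ?W"
      by (rule openin_smooth_nonzero[OF U smooth_fun_component_sums[OF U smN smN]])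
    have "N p \<noteq> 0"
    proof
      assume "N p = 0"
      then have "e = (\<Sum>j<k. (e \<bullet> E j p) *\<^sub>R E j p)" by (simp add: N_def)
      moreover have "(\<Sum>j<k. (e \<bullet> E j p) *\<^sub>R E j p) \<in> span ((\<lambda>j. E j p) ` {..<k})"
        by (intro span_sum span_scale span_base) auto
      ultimately show False using e by simp
    qed
    then show "p \<in> ?W" using p by simp
    show "\<forall>b\<in>Basis. smooth_fun M ?W (\<lambda>q. N q \<bullet> b)"
      by (intro ballI smooth_fun_subset[OF smN]) auto
    show "\<forall>q\<in>?W. \<forall>i<k. N q \<bullet> Y i q = 0"
    proof (intro ballI allI impI)
      fix q i assume q: "q \<in> ?W" and i: "i < k"
      have "subspace {y. N q \<bullet> y = 0}" by (simp add: subspace_def inner_simps)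
      then have "span ((\<lambda>j. E j q) ` {..<k}) \<subseteq> {y. N q \<bullet> y = 0}"
        using perpE q by (intro span_minimal) auto
      then show "N q \<bullet> Y i q = 0" using E(3)[of q] q i span_base[of "Y i q" "(\<lambda>j. Y j q) ` {..<k}"] by blast
    qed
  qed auto
qed

end

locale sub_riem_contact = smooth_mfd M for M :: "('a, 'e::euclidean_space) manifold" +
  fixes H :: "'a \<Rightarrow> ('a, 'e) tvec set" and g :: "('a, 'e) bilin" and n :: nat
  assumes n_pos: "n \<ge> 1" and dim_M: "DIM('e) = 2 * n + 1" and src: "sub_riemannian_contact M H g"
begin

lemma H_subspace: "p \<in> topspace (mtop M) \<Longrightarrow> subspace (H p)"
  and H_tangent: "p \<in> topspace (mtop M) \<Longrightarrow> u \<in> H p \<Longrightarrow> u \<in> tangent M p"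
  and H_dim: "p \<in> topspace (mtop M) \<Longrightarrow> dim (H p) = 2 * n"
  using src dim_M unfolding sub_riemannian_contact_def contact_distribution_def smooth_subbundle_def by auto

lemma H_frame:
  assumes "p \<in> topspace (mtop M)"
  obtains U X where "openin (mtop M) U" "p \<in> U" "\<forall>i<2 * n. X i \<in> vfields M U"
    "\<forall>q\<in>U. span ((\<lambda>i. X i q) ` {..<2 * n}) = H q"
proof -
  have "\<exists>U X. openin (mtop M) U \<and> p \<in> U \<and> (\<forall>i<2 * n. X i \<in> vfields M U) \<and>
        (\<forall>q\<in>U. span ((\<lambda>i. X i q) ` {..<2 * n}) = H q)"
    using src dim_M assms unfolding sub_riemannian_contact_def contact_distribution_def smooth_subbundle_def
    by (metis add_diff_cancel_right')
  then show ?thesis using that by auto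
qed

lemma levi_nondegenerate:
  assumes "p \<in> topspace (mtop M)" "u \<in> H p" "u \<noteq> 0"
  obtains U X Y where "openin (mtop M) U" "p \<in> U" "X \<in> H_fields M H U" "Y \<in> H_fields M H U"
    "X p = u" "lie_bracket M X Y p \<notin> H p"
  using src assms that unfolding sub_riemannian_contact_def contact_distribution_def by blast

lemma metric_inner_on: "p \<in> topspace (mtop M) \<Longrightarrow> inner_on (H p) (g p)"
  using src H_subspace[of p] unfolding sub_riemannian_contact_def metric_on_def inner_on_def by blast

lemma metric_smooth:
  "openin (mtop M) U \<Longrightarrow> X \<in> H_fields M H U \<Longrightarrow> Y \<in> H_fields M H U \<Longrightarrow> smooth_fun M U (\<lambda>p. g p (X p) (Y p))"
  using src[unfolded sub_riemannian_contact_def metric_on_def, THEN conjunct2, THEN conjunct2, rule_format, of U X Y]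
  by simp

lemma H_fields_vfields: "X \<in> H_fields M H U \<Longrightarrow> X \<in> vfields M U"
  and H_fields_H: "X \<in> H_fields M H U \<Longrightarrow> p \<in> U \<Longrightarrow> X p \<in> H p"
  by (auto simp: H_fields_def)

lemma H_fieldsI: "X \<in> vfields M U \<Longrightarrow> (\<And>p. p \<in> U \<Longrightarrow> X p \<in> H p) \<Longrightarrow> X \<in> H_fields M H U"
  by (auto simp: H_fields_def)

lemma H_fields_restr:
  "X \<in> H_fields M H U \<Longrightarrow> openin (mtop M) V \<Longrightarrow> V \<subseteq> U \<Longrightarrow> restr V X \<in> H_fields M H V"
  by (auto simp: H_fields_def vfields_restr)

definition H_frame_on :: "'a set \<Rightarrow> (nat \<Rightarrow> ('a, 'e) vfield) \<Rightarrow> bool" where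
  "H_frame_on U E \<longleftrightarrow> (\<forall>i<2 * n. E i \<in> H_fields M H U) \<and>
     (\<forall>q\<in>U. (\<forall>i<2 * n. \<forall>j<2 * n. g q (E i q) (E j q) = (if i = j then 1 else 0)) \<and>
        span ((\<lambda>i. E i q) ` {..<2 * n}) = H q)"

lemma H_frame_onD:
  assumes "H_frame_on U E"
  shows "\<And>i. i < 2 * n \<Longrightarrow> E i \<in> H_fields M H U"
    "\<And>q i j. q \<in> U \<Longrightarrow> i < 2 * n \<Longrightarrow> j < 2 * n \<Longrightarrow> g q (E i q) (E j q) = (if i = j then 1 else 0)"
    "\<And>q. q \<in> U \<Longrightarrow> span ((\<lambda>i. E i q) ` {..<2 * n}) = H q"
  using assms by (auto simp: H_frame_on_def)

lemma H_frame_on_restr: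
  assumes "H_frame_on U E" "openin (mtop M) V" "V \<subseteq> U"
  shows "H_frame_on V (\<lambda>i. restr V (E i))"
  unfolding H_frame_on_def
  using H_frame_onD[OF assms(1)] H_fields_restr[OF _ assms(2,3)] assms(3) by (auto simp: subset_iff)

lemma orthonormal_frame:
  assumes "p \<in> topspace (mtop M)"
  obtains U E where "openin (mtop M) U" "p \<in> U" "H_frame_on U E"
proof -
  obtain U X where U: "openin (mtop M) U" "p \<in> U" and X': "\<forall>i<2 * n. X i \<in> vfields M U"
    and sp': "\<forall>q\<in>U. span ((\<lambda>i. X i q) ` {..<2 * n}) = H q"
    by (rule H_frame[OF assms])
  note X = X'[rule_format] and sp = sp'[rule_format]
  note top = openin_point[OF U(1)]
  have XH: "X i \<in> H_fields M H U" if "i < 2 * n" for i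
  proof (rule H_fieldsI[OF X[OF that]])
    fix q assume "q \<in> U"
    have "X i q \<in> span ((\<lambda>i. X i q) ` {..<2 * n})" by (rule span_base) (use that in auto)
    then show "X i q \<in> H q" by (simp only: sp[OF \<open>q \<in> U\<close>])
  qed
  have "\<exists>E. (\<forall>i<2 * n. E i \<in> H_fields M H U) \<and>
      (\<forall>x\<in>U. \<forall>i<2 * n. \<forall>j<2 * n. g x (E i x) (E j x) = (if i = j then 1 else 0)) \<and>
      (\<forall>x\<in>U. span ((\<lambda>j. E j x) ` {..<2 * n}) = span ((\<lambda>j. X j x) ` {..<2 * n}))"
  \<comment> \<open>The sections are here the fields of \<open>H\<close>, with \<open>g\<close> as
    inner product and smooth functions as coefficients.\<close>
  proof (rule gram_schmidt_sections[where B = H and F = "Collect (smooth_fun M U)"])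
    show "(\<lambda>x. Y x + Z x) \<in> H_fields M H U" if "Y \<in> H_fields M H U" "Z \<in> H_fields M H U" for Y Z
      using that by (intro H_fieldsI vfields_add U) (auto intro: subspace_add[OF H_subspace[OF top]] H_fields_vfields H_fields_H)
    show "(\<lambda>x. f x *\<^sub>R Y x) \<in> H_fields M H U" if "f \<in> Collect (smooth_fun M U)" "Y \<in> H_fields M H U" for f Y
      using that by (intro H_fieldsI vfields_scale U) (auto intro: subspace_scale[OF H_subspace[OF top]] H_fields_vfields H_fields_H)
    show "(\<lambda>x. inverse (sqrt (f x))) \<in> Collect (smooth_fun M U)"
      if f: "f \<in> Collect (smooth_fun M U)" "\<And>x. x \<in> U \<Longrightarrow> f x > 0" for f
      using smooth_fun_inverse[OF U(1) smooth_fun_sqrt[OF U(1) _ f(2)]] f by force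
    show "X i x \<notin> span ((\<lambda>j. X j x) ` {..<i})" if "i < 2 * n" "x \<in> U" for i x
      by (rule not_in_span_of_dim[OF _ that(1)]) (simp add: sp[OF that(2)] H_dim[OF top[OF that(2)]])
    show "(\<lambda>x. - f x) \<in> Collect (smooth_fun M U)" if "f \<in> Collect (smooth_fun M U)" for f
      using smooth_fun_uminus[OF U(1)] that by simp
    show "(\<lambda>x. g x (Y x) (Z x)) \<in> Collect (smooth_fun M U)" if "Y \<in> H_fields M H U" "Z \<in> H_fields M H U" for Y Z
      using metric_smooth[OF U(1) that] by simp
    show "inner_on (H x) (g x)" if "x \<in> U" for x by (rule metric_inner_on[OF top[OF that]])
    show "Y x \<in> H x" if "Y \<in> H_fields M H U" "x \<in> U" for Y x by (rule H_fields_H[OF that])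
    show "X i \<in> H_fields M H U" if "i < 2 * n" for i by (rule XH[OF that])
  qed
  then obtain E where "\<forall>i<2 * n. E i \<in> H_fields M H U"
      "\<forall>x\<in>U. \<forall>i<2 * n. \<forall>j<2 * n. g x (E i x) (E j x) = (if i = j then 1 else 0)"
      "\<forall>x\<in>U. span ((\<lambda>j. E j x) ` {..<2 * n}) = span ((\<lambda>j. X j x) ` {..<2 * n})"
    by blast
  then show ?thesis using that[of U E] U sp by (simp add: H_frame_on_def)
qed

subsection \<open>Contact forms\<close>

lemma contact_formD:
  assumes "contact_form M H U \<theta>"
  shows "openin (mtop M) U" "\<theta> \<in> one_forms M U" "\<And>p. p \<in> U \<Longrightarrow> \<theta> p \<noteq> 0"
    "\<And>p u. p \<in> U \<Longrightarrow> u \<in> H p \<Longrightarrow> \<theta> p u = 0"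
  using assms by (auto simp: contact_form_def)

lemma contact_form_restr:
  "contact_form M H U \<theta> \<Longrightarrow> openin (mtop M) V \<Longrightarrow> V \<subseteq> U \<Longrightarrow> contact_form M H V (restr V \<theta>)"
  by (auto simp: contact_form_def one_forms_restr)

text \<open>In a chart, \<open>H\<close> becomes a hyperplane spanned by \<open>2 * n\<close> smooth
  coordinate vectors; pairing coordinates with a smooth nonzero normal vector \<open>N\<close> of
  this hyperplane is the required form.\<close>

lemma contact_form_exists:
  assumes "p \<in> topspace (mtop M)"
  obtains W \<theta> where "p \<in> W" "contact_form M H W \<theta>"
proof -
  obtain U0 X where U0: "openin (mtop M) U0" "p \<in> U0" and X': "\<forall>i<2 * n. X i \<in> vfields M U0"
    and sp': "\<forall>q\<in>U0. span ((\<lambda>i. X i q) ` {..<2 * n}) = H q"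
    by (rule H_frame[OF assms])
  note X = X'[rule_format] and sp = sp'[rule_format]
  define c where "c = chart_at M p"
  note c = charts_atD[OF chart_at[OF assms], folded c_def]
  let ?U = "U0 \<inter> fst c"
  have U: "openin (mtop M) ?U" "p \<in> ?U" using U0 c by (auto intro!: openin_Int chart_domain_open)
  note top = openin_point[OF U(1)]
  have ch: "c \<in> charts_at M q" if "q \<in> ?U" for q using that c by (auto intro: charts_atI)
  define Y where "Y i q = X i q c" for i q
  have lin_c: "linear (\<lambda>v :: ('a, 'e) tvec. v c)" by (rule linearI) auto
  have HY: "span ((\<lambda>j. Y j q) ` J) = (\<lambda>v. v c) ` span ((\<lambda>j. X j q) ` J)" for q J
    unfolding Y_def using linear_span_image[OF lin_c, of "(\<lambda>j. X j q) ` J"] by (simp add: image_image)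
  have smY: "smooth_fun M ?U (\<lambda>q. Y i q \<bullet> b)" if "i < 2 * n" for i b
    unfolding Y_def
    by (rule iffD1[OF smooth_fun_cong[OF U(1)] vfields_component[OF U(1) vfields_restr[OF X[OF that] U(1)] c(1)]]) auto
  \<comment> \<open>Taking coordinates in a chart is injective on tangent vectors, so independence
    of the frame of \<open>H\<close> passes to its coordinate vectors.\<close>
  have indep: "Y i q \<notin> span ((\<lambda>j. Y j q) ` {..<i})" if "i < 2 * n" "q \<in> ?U" for i q
  proof
    assume "Y i q \<in> span ((\<lambda>j. Y j q) ` {..<i})"
    then obtain w where w: "w \<in> span ((\<lambda>j. X j q) ` {..<i})" "X i q c = w c"
      unfolding HY by (auto simp: Y_def)
    have "span ((\<lambda>j. X j q) ` {..<i}) \<subseteq> H q"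
      using sp[of q] span_mono[of "(\<lambda>j. X j q) ` {..<i}" "(\<lambda>j. X j q) ` {..<2 * n}"] that by force
    then have "X i q = w"
      using w that H_tangent[OF top[OF that(2)]] vfields_tangent[OF X[OF that(1)]] ch[OF that(2)]
      by (intro tangent_eqI[of _ q _ c]) auto
    moreover have "X i q \<notin> span ((\<lambda>j. X j q) ` {..<i})"
      by (rule not_in_span_of_dim[OF _ that(1)]) (use sp H_dim[OF top] that in auto)
    ultimately show False using w by simp
  qed
  obtain W N where W: "openin (mtop M) W" "p \<in> W" "W \<subseteq> ?U"
    and smN': "\<forall>b\<in>Basis. smooth_fun M W (\<lambda>q. N q \<bullet> b)"
    and N': "\<forall>q\<in>W. N q \<noteq> 0" "\<forall>q\<in>W. \<forall>i<2 * n. N q \<bullet> Y i q = 0"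
    by (rule smooth_perp_vector[OF U _ smY indep, of "2 * n"]) (use dim_M in simp_all)
  note smN = smN'[rule_format] and N = N'[rule_format]
  define \<theta> where "\<theta> q v = (if q \<in> W \<and> v \<in> tangent M q then N q \<bullet> v c else 0)" for q v
  have "\<theta> \<in> one_forms M W"
  proof -
    have "smooth_fun M V (\<lambda>p. \<theta> p (Z p))" if V: "openin (mtop M) V" "V \<subseteq> W" and Z: "Z \<in> vfields M V" for V Z
    proof (rule iffD1[OF smooth_fun_cong[OF V(1)]])
      show "smooth_fun M V (\<lambda>q. N q \<bullet> Z q c)"
      proof (rule smooth_fun_component_sums[OF V(1)])
        fix b :: 'e assume b: "b \<in> Basis"
        show "smooth_fun M V (\<lambda>q. N q \<bullet> b)" by (rule smooth_fun_subset[OF smN[OF b] V(2)])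
        show "smooth_fun M V (\<lambda>q. Z q c \<bullet> b)"
          by (rule vfields_component[OF V(1) Z c(1)]) (use W(3) V(2) in blast)
      qed
    qed (use V vfields_tangent[OF Z] in \<open>auto simp: \<theta>_def\<close>)
    moreover have "\<theta> q \<in> cotangent M q" if "q \<in> W" for q
      using subspace_tangent[OF openin_point[OF W(1) that]] that
      by (auto simp: \<theta>_def cotangent_def linear_on_def inner_simps subspace_add subspace_scale)
    moreover have "\<theta> q = 0" if "q \<notin> W" for q using that by (auto simp: \<theta>_def)
    ultimately show ?thesis by (auto simp: one_forms_def)
  qed
  moreover have "\<theta> q \<noteq> 0" if q: "q \<in> W" for q
  proof -
    have cq: "c \<in> charts_at M q" using ch q W by blast
    have "\<theta> q (coord_vec M c (N q) q) = N q \<bullet> N q"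
      using q by (simp add: \<theta>_def coord_vec_tangent[OF cq] coord_vec_self[OF cq])
    then show ?thesis using N(1)[OF q] by (metis inner_eq_zero_iff zero_fun_apply)
  qed
  moreover have "\<theta> q u = 0" if q: "q \<in> W" and u: "u \<in> H q" for q u
  proof -
    have "subspace {y. N q \<bullet> y = 0}" by (simp add: subspace_def inner_simps)
    then have "span ((\<lambda>j. Y j q) ` {..<2 * n}) \<subseteq> {y. N q \<bullet> y = 0}"
      using N(2) q by (intro span_minimal) auto
    moreover have "u c \<in> span ((\<lambda>j. Y j q) ` {..<2 * n})"
      unfolding HY using sp[of q] u q W by auto
    ultimately show ?thesis by (auto simp: \<theta>_def)
  qed
  ultimately show ?thesis using that[of W \<theta>] W by (simp add: contact_form_def)
qed

text \<open>Dimension count: a vector \<open>v\<close> outside \<open>H p\<close> killed by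
  \<open>\<theta> p\<close>, a basis of \<open>H p\<close> and a vector \<open>t\<close> not killed
  by \<open>\<theta> p\<close> would be \<open>2 * n + 2\<close> independent tangent
  vectors.\<close>

lemma contact_form_kernel:
  assumes \<theta>: "contact_form M H U \<theta>" and p: "p \<in> U" and v: "v \<in> tangent M p" and zero: "\<theta> p v = 0"
  shows "v \<in> H p"
proof (rule ccontr)
  assume vH: "v \<notin> H p"
  note th = contact_formD[OF \<theta>]
  have top: "p \<in> topspace (mtop M)" by (rule openin_point[OF th(1) p])
  obtain t where t: "\<theta> p t \<noteq> 0" using th(3)[OF p] by (auto simp: fun_eq_iff)
  then have tT: "t \<in> tangent M p" using one_forms_off_tangent[OF th(2)] by blast
  obtain B where B: "B \<subseteq> H p" "independent B" "H p \<subseteq> span B" "card B = dim (H p)"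
    by (rule basis_exists)
  have "card B = 2 * n" using B(4) H_dim[OF top] by simp
  \<comment> \<open>Infinite sets have \<open>card\<close> 0, so the positive cardinality
    \<open>2 * n\<close> implies finiteness.\<close>
  then have fB: "finite B" using n_pos by (metis card.infinite mult_is_0 not_one_le_zero zero_neq_numeral)
  have spB: "span B = H p" using B span_minimal[OF B(1) H_subspace[OF top]] by blast
  have iv: "independent (insert v B)" using B(2) vH spB by (intro independent_insertI) auto
  have "subspace {w \<in> tangent M p. \<theta> p w = 0}"
  proof -
    have "linear_on (tangent M p) (\<theta> p)" using one_forms_cotangent[OF th(2) p] by (simp add: cotangent_def)
    note L = linear_on_0[OF subspace_tangent[OF top] this] linear_on_add[OF subspace_tangent[OF top] this]
      linear_on_scale[OF subspace_tangent[OF top] this]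
    show ?thesis
      using L subspace_0[OF subspace_tangent[OF top]] subspace_add[OF subspace_tangent[OF top]]
        subspace_scale[OF subspace_tangent[OF top]]
      unfolding subspace_def by simp
  qed
  then have "span (insert v B) \<subseteq> {w \<in> tangent M p. \<theta> p w = 0}"
    using v zero B(1) H_tangent[OF top] th(4)[OF p] by (intro span_minimal) blast+
  then have "t \<notin> span (insert v B)" using t by blast
  then have it: "independent (insert t (insert v B))" using iv by (rule independent_insertI)
  have c: "chart_at M p \<in> charts_at M p" by (rule chart_at[OF top])
  let ?T = "(\<lambda>b. coord_vec M (chart_at M p) b p) ` Basis"
  have "tangent M p \<subseteq> span ?T"
  proof
    fix w assume "w \<in> tangent M p"
    then have "w = (\<Sum>b\<in>Basis. (w (chart_at M p) \<bullet> b) *\<^sub>R coord_vec M (chart_at M p) b p)"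
      using coord_vec_of_tangent[OF _ c] coord_vec_basis[OF c] by metis
    also have "\<dots> \<in> span ?T" by (intro span_sum span_scale span_base) auto
    finally show "w \<in> span ?T" .
  qed
  then have "insert t (insert v B) \<subseteq> span ?T" using tT v B(1) H_tangent[OF top] by blast
  then have "card (insert t (insert v B)) \<le> card ?T"
    using independent_span_bound[OF _ it, of ?T] by simp
  also have "\<dots> \<le> 2 * n + 1" using card_image_le[of Basis "\<lambda>b. coord_vec M (chart_at M p) b p"] dim_M by simp
  finally have "card (insert t (insert v B)) \<le> 2 * n + 1" .
  moreover have "t \<notin> insert v B" "v \<notin> B" using \<open>t \<notin> span (insert v B)\<close> span_base vH B(1) by blast+
  ultimately show False using \<open>card B = 2 * n\<close> fB by simp
qed

text \<open>On fields of \<open>H\<close> the functions \<theta>(X) and \<theta>(Y) vanish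
  identically, so Cartan's formula leaves d\<theta>(X,Y) = -\<theta>([X,Y]), which is nonzero
  because the bracket leaves \<open>H\<close>.\<close>

lemma contact_form_nondegenerate:
  assumes \<theta>: "contact_form M H U \<theta>" and p: "p \<in> U" and u: "u \<in> H p" "u \<noteq> 0"
  obtains v where "v \<in> H p" "ext_deriv M \<theta> p u v \<noteq> 0"
proof -
  note th = contact_formD[OF \<theta>]
  have top: "p \<in> topspace (mtop M)" by (rule openin_point[OF th(1) p])
  obtain V X Y where V: "openin (mtop M) V" "p \<in> V" and XY: "X \<in> H_fields M H V" "Y \<in> H_fields M H V"
    and Xp: "X p = u" and br: "lie_bracket M X Y p \<notin> H p"
    by (rule levi_nondegenerate[OF top u])
  let ?W = "U \<inter> V"
  have W: "openin (mtop M) ?W" "p \<in> ?W" using th(1) V p by auto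
  define X' where "X' = restr ?W X"
  define Y' where "Y' = restr ?W Y"
  have X': "X' \<in> H_fields M H ?W" and Y': "Y' \<in> H_fields M H ?W"
    unfolding X'_def Y'_def using H_fields_restr[OF XY(1) W(1)] H_fields_restr[OF XY(2) W(1)] by auto
  \<comment> \<open>The bracket at \<open>p\<close> depends only on the fields near
    \<open>p\<close>, so it survives the passage to the common domain of \<theta> and the
    fields.\<close>
  have br': "lie_bracket M X' Y' p = lie_bracket M X Y p"
  proof -
    have c: "chart_at M p \<in> atlas M" "p \<in> fst (chart_at M p)" using charts_atD[OF chart_at[OF top]] by auto
    have "frechet_derivative (\<lambda>x. restr ?W Z (chart_inv (chart_at M p) x) (chart_at M p)) (at (snd (chart_at M p) p)) =
      frechet_derivative (\<lambda>x. Z (chart_inv (chart_at M p) x) (chart_at M p)) (at (snd (chart_at M p) p))" for Z :: "('a, 'e) vfield"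
      by (rule frechet_derivative_cong_open(1)[OF chart_image_open[OF c(1) W(1)]]) (use c W in auto)
    then show ?thesis using W by (simp add: lie_bracket_def Let_def X'_def Y'_def)
  qed
  have \<theta>W: "restr ?W \<theta> \<in> one_forms M ?W" by (rule one_forms_restr[OF th(2) W(1)]) auto
  have "ext_deriv M (restr ?W \<theta>) p (X' p) (Y' p) =
    dir_deriv M p (X' p) (\<lambda>q. restr ?W \<theta> q (Y' q)) - dir_deriv M p (Y' p) (\<lambda>q. restr ?W \<theta> q (X' q)) -
    restr ?W \<theta> p (lie_bracket M X' Y' p)"
    by (rule ext_deriv_lie_bracket[OF \<theta>W W H_fields_vfields[OF X'] H_fields_vfields[OF Y']])
  moreover have "dir_deriv M p v (\<lambda>q. restr ?W \<theta> q (Z q)) = 0" if Z: "Z \<in> H_fields M H ?W" for Z v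
    by (rule dir_deriv_eq_const[OF W]) (use th(4) H_fields_H[OF Z] in auto)
  ultimately have "ext_deriv M (restr ?W \<theta>) p (X' p) (Y' p) = - \<theta> p (lie_bracket M X Y p)"
    using X' Y' W br' by simp
  moreover have "ext_deriv M (restr ?W \<theta>) p (X' p) (Y' p) = ext_deriv M \<theta> p (X' p) (Y' p)"
    by (rule ext_deriv_cong[OF W]) auto
  moreover have "\<theta> p (lie_bracket M X Y p) \<noteq> 0"
    using contact_form_kernel[OF \<theta> p lie_bracket_tangent[OF top]] br by blast
  ultimately have "ext_deriv M \<theta> p u (Y p) \<noteq> 0" using W Xp by (simp add: X'_def Y'_def)
  then show ?thesis using that H_fields_H[OF XY(2) V(2)] by blast
qed

section \<open>The norm of d\<theta> on \<open>H\<close>\<close>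

lemma orthonormal_basis_frame:
  assumes "\<And>i j. i < 2 * n \<Longrightarrow> j < 2 * n \<Longrightarrow> g q (E i) (E j) = (if i = j then 1 else 0)"
    and "span (E ` {..<2 * n}) = H q"
  shows "orthonormal_basis H g q (E ` {..<2 * n})" "inj_on E {..<2 * n}"
proof -
  show inj: "inj_on E {..<2 * n}"
  proof (rule inj_onI)
    fix i j assume ij: "i \<in> {..<2 * n}" "j \<in> {..<2 * n}" "E i = E j"
    then have "g q (E i) (E j) = 1" using assms(1)[of i i] by simp
    then show "i = j" using assms(1)[of i j] ij by (auto split: if_splits)
  qed
  show "orthonormal_basis H g q (E ` {..<2 * n})"
    unfolding orthonormal_basis_def using assms inj by (auto simp: inj_on_def)
qed

text \<open>\<open>Omega_norm_sq\<close> is computed in a basis picked by \<open>SOME\<close>; the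
  sum of squares is carried over to the frame in one argument after the other. Injectivity of the
  frame turns the sum over a set of vectors into a sum over indices.\<close>

lemma Omega_norm_sq_frame:
  assumes \<theta>: "\<theta> \<in> one_forms M U" and U: "openin (mtop M) U" "q \<in> U"
    and on: "\<And>i j. i < 2 * n \<Longrightarrow> j < 2 * n \<Longrightarrow> g q (E i) (E j) = (if i = j then 1 else 0)"
    and sp: "span (E ` {..<2 * n}) = H q"
  shows "Omega_norm_sq M H g \<theta> q = (\<Sum>i<2 * n. \<Sum>j<2 * n. (ext_deriv M \<theta> q (E i) (E j))\<^sup>2)"
proof -
  note top = openin_point[OF U]
  interpret inner_on "H q" "g q" by (rule metric_inner_on[OF top])
  define A where "A = E ` {..<2 * n}"
  define B where "B = (SOME B. orthonormal_basis H g q B)"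
  have A: "orthonormal_basis H g q A" "inj_on E {..<2 * n}"
    unfolding A_def by (rule orthonormal_basis_frame; use on sp in simp)+
  have B: "orthonormal_basis H g q B" unfolding B_def by (rule someI[of "orthonormal_basis H g q", OF A(1)])
  note A' = A(1)[unfolded orthonormal_basis_def] and B' = B[unfolded orthonormal_basis_def]
  have sq: "(\<Sum>u\<in>B. (f u)\<^sup>2) = (\<Sum>u\<in>A. (f u)\<^sup>2)" if "linear f" for f :: "('a, 'e) tvec \<Rightarrow> real"
    by (rule sum_squares_orthonormal[OF linear_imp_linear_on[OF that]]) (use A' B' in auto)
  note lin = ext_deriv_linear[OF U \<theta>]
  have "Omega_norm_sq M H g \<theta> q = (\<Sum>u\<in>B. \<Sum>v\<in>B. (ext_deriv M \<theta> q u v)\<^sup>2)"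
    by (simp add: Omega_norm_sq_def Let_def B_def)
  also have "\<dots> = (\<Sum>u\<in>B. \<Sum>v\<in>A. (ext_deriv M \<theta> q u v)\<^sup>2)" by (simp only: sq[OF lin(2)])
  also have "\<dots> = (\<Sum>v\<in>A. \<Sum>u\<in>B. (ext_deriv M \<theta> q u v)\<^sup>2)" by (rule sum.swap)
  also have "\<dots> = (\<Sum>v\<in>A. \<Sum>u\<in>A. (ext_deriv M \<theta> q u v)\<^sup>2)" by (simp only: sq[OF lin(1)])
  also have "\<dots> = (\<Sum>u\<in>A. \<Sum>v\<in>A. (ext_deriv M \<theta> q u v)\<^sup>2)" by (rule sum.swap)
  also have "\<dots> = (\<Sum>i<2 * n. \<Sum>j<2 * n. (ext_deriv M \<theta> q (E i) (E j))\<^sup>2)"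
    unfolding A_def by (simp add: sum.reindex[OF A(2)])
  finally show ?thesis .
qed

lemma Omega_norm_sq_cong:
  assumes "openin (mtop M) U" "q \<in> U" "\<And>p. p \<in> U \<Longrightarrow> \<theta> p = \<eta> p"
  shows "Omega_norm_sq M H g \<theta> q = Omega_norm_sq M H g \<eta> q"
  unfolding Omega_norm_sq_def Let_def by (simp add: ext_deriv_cong[OF assms])

lemma orthonormal_basis_exists: "p \<in> topspace (mtop M) \<Longrightarrow> \<exists>B. orthonormal_basis H g p B"
proof -
  assume p: "p \<in> topspace (mtop M)"
  obtain U E where U: "p \<in> U" and E: "H_frame_on U E" by (rule orthonormal_frame[OF p])
  show ?thesis
    by (rule exI, rule orthonormal_basis_frame(1)[OF H_frame_onD(2)[OF E U] H_frame_onD(3)[OF E U]])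
qed

text \<open>The terms of d(f\<theta>) with df contain a factor \<theta>, which vanishes on
  \<open>H\<close>.\<close>

lemma ext_deriv_scale_H:
  assumes \<theta>: "contact_form M H U \<theta>" and q: "q \<in> U" and f: "smooth_fun M U f"
    and uv: "u \<in> H q" "v \<in> H q"
  shows "ext_deriv M (\<lambda>p. f p *\<^sub>R \<theta> p) q u v = f q * ext_deriv M \<theta> q u v"
proof -
  note th = contact_formD[OF \<theta>]
  note top = openin_point[OF th(1) q]
  show ?thesis
    using ext_deriv_scale[OF th(1) q f th(2) H_tangent[OF top uv(1)] H_tangent[OF top uv(2)]]
      th(4)[OF q uv(1)] th(4)[OF q uv(2)] by simp
qed

lemma Omega_norm_sq_scale:
  assumes \<theta>: "contact_form M H U \<theta>" and q: "q \<in> U" and f: "smooth_fun M U f"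
  shows "Omega_norm_sq M H g (\<lambda>p. f p *\<^sub>R \<theta> p) q = (f q)\<^sup>2 * Omega_norm_sq M H g \<theta> q"
proof -
  note th = contact_formD[OF \<theta>]
  note top = openin_point[OF th(1) q]
  define B where "B = (SOME B. orthonormal_basis H g q B)"
  have "orthonormal_basis H g q B" unfolding B_def by (rule someI_ex[OF orthonormal_basis_exists[OF top]])
  then have B: "u \<in> H q" if "u \<in> B" for u using that span_base unfolding orthonormal_basis_def by blast
  have "(\<Sum>u\<in>B. \<Sum>v\<in>B. (ext_deriv M (\<lambda>p. f p *\<^sub>R \<theta> p) q u v)\<^sup>2) =
      (\<Sum>u\<in>B. \<Sum>v\<in>B. (f q)\<^sup>2 * (ext_deriv M \<theta> q u v)\<^sup>2)"
    by (intro sum.cong refl) (simp add: ext_deriv_scale_H[OF assms B B] power_mult_distrib)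
  then show ?thesis by (simp add: Omega_norm_sq_def Let_def B_def[symmetric] sum_distrib_left)
qed

section \<open>The Reeb field\<close>

lemma reeb_projection_H:
  assumes \<theta>: "contact_form M H U \<theta>" and q: "q \<in> U" and T: "T \<in> tangent M q" "\<theta> q T = 1" and v: "v \<in> tangent M q"
  shows "v - \<theta> q v *\<^sub>R T \<in> H q"
proof (rule contact_form_kernel[OF \<theta> q])
  note th = contact_formD[OF \<theta>]
  note tan = subspace_tangent[OF openin_point[OF th(1) q]]
  show "v - \<theta> q v *\<^sub>R T \<in> tangent M q" by (intro subspace_diff subspace_scale tan T v)
  show "\<theta> q (v - \<theta> q v *\<^sub>R T) = 0"
    using one_forms_lincomb[OF th(2) q v T(1), of 1 "- \<theta> q v"] T(2) by simp
qed

text \<open>The Reeb direction solves the \<open>2 * n\<close> equations d\<theta>(E_i, .) = 0 in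
  the \<open>2 * n + 1\<close> coordinates of the tangent space. Nondegeneracy makes the equations
  independent and keeps a nonzero solution out of \<open>H\<close>, so that it can be scaled to
  \<theta>(T) = 1.\<close>

lemma reeb_field_exists:
  assumes \<theta>: "contact_form M H U \<theta>" and p: "p \<in> U"
    and E: "\<And>i. i < 2 * n \<Longrightarrow> E i \<in> H_fields M H U"
    and sp: "\<And>q. q \<in> U \<Longrightarrow> span ((\<lambda>i. E i q) ` {..<2 * n}) = H q"
  obtains W T where "openin (mtop M) W" "p \<in> W" "W \<subseteq> U" "reeb_field M W \<theta> T"
proof -
  note th = contact_formD[OF \<theta>]
  define c where "c = chart_at M p"
  note c = charts_atD[OF chart_at[OF openin_point[OF th(1) p]], folded c_def]
  let ?U = "U \<inter> fst c"
  have U: "openin (mtop M) ?U" "p \<in> ?U" using th(1) p c by (auto intro!: openin_Int chart_domain_open)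
  note top = openin_point[OF U(1)]
  have ch: "c \<in> charts_at M q" if "q \<in> ?U" for q using that c by (auto intro: charts_atI)
  \<comment> \<open>The covector d\<theta>(E_i, .) written as a coordinate vector in the chart
    \<open>c\<close>, as \<open>w_inner\<close> confirms.\<close>
  define w where "w i q = (\<Sum>b\<in>Basis. ext_deriv M \<theta> q (E i q) (coord_vec M c b q) *\<^sub>R b)" for i q
  have lin: "linear (\<lambda>u. ext_deriv M \<theta> q u v)" "linear (\<lambda>v. ext_deriv M \<theta> q u v)" if "q \<in> ?U" for q u v
    using ext_deriv_linear[OF th(1) _ th(2), of q] that by auto
  have w_inner: "w i q \<bullet> x = ext_deriv M \<theta> q (E i q) (coord_vec M c x q)" if q: "q \<in> ?U" for i q x
  proof -
    have "ext_deriv M \<theta> q (E i q) (coord_vec M c x q) =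
        ext_deriv M \<theta> q (E i q) (\<Sum>b\<in>Basis. (x \<bullet> b) *\<^sub>R coord_vec M c b q)"
      by (subst coord_vec_basis[OF ch[OF q]]) (rule refl)
    also have "\<dots> = (\<Sum>b\<in>Basis. (x \<bullet> b) * ext_deriv M \<theta> q (E i q) (coord_vec M c b q))"
      by (subst linear_sum[OF lin(2)[OF q]]) (simp only: linear_scale[OF lin(2)[OF q]] real_scaleR_def)
    also have "\<dots> = w i q \<bullet> x"
      unfolding w_def inner_sum_left by (rule sum.cong) (auto simp: inner_commute)
    finally show ?thesis by simp
  qed
  have smw: "smooth_fun M ?U (\<lambda>q. w i q \<bullet> b)" if "i < 2 * n" "b \<in> Basis" for i b
  proof (rule iffD1[OF smooth_fun_cong[OF U(1)]])
    have "restr ?U (E i) \<in> vfields M ?U"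
      by (rule vfields_restr[OF H_fields_vfields[OF E[OF that(1)]] U(1)]) auto
    moreover have "restr ?U (coord_vec M c b) \<in> vfields M ?U"
      using vfields_coord[OF U(1) c(1), of "\<lambda>_. b"] smooth_fun_const[OF U(1)] by simp
    moreover have "restr ?U \<theta> \<in> one_forms M ?U" by (rule one_forms_restr[OF th(2) U(1)]) auto
    ultimately show "smooth_fun M ?U (\<lambda>q. ext_deriv M (restr ?U \<theta>) q (restr ?U (E i) q) (restr ?U (coord_vec M c b) q))"
      using smooth_fun_ext_deriv[OF _ U(1)] by blast
    show "ext_deriv M (restr ?U \<theta>) q (restr ?U (E i) q) (restr ?U (coord_vec M c b) q) = w i q \<bullet> b" if "q \<in> ?U" for q
      using w_inner[OF that] ext_deriv_cong[OF U(1) that, of "restr ?U \<theta>" \<theta>] that by simp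
  qed
  have indep: "w i q \<notin> span ((\<lambda>j. w j q) ` {..<i})" if i: "i < 2 * n" and q: "q \<in> ?U" for i q
  proof
    assume *: "w i q \<in> span ((\<lambda>j. w j q) ` {..<i})"
    \<comment> \<open>\<open>L u\<close> is the coordinate vector of d\<theta>(u, .), and
      \<open>w i q\<close> is \<open>L (E i q)\<close>: a relation among the \<open>w\<close> would
      give a nonzero vector of \<open>H\<close> killed by \<open>L\<close>, against
      nondegeneracy.\<close>
    define L where "L u = (\<Sum>b\<in>Basis. ext_deriv M \<theta> q u (coord_vec M c b q) *\<^sub>R b)" for u
    have L: "linear L" unfolding L_def
      by (intro linear_compose_sum ballI linearI)
        (auto simp: linear_add[OF lin(1)[OF q]] linear_scale[OF lin(1)[OF q]] scaleR_left_distrib)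
    have "(\<lambda>j. w j q) ` {..<i} = L ` (\<lambda>j. E j q) ` {..<i}" by (auto simp: w_def L_def)
    then obtain e where e: "e \<in> span ((\<lambda>j. E j q) ` {..<i})" "w i q = L e"
      using * linear_span_image[OF L] by auto
    have eH: "e \<in> H q"
      using e(1) sp[of q] span_mono[of "(\<lambda>j. E j q) ` {..<i}" "(\<lambda>j. E j q) ` {..<2 * n}"] i q by force
    have EH: "E i q \<in> H q" using H_fields_H[OF E[OF i]] q by blast
    have Hs: "subspace (H q)" by (rule H_subspace[OF top[OF q]])
    have "w i q = L (E i q)" by (simp only: w_def L_def)
    then have "L (E i q - e) = 0" using e(2) linear_diff[OF L, of "E i q" e] by simp
    have "ext_deriv M \<theta> q (E i q - e) v = 0" if v: "v \<in> H q" for v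
    proof -
      have "v = (\<Sum>b\<in>Basis. (v c \<bullet> b) *\<^sub>R coord_vec M c b q)"
        using coord_vec_of_tangent[OF H_tangent[OF top[OF q] v] ch[OF q]] coord_vec_basis[OF ch[OF q]] by metis
      then have "ext_deriv M \<theta> q (E i q - e) v =
          (\<Sum>b\<in>Basis. (v c \<bullet> b) * ext_deriv M \<theta> q (E i q - e) (coord_vec M c b q))"
        using linear_sum[OF lin(2)[OF q, of "E i q - e"], of "\<lambda>b. (v c \<bullet> b) *\<^sub>R coord_vec M c b q" Basis]
        by (simp only: linear_scale[OF lin(2)[OF q]] real_scaleR_def)
      also have "\<dots> = L (E i q - e) \<bullet> v c"
        unfolding L_def inner_sum_left by (rule sum.cong) (auto simp: inner_commute)
      finally show ?thesis using \<open>L (E i q - e) = 0\<close> by simp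
    qed
    then have "E i q - e = 0"
      using contact_form_nondegenerate[OF \<theta> _ subspace_diff[OF Hs EH eH]] q by blast
    moreover have "E i q \<notin> span ((\<lambda>j. E j q) ` {..<i})"
      by (rule not_in_span_of_dim[OF _ i]) (use sp H_dim[OF top[OF q]] q in auto)
    ultimately show False using e(1) by simp
  qed
  obtain W N where W: "openin (mtop M) W" "p \<in> W" "W \<subseteq> ?U"
    and smN': "\<forall>b\<in>Basis. smooth_fun M W (\<lambda>q. N q \<bullet> b)"
    and N': "\<forall>q\<in>W. N q \<noteq> 0" "\<forall>q\<in>W. \<forall>i<2 * n. N q \<bullet> w i q = 0"
    by (rule smooth_perp_vector[OF U _ smw indep, of "2 * n"]) (use dim_M in simp_all)
  note smN = smN'[rule_format] and N = N'[rule_format]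
  have WU: "q \<in> ?U" "q \<in> U" "q \<in> topspace (mtop M)" if "q \<in> W" for q using W(3) that top by auto
  define T0 where "T0 = restr W (\<lambda>q. coord_vec M c (N q) q)"
  have T0: "T0 \<in> vfields M W" unfolding T0_def using W(3) by (intro vfields_coord W(1) c(1) smN) auto
  have T0q: "T0 q = coord_vec M c (N q) q" if "q \<in> W" for q using that by (simp add: T0_def)
  have T0H: "ext_deriv M \<theta> q u (T0 q) = 0" if q: "q \<in> W" and u: "u \<in> H q" for q u
  proof -
    note L = lin(1)[OF WU(1)[OF q], of "T0 q"]
    have "subspace {u. ext_deriv M \<theta> q u (T0 q) = 0}"
      by (simp add: subspace_def linear_0[OF L] linear_add[OF L] linear_scale[OF L])
    moreover have "ext_deriv M \<theta> q (E i q) (T0 q) = 0" if "i < 2 * n" for i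
      using w_inner[OF WU(1)[OF q], of i "N q"] N(2)[OF q that] T0q[OF q] by (simp add: inner_commute)
    ultimately have "span ((\<lambda>i. E i q) ` {..<2 * n}) \<subseteq> {u. ext_deriv M \<theta> q u (T0 q) = 0}"
      by (intro span_minimal) auto
    then show ?thesis using sp[OF WU(2)[OF q]] u by auto
  qed
  have T0t: "T0 q \<in> tangent M q" if "q \<in> W" for q by (rule vfields_tangent[OF T0 that])
  have \<theta>T0: "\<theta> q (T0 q) \<noteq> 0" if q: "q \<in> W" for q
  proof
    assume "\<theta> q (T0 q) = 0"
    then have "T0 q \<in> H q" by (rule contact_form_kernel[OF \<theta> WU(2)[OF q] T0t[OF q]])
    moreover have "T0 q \<noteq> 0"
      using N(1)[OF q] T0q[OF q] coord_vec_self[OF ch[OF WU(1)[OF q]], of "N q"] by (metis zero_fun_apply)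
    ultimately obtain v where "v \<in> H q" "ext_deriv M \<theta> q (T0 q) v \<noteq> 0"
      by (rule contact_form_nondegenerate[OF \<theta> WU(2)[OF q]])
    then show False using T0H[OF q] ext_deriv_antisym[of \<theta> q "T0 q" v] by simp
  qed
  have sm\<theta>: "smooth_fun M W (\<lambda>q. \<theta> q (T0 q))"
    by (rule one_forms_smooth[OF th(2) W(1) _ T0]) (use W(3) in auto)
  define T where "T q = inverse (\<theta> q (T0 q)) *\<^sub>R T0 q" for q
  have Tv: "T \<in> vfields M W"
    unfolding T_def by (rule vfields_scale[OF W(1) smooth_fun_inverse[OF W(1) sm\<theta> \<theta>T0] T0])
  have \<theta>T: "\<theta> q (T q) = 1" if q: "q \<in> W" for q
    using one_forms_lincomb[OF th(2) WU(2)[OF q] T0t[OF q] T0t[OF q], of "inverse (\<theta> q (T0 q))" 0] \<theta>T0[OF q]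
    by (simp add: T_def)
  \<comment> \<open>So far the equation is known for \<open>H\<close> only. A tangent vector is a
    vector of \<open>H\<close> plus a multiple of \<open>T q\<close>, and on the latter it holds by
    antisymmetry.\<close>
  have "ext_deriv M \<theta> q (T q) v = 0" if q: "q \<in> W" and v: "v \<in> tangent M q" for q v
  proof -
    let ?P = "v - \<theta> q v *\<^sub>R T q"
    have PH: "?P \<in> H q"
      by (rule reeb_projection_H[OF \<theta> WU(2)[OF q] vfields_tangent[OF Tv q] \<theta>T[OF q] v])
    have "ext_deriv M \<theta> q (T q) v = ext_deriv M \<theta> q (T q) ?P + \<theta> q v * ext_deriv M \<theta> q (T q) (T q)"
      using linear_diff[OF lin(2)[OF WU(1)[OF q], of "T q"], of v "\<theta> q v *\<^sub>R T q"]
        linear_scale[OF lin(2)[OF WU(1)[OF q], of "T q"], of "\<theta> q v" "T q"] by simp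
    moreover have "ext_deriv M \<theta> q (T q) (T q) = 0" using ext_deriv_antisym[of \<theta> q "T q" "T q"] by simp
    moreover have "ext_deriv M \<theta> q (T q) ?P = 0"
      using T0H[OF q PH] ext_deriv_antisym[of \<theta> q "T q" ?P] linear_scale[OF lin(2)[OF WU(1)[OF q], of ?P], of _ "T0 q"]
      by (simp add: T_def)
    ultimately show ?thesis by simp
  qed
  then have "reeb_field M W \<theta> T" using Tv \<theta>T by (simp add: reeb_field_def)
  moreover have "W \<subseteq> U" using W(3) by blast
  ultimately show ?thesis using that W by blast
qed

lemma reeb_fieldD:
  assumes "reeb_field M U \<theta> T"
  shows "T \<in> vfields M U" "\<And>p. p \<in> U \<Longrightarrow> \<theta> p (T p) = 1"
    "\<And>p v. p \<in> U \<Longrightarrow> v \<in> tangent M p \<Longrightarrow> ext_deriv M \<theta> p (T p) v = 0"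
  using assms by (auto simp: reeb_field_def)

section \<open>Normalised contact forms: local existence, and uniqueness up to sign\<close>

definition normalized :: "'a set \<Rightarrow> ('a, 'e) oneform \<Rightarrow> ('a, 'e) vfield \<Rightarrow> bool" where
  "normalized U \<theta> T \<longleftrightarrow> contact_form M H U \<theta> \<and> (\<forall>p\<in>U. Omega_norm_sq M H g \<theta> p = 2 * real n) \<and>
     reeb_field M U \<theta> T"

lemma normalizedD:
  assumes "normalized U \<theta> T"
  shows "contact_form M H U \<theta>" "\<And>p. p \<in> U \<Longrightarrow> Omega_norm_sq M H g \<theta> p = 2 * real n"
    "reeb_field M U \<theta> T"
  using assms by (auto simp: normalized_def)

lemma normalized_restr:
  assumes "normalized U \<theta> T" "openin (mtop M) V" "V \<subseteq> U"
  shows "normalized V (restr V \<theta>) (restr V T)"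
proof -
  note N = normalizedD[OF assms(1)]
  note R = reeb_fieldD[OF N(3)]
  have dr: "ext_deriv M (restr V \<theta>) p = ext_deriv M \<theta> p" if "p \<in> V" for p
    by (intro ext ext_deriv_cong[OF assms(2) that]) simp
  have "Omega_norm_sq M H g (restr V \<theta>) p = 2 * real n" if "p \<in> V" for p
    using Omega_norm_sq_cong[OF assms(2) that, of "restr V \<theta>" \<theta>] N(2)[of p] that assms(3) by auto
  moreover have "reeb_field M V (restr V \<theta>) (restr V T)"
    unfolding reeb_field_def using R vfields_restr[OF R(1) assms(2,3)] assms(3) by (auto simp: dr)
  ultimately show ?thesis unfolding normalized_def using contact_form_restr[OF N(1) assms(2,3)] by simp
qed

lemma normalized_frame_exists:
  assumes "p \<in> topspace (mtop M)"
  obtains W \<theta> T E where "p \<in> W" "normalized W \<theta> T" "H_frame_on W E"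
proof -
  obtain U0 \<theta>0 where U0: "p \<in> U0" and \<theta>0: "contact_form M H U0 \<theta>0"
    by (rule contact_form_exists[OF assms])
  obtain U1 E1 where U1: "openin (mtop M) U1" "p \<in> U1" and E1: "H_frame_on U1 E1"
    by (rule orthonormal_frame[OF assms])
  let ?U = "U0 \<inter> U1"
  have U: "openin (mtop M) ?U" "p \<in> ?U" using U0 U1 contact_formD(1)[OF \<theta>0] by auto
  define \<theta> where "\<theta> = restr ?U \<theta>0"
  define E where "E = (\<lambda>i. restr ?U (E1 i))"
  have \<theta>: "contact_form M H ?U \<theta>" unfolding \<theta>_def by (rule contact_form_restr[OF \<theta>0 U(1)]) auto
  have EF: "H_frame_on ?U E" unfolding E_def by (rule H_frame_on_restr[OF E1 U(1)]) auto
  note th = contact_formD[OF \<theta>] and E = H_frame_onD[OF EF]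
  note top = openin_point[OF U(1)]
  define N where "N q = (\<Sum>i<2 * n. \<Sum>j<2 * n. (ext_deriv M \<theta> q (E i q) (E j q))\<^sup>2)" for q
  have NO: "Omega_norm_sq M H g \<theta> q = N q" if q: "q \<in> ?U" for q
    unfolding N_def by (rule Omega_norm_sq_frame[OF th(2,1) q E(2)[OF q] E(3)[OF q]])
  have smN: "smooth_fun M ?U N"
    unfolding N_def power2_eq_square
    by (intro smooth_fun_sum smooth_fun_mult smooth_fun_ext_deriv[OF th(2)] H_fields_vfields E(1) U(1)) auto
  \<comment> \<open>If the sum vanished, d\<theta> would vanish on \<open>H\<close>, although
    \<open>E 0 q\<close> is a nonzero vector of \<open>H\<close>; the index 0 is available because
    \<open>n \<ge> 1\<close>.\<close>
  have Npos: "N q > 0" if q: "q \<in> ?U" for q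
  proof (rule ccontr)
    assume "\<not> N q > 0"
    moreover have "N q \<ge> 0" unfolding N_def by (intro sum_nonneg) auto
    ultimately have "N q = 0" by simp
    then have z: "ext_deriv M \<theta> q (E i q) (E j q) = 0" if "i < 2 * n" "j < 2 * n" for i j
      using that unfolding N_def
      by (subst (asm) sum_nonneg_eq_0_iff) (auto intro!: sum_nonneg simp: sum_nonneg_eq_0_iff)
    have E0: "E 0 q \<in> H q" using E(1)[of 0] H_fields_H[OF _ q] n_pos by simp
    interpret inner_on "H q" "g q" by (rule metric_inner_on[OF top[OF q]])
    have "E 0 q \<noteq> 0"
      using E(2)[OF q, of 0 0] n_pos linear_on_0[OF subspace_V lin[OF E0]] by auto
    with \<theta> q E0 obtain v where v: "v \<in> H q" "ext_deriv M \<theta> q (E 0 q) v \<noteq> 0"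
      by (rule contact_form_nondegenerate)
    have L: "linear (\<lambda>v. ext_deriv M \<theta> q (E 0 q) v)" by (rule ext_deriv_linear(2)[OF th(1) q th(2)])
    have "subspace {v. ext_deriv M \<theta> q (E 0 q) v = 0}"
      by (simp add: subspace_def linear_0[OF L] linear_add[OF L] linear_scale[OF L])
    then have "span ((\<lambda>i. E i q) ` {..<2 * n}) \<subseteq> {v. ext_deriv M \<theta> q (E 0 q) v = 0}"
      using z n_pos by (intro span_minimal) auto
    then show False using E(3)[OF q] v by auto
  qed
  \<comment> \<open>The squared norm \<open>N\<close> gets multiplied by the square of
    \<open>f\<close>, so this is the positive factor that brings it to \<open>2 * n\<close>; it is
    smooth because the radicand is smooth and positive.\<close>
  define f where "f q = sqrt (2 * real n * inverse (N q))" for q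
  have smf: "smooth_fun M ?U f"
    unfolding f_def using Npos n_pos
    by (intro smooth_fun_sqrt smooth_fun_mult smooth_fun_const smooth_fun_inverse smN U(1)) (auto simp: less_imp_neq[symmetric])
  have fpos: "f q > 0" if "q \<in> ?U" for q unfolding f_def using Npos[OF that] n_pos by simp
  define \<eta> where "\<eta> q = f q *\<^sub>R \<theta> q" for q
  have \<eta>: "contact_form M H ?U \<eta>"
    unfolding contact_form_def
  proof (intro conjI ballI)
    show "openin (mtop M) ?U" by (rule U(1))
    show "\<eta> \<in> one_forms M ?U" unfolding \<eta>_def by (rule one_forms_scale[OF U(1) smf th(2)])
    fix q assume q: "q \<in> ?U"
    show "\<eta> q \<noteq> 0" using fpos[OF q] th(3)[OF q] by (simp add: \<eta>_def)
    fix u assume "u \<in> H q"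
    then show "\<eta> q u = 0" using th(4)[OF q] by (simp add: \<eta>_def)
  qed
  have norm: "Omega_norm_sq M H g \<eta> q = 2 * real n" if q: "q \<in> ?U" for q
  proof -
    have "Omega_norm_sq M H g \<eta> q = (f q)\<^sup>2 * N q"
      unfolding \<eta>_def using Omega_norm_sq_scale[OF \<theta> q smf] NO[OF q] by simp
    also have "(f q)\<^sup>2 = 2 * real n * inverse (N q)" unfolding f_def using Npos[OF q] by simp
    finally show ?thesis using Npos[OF q] by simp
  qed
  obtain W T where W: "openin (mtop M) W" "p \<in> W" "W \<subseteq> ?U" and T: "reeb_field M W \<eta> T"
    by (rule reeb_field_exists[OF \<eta> U(2) E(1) E(3)])
  note R = reeb_fieldD[OF T]
  have dr: "ext_deriv M (restr W \<eta>) q = ext_deriv M \<eta> q" if "q \<in> W" for q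
    by (intro ext ext_deriv_cong[OF W(1) that]) simp
  have "Omega_norm_sq M H g (restr W \<eta>) q = 2 * real n" if "q \<in> W" for q
    using Omega_norm_sq_cong[OF W(1) that, of "restr W \<eta>" \<eta>] norm[of q] that W(3) by auto
  moreover have "reeb_field M W (restr W \<eta>) T"
    unfolding reeb_field_def using R by (auto simp: dr)
  ultimately have "normalized W (restr W \<eta>) T"
    unfolding normalized_def using contact_form_restr[OF \<eta> W(1,3)] by simp
  then show ?thesis using that W(2) H_frame_on_restr[OF EF W(1,3)] by blast
qed

text \<open>The factor is \<theta>'(T), and equality of the norms makes its square 1. As
  \<open>U\<close> may be disconnected, the sign is kept as a function \<open>a\<close>; from a a =
  1 its derivative vanishes, which gives d\<theta>' = a d\<theta>, and then T' = a T because
  nondegeneracy leaves only one Reeb direction.\<close>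

lemma normalized_sign:
  assumes N: "normalized U \<theta> T" and N': "normalized U \<theta>' T'"
  obtains a where "smooth_fun M U a" "\<forall>q\<in>U. a q * a q = 1" "\<forall>q\<in>U. \<theta>' q = a q *\<^sub>R \<theta> q"
    "\<forall>q\<in>U. T' q = a q *\<^sub>R T q" "\<forall>q\<in>U. \<forall>v. dir_deriv M q v a = 0"
    "\<forall>q\<in>U. \<forall>u\<in>tangent M q. \<forall>v\<in>tangent M q. ext_deriv M \<theta>' q u v = a q * ext_deriv M \<theta> q u v"
proof -
  note n = normalizedD[OF N] and n' = normalizedD[OF N']
  note th = contact_formD[OF n(1)] and th' = contact_formD[OF n'(1)]
  note R = reeb_fieldD[OF n(3)] and R' = reeb_fieldD[OF n'(3)]
  note U = th(1) and top = openin_point[OF th(1)]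
  define a where "a q = \<theta>' q (T q)" for q
  have sma: "smooth_fun M U a" unfolding a_def by (rule one_forms_smooth[OF th'(2) U order_refl R(1)])
  have Tt: "T q \<in> tangent M q" "T' q \<in> tangent M q" if "q \<in> U" for q
    using vfields_tangent[OF R(1) that] vfields_tangent[OF R'(1) that] by auto
  have \<theta>': "\<theta>' q = a q *\<^sub>R \<theta> q" if q: "q \<in> U" for q
  proof
    fix v
    show "\<theta>' q v = (a q *\<^sub>R \<theta> q) v"
    proof (cases "v \<in> tangent M q")
      case True
      have "v - \<theta> q v *\<^sub>R T q \<in> H q"
        by (rule reeb_projection_H[OF n(1) q Tt(1)[OF q] R(2)[OF q] True])
      then have "\<theta>' q (v - \<theta> q v *\<^sub>R T q) = 0" by (rule th'(4)[OF q])
      then show ?thesis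
        using one_forms_lincomb[OF th'(2) q True Tt(1)[OF q], of 1 "- \<theta> q v"] by (simp add: a_def)
    next
      case False
      then show ?thesis using one_forms_off_tangent[OF th(2)] one_forms_off_tangent[OF th'(2)] by simp
    qed
  qed
  have a2: "a q * a q = 1" if q: "q \<in> U" for q
  proof -
    have "Omega_norm_sq M H g \<theta>' q = Omega_norm_sq M H g (\<lambda>p. a p *\<^sub>R \<theta> p) q"
      by (rule Omega_norm_sq_cong[OF U q \<theta>'])
    also have "\<dots> = (a q)\<^sup>2 * (2 * real n)" using Omega_norm_sq_scale[OF n(1) q sma] n(2)[OF q] by simp
    finally show ?thesis using n'(2)[OF q] n_pos by (simp add: power2_eq_square)
  qed
  have da: "dir_deriv M q v a = 0" if q: "q \<in> U" for q v
  proof -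
    have "dir_deriv M q v (\<lambda>q. a q * a q) = 0" by (rule dir_deriv_eq_const[OF U q a2])
    then have "2 * a q * dir_deriv M q v a = 0" using dir_deriv_mult[OF U q sma sma] by simp
    moreover have "a q \<noteq> 0" using a2[OF q] by auto
    ultimately show ?thesis by simp
  qed
  have d\<theta>': "ext_deriv M \<theta>' q u v = a q * ext_deriv M \<theta> q u v"
    if q: "q \<in> U" and uv: "u \<in> tangent M q" "v \<in> tangent M q" for q u v
  proof -
    have "ext_deriv M \<theta>' q u v = ext_deriv M (\<lambda>p. a p *\<^sub>R \<theta> p) q u v"
      by (rule ext_deriv_cong[OF U q \<theta>'])
    then show ?thesis using ext_deriv_scale[OF U q sma th(2) uv] da[OF q] by simp
  qed
  have T': "T' q = a q *\<^sub>R T q" if q: "q \<in> U" for q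
  proof -
    note tan = subspace_tangent[OF top[OF q]]
    \<comment> \<open>The difference is killed by \<theta>, so it lies in \<open>H\<close>, and it
      pairs to zero with all of \<open>H\<close> under d\<theta>; nondegeneracy makes it
      zero.\<close>
    let ?D = "T' q - a q *\<^sub>R T q"
    have Dt: "?D \<in> tangent M q" by (intro subspace_diff subspace_scale tan Tt[OF q])
    have "a q * \<theta> q (T' q) = 1" using R'(2)[OF q] \<theta>'[OF q] by simp
    then have "\<theta> q (T' q) = a q" using a2[OF q] by (metis mult.assoc mult.right_neutral mult.left_commute)
    then have "\<theta> q ?D = 0"
      using one_forms_lincomb[OF th(2) q Tt(2)[OF q] Tt(1)[OF q], of 1 "- a q"] R(2)[OF q] by simp
    then have DH: "?D \<in> H q" by (rule contact_form_kernel[OF n(1) q Dt])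
    have L: "linear (\<lambda>u. ext_deriv M \<theta> q u v)" for v by (rule ext_deriv_linear(1)[OF U q th(2)])
    have "ext_deriv M \<theta> q ?D v = 0" if v: "v \<in> H q" for v
    proof -
      have vt: "v \<in> tangent M q" by (rule H_tangent[OF top[OF q] v])
      have "ext_deriv M \<theta> q (T' q) v = 0"
        using R'(3)[OF q vt] d\<theta>'[OF q Tt(2)[OF q] vt] a2[OF q] by auto
      then show ?thesis using R(3)[OF q vt] by (simp add: linear_diff[OF L] linear_scale[OF L])
    qed
    then have "?D = 0" using contact_form_nondegenerate[OF n(1) q DH] by blast
    then show ?thesis by simp
  qed
  show ?thesis by (rule that[of a]) (use sma a2 \<theta>' T' da d\<theta>' in blast)+
qed

section \<open>Partial connections in a local frame\<close>

text \<open>The pointwise content of \<open>partial_connection\<close>; the operator constructed from a frame has it only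
  at the points of the domain of the frame.\<close>

definition conn_at :: "'a \<Rightarrow> ('a, 'e) form_operator \<Rightarrow> bool" where
  "conn_at p D \<longleftrightarrow> (\<forall>V \<sigma>. openin (mtop M) V \<and> p \<in> V \<and> \<sigma> \<in> one_forms M V \<longrightarrow>
     (\<forall>V'. openin (mtop M) V' \<and> p \<in> V' \<and> V' \<subseteq> V \<longrightarrow>
        (\<forall>u\<in>H p. \<forall>v\<in>tangent M p. D V' (restr V' \<sigma>) p u v = D V \<sigma> p u v)) \<and>
     (\<forall>\<tau>\<in>one_forms M V. \<forall>u\<in>H p. \<forall>v\<in>tangent M p.
        D V (\<lambda>q. \<sigma> q + \<tau> q) p u v = D V \<sigma> p u v + D V \<tau> p u v) \<and>
     (\<forall>f. smooth_fun M V f \<longrightarrow> (\<forall>u\<in>H p. \<forall>v\<in>tangent M p.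
        D V (\<lambda>q. f q *\<^sub>R \<sigma> q) p u v = f p * D V \<sigma> p u v + dir_deriv M p u f * \<sigma> p v)) \<and>
     (\<forall>u\<in>H p. linear_on (tangent M p) (D V \<sigma> p u)) \<and>
     (\<forall>v\<in>tangent M p. linear_on (H p) (\<lambda>u. D V \<sigma> p u v)))"

lemma conn_atD:
  assumes "conn_at p D" "openin (mtop M) V" "p \<in> V" "\<sigma> \<in> one_forms M V" "u \<in> H p" "v \<in> tangent M p"
  shows "openin (mtop M) V' \<Longrightarrow> p \<in> V' \<Longrightarrow> V' \<subseteq> V \<Longrightarrow> D V' (restr V' \<sigma>) p u v = D V \<sigma> p u v"
    "\<tau> \<in> one_forms M V \<Longrightarrow> D V (\<lambda>q. \<sigma> q + \<tau> q) p u v = D V \<sigma> p u v + D V \<tau> p u v"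
    "smooth_fun M V f \<Longrightarrow> D V (\<lambda>q. f q *\<^sub>R \<sigma> q) p u v = f p * D V \<sigma> p u v + dir_deriv M p u f * \<sigma> p v"
    "linear_on (tangent M p) (D V \<sigma> p u)" "linear_on (H p) (\<lambda>u. D V \<sigma> p u v)"
  using assms(1)[unfolded conn_at_def, rule_format, OF conjI, OF assms(2) conjI, OF assms(3,4)] assms(5,6) by auto

lemma conn_at_sum:
  assumes "conn_at p D" "openin (mtop M) V" "p \<in> V" "u \<in> H p" "v \<in> tangent M p"
  shows "finite I \<Longrightarrow> (\<And>i. i \<in> I \<Longrightarrow> \<sigma> i \<in> one_forms M V) \<Longrightarrow> D V (\<lambda>q. \<Sum>i\<in>I. \<sigma> i q) p u v = (\<Sum>i\<in>I. D V (\<sigma> i) p u v)"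
proof (induction I rule: finite_induct)
  case empty
  have z: "(\<lambda>q. 0) \<in> one_forms M V" by (rule one_forms_zero_form[OF assms(2)])
  \<comment> \<open>The zero form is 0 times itself, so the Leibniz rule gives the value 0.\<close>
  have "D V (\<lambda>q. 0 *\<^sub>R (\<lambda>q. 0) q) p u v = 0 * D V (\<lambda>q. 0) p u v + dir_deriv M p u (\<lambda>q. 0) * 0"
    using conn_atD(3)[OF assms(1-3) z assms(4,5) smooth_fun_const[OF assms(2), of 0]] by (simp only: zero_fun_apply)
  then show ?case by (simp only: scaleR_zero_left sum.empty mult_zero_left mult_zero_right add_0)
next
  case (insert i I)
  have "D V (\<lambda>q. \<Sum>i\<in>insert i I. \<sigma> i q) p u v = D V (\<lambda>q. \<sigma> i q + (\<Sum>i\<in>I. \<sigma> i q)) p u v"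
    by (simp only: sum.insert[OF insert.hyps(1,2)])
  also have "\<dots> = D V (\<sigma> i) p u v + D V (\<lambda>q. \<Sum>i\<in>I. \<sigma> i q) p u v"
    by (rule conn_atD(2)[OF assms(1-3) _ assms(4,5) one_forms_sum_form[OF assms(2)]]) (use insert.prems in auto)
  also have "D V (\<lambda>q. \<Sum>i\<in>I. \<sigma> i q) p u v = (\<Sum>i\<in>I. D V (\<sigma> i) p u v)"
    by (rule insert.IH) (use insert.prems in auto)
  finally show ?case by (simp only: sum.insert[OF insert.hyps(1,2)])
qed

section \<open>Frames, dual coframes and the induced connection on vector fields\<close>

definition is_frame :: "'a set \<Rightarrow> nat \<Rightarrow> (nat \<Rightarrow> ('a, 'e) vfield) \<Rightarrow> (nat \<Rightarrow> ('a, 'e) oneform) \<Rightarrow> bool" where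
  "is_frame W m F \<epsilon> \<longleftrightarrow> openin (mtop M) W \<and> (\<forall>a<m. F a \<in> vfields M W \<and> \<epsilon> a \<in> one_forms M W) \<and>
     (\<forall>q\<in>W. (\<forall>a<m. \<forall>b<m. \<epsilon> a q (F b q) = (if a = b then 1 else 0)) \<and>
        (\<forall>v\<in>tangent M q. v = (\<Sum>a<m. \<epsilon> a q v *\<^sub>R F a q)))"

context
  fixes W m F \<epsilon> assumes fr: "is_frame W m F \<epsilon>"
begin

lemma is_frameD:
  shows "openin (mtop M) W" "\<And>a. a < m \<Longrightarrow> F a \<in> vfields M W" "\<And>a. a < m \<Longrightarrow> \<epsilon> a \<in> one_forms M W"
    "\<And>q a b. q \<in> W \<Longrightarrow> a < m \<Longrightarrow> b < m \<Longrightarrow> \<epsilon> a q (F b q) = (if a = b then 1 else 0)"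
    "\<And>q v. q \<in> W \<Longrightarrow> v \<in> tangent M q \<Longrightarrow> v = (\<Sum>a<m. \<epsilon> a q v *\<^sub>R F a q)"
  using fr unfolding is_frame_def by blast+

lemma frame_tangent: "a < m \<Longrightarrow> q \<in> W \<Longrightarrow> F a q \<in> tangent M q"
  by (rule vfields_tangent[OF is_frameD(2)])

lemma form_expansion:
  assumes "\<sigma> \<in> one_forms M V" "q \<in> V" "q \<in> W" "v \<in> tangent M q"
  shows "\<sigma> q v = (\<Sum>a<m. \<sigma> q (F a q) * \<epsilon> a q v)"
proof -
  have "\<sigma> q v = \<sigma> q (\<Sum>a<m. \<epsilon> a q v *\<^sub>R F a q)" using is_frameD(5)[OF assms(3,4)] by simp
  also have "\<dots> = (\<Sum>a<m. \<epsilon> a q v * \<sigma> q (F a q))"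
    by (rule one_forms_sum[OF assms(1,2) openin_point[OF is_frameD(1) assms(3)]]) (use frame_tangent assms(3) in auto)
  finally show ?thesis by (simp only: mult.commute)
qed

text \<open>An equation between functions, including the values off \<open>V \<inter> W\<close> and
  off the tangent spaces, because an operator is applied to the form itself and not to its values on
  tangent vectors.\<close>

lemma form_restr_expansion:
  assumes \<sigma>: "\<sigma> \<in> one_forms M V"
  shows "restr (V \<inter> W) \<sigma> = (\<lambda>q. \<Sum>a<m. \<sigma> q (F a q) *\<^sub>R restr (V \<inter> W) (\<epsilon> a) q)"
proof (intro ext)
  fix q v
  show "restr (V \<inter> W) \<sigma> q v = (\<Sum>a<m. \<sigma> q (F a q) *\<^sub>R restr (V \<inter> W) (\<epsilon> a) q) v"
  proof (cases "q \<in> V \<inter> W")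
    case True
    show ?thesis
    proof (cases "v \<in> tangent M q")
      case v: True
      show ?thesis using form_expansion[OF \<sigma> _ _ v] True by (simp add: sum_fun_apply)
    next
      case False
      then have "restr (V \<inter> W) (\<epsilon> a) q v = 0" if "a < m" for a
        using one_forms_off_tangent[OF is_frameD(3)[OF that]] True by simp
      then show ?thesis using True one_forms_off_tangent[OF \<sigma> False] by (simp add: sum_fun_apply)
    qed
  next
    case False
    then show ?thesis by (simp add: sum_fun_apply)
  qed
qed

lemma smooth_form_frame:
  assumes "\<sigma> \<in> one_forms M V" "openin (mtop M) V" "a < m"
  shows "smooth_fun M (V \<inter> W) (\<lambda>q. \<sigma> q (F a q))"
  by (rule one_forms_smooth_restr[OF assms(1) is_frameD(2)[OF assms(3)]]) (use assms is_frameD(1) in auto)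

lemma smooth_coframe:
  assumes "Y \<in> vfields M V" "openin (mtop M) V" "a < m"
  shows "smooth_fun M (V \<inter> W) (\<lambda>q. \<epsilon> a q (Y q))"
  by (rule one_forms_smooth_restr[OF is_frameD(3)[OF assms(3)] assms(1)]) (use assms is_frameD(1) in auto)

text \<open>Additivity and the Leibniz rule applied to the expansion of \<open>\<sigma>\<close> in
  the coframe, over the common domain. The operator at \<open>p\<close> is thus known from its
  values on the forms \<open>\<epsilon> a\<close>.\<close>

lemma conn_at_expansion:
  assumes D: "conn_at p D" and V: "openin (mtop M) V" and p: "p \<in> V" "p \<in> W" and \<sigma>: "\<sigma> \<in> one_forms M V"
    and u: "u \<in> H p" and v: "v \<in> tangent M p"
  shows "D V \<sigma> p u v = (\<Sum>a<m. dir_deriv M p u (\<lambda>q. \<sigma> q (F a q)) * \<epsilon> a p v + \<sigma> p (F a p) * D W (\<epsilon> a) p u v)"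
proof -
  let ?V = "V \<inter> W"
  have oV: "openin (mtop M) ?V" "p \<in> ?V" using V is_frameD(1) p by auto
  have res: "restr ?V (\<epsilon> a) \<in> one_forms M ?V" if "a < m" for a
    by (rule one_forms_restr[OF is_frameD(3)[OF that] oV(1)]) auto
  have "D V \<sigma> p u v = D ?V (restr ?V \<sigma>) p u v"
    by (rule conn_atD(1)[OF D V p(1) \<sigma> u v oV, symmetric]) auto
  also have "\<dots> = (\<Sum>a<m. D ?V (\<lambda>q. \<sigma> q (F a q) *\<^sub>R restr ?V (\<epsilon> a) q) p u v)"
    unfolding form_restr_expansion[OF \<sigma>]
    by (rule conn_at_sum[OF D oV u v]) (auto intro!: one_forms_scale oV res smooth_form_frame \<sigma> V)
  also have "\<dots> = (\<Sum>a<m. dir_deriv M p u (\<lambda>q. \<sigma> q (F a q)) * \<epsilon> a p v + \<sigma> p (F a p) * D W (\<epsilon> a) p u v)"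
  proof (rule sum.cong[OF refl])
    fix a assume "a \<in> {..<m}"
    then have a: "a < m" by simp
    have "D ?V (\<lambda>q. \<sigma> q (F a q) *\<^sub>R restr ?V (\<epsilon> a) q) p u v =
      \<sigma> p (F a p) * D ?V (restr ?V (\<epsilon> a)) p u v + dir_deriv M p u (\<lambda>q. \<sigma> q (F a q)) * restr ?V (\<epsilon> a) p v"
      by (rule conn_atD(3)[OF D oV res[OF a] u v smooth_form_frame[OF \<sigma> V a]])
    also have "D ?V (restr ?V (\<epsilon> a)) p u v = D W (\<epsilon> a) p u v"
      by (rule conn_atD(1)[OF D is_frameD(1) p(2) is_frameD(3)[OF a] u v oV]) auto
    finally show "D ?V (\<lambda>q. \<sigma> q (F a q) *\<^sub>R restr ?V (\<epsilon> a) q) p u v =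
        dir_deriv M p u (\<lambda>q. \<sigma> q (F a q)) * \<epsilon> a p v + \<sigma> p (F a p) * D W (\<epsilon> a) p u v"
      by (simp only: restr_apply(1)[OF oV(2)] add.commute)
  qed
  finally show ?thesis .
qed

text \<open>Shows that the definite description in \<open>induced_TM\<close> denotes. Inserting the
  coframe forms forces the candidate, which is uniqueness; by \<open>conn_at_expansion\<close> the
  candidate satisfies the equation for every form.\<close>

lemma induced_TM_frame:
  assumes D: "conn_at p D" and V: "openin (mtop M) V" and p: "p \<in> V" "p \<in> W" and Y: "Y \<in> vfields M V"
    and u: "u \<in> H p"
  shows "induced_TM M D V Y p u =
    (\<Sum>a<m. (dir_deriv M p u (\<lambda>q. \<epsilon> a q (Y q)) - D W (\<epsilon> a) p u (Y p)) *\<^sub>R F a p)" (is "_ = ?w")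
proof -
  note top = openin_point[OF V p(1)]
  have Yp: "Y p \<in> tangent M p" by (rule vfields_tangent[OF Y p(1)])
  have wt: "?w \<in> tangent M p" by (rule tangent_sum[OF top]) (use frame_tangent p in auto)
  show ?thesis
    unfolding induced_TM_def
  proof (rule the_equality)
    show "?w \<in> tangent M p \<and> (\<forall>V' \<omega>. openin (mtop M) V' \<and> p \<in> V' \<and> V' \<subseteq> V \<and> \<omega> \<in> one_forms M V' \<longrightarrow>
        dir_deriv M p u (\<lambda>q. \<omega> q (Y q)) = D V' \<omega> p u (Y p) + \<omega> p ?w)"
    proof (intro conjI wt allI impI)
      fix V' \<omega> assume "openin (mtop M) V' \<and> p \<in> V' \<and> V' \<subseteq> V \<and> \<omega> \<in> one_forms M V'"
      then have V': "openin (mtop M) V'" "p \<in> V'" "V' \<subseteq> V" and \<omega>: "\<omega> \<in> one_forms M V'" by auto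
      let ?V = "V' \<inter> W"
      have oV: "openin (mtop M) ?V" "p \<in> ?V" using V' is_frameD(1) p by auto
      have smY: "smooth_fun M ?V (\<lambda>q. \<epsilon> a q (Y q))" if "a < m" for a
        by (rule smooth_fun_subset[OF smooth_coframe[OF Y V that]]) (use V' in auto)
      have "dir_deriv M p u (\<lambda>q. \<omega> q (Y q)) = dir_deriv M p u (\<lambda>q. \<Sum>a<m. \<omega> q (F a q) * \<epsilon> a q (Y q))"
        by (rule dir_deriv_cong[OF oV], rule form_expansion[OF \<omega>])
          (use V' vfields_tangent[OF Y] in auto)
      also have "\<dots> = (\<Sum>a<m. \<omega> p (F a p) * dir_deriv M p u (\<lambda>q. \<epsilon> a q (Y q)) +
          dir_deriv M p u (\<lambda>q. \<omega> q (F a q)) * \<epsilon> a p (Y p))"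
        by (rule dir_deriv_sum_mult[OF oV]) (use smY smooth_form_frame[OF \<omega> V'(1)] in auto)
      finally have 1: "dir_deriv M p u (\<lambda>q. \<omega> q (Y q)) = \<dots>" .
      have 2: "\<omega> p ?w = (\<Sum>a<m. (dir_deriv M p u (\<lambda>q. \<epsilon> a q (Y q)) - D W (\<epsilon> a) p u (Y p)) * \<omega> p (F a p))"
        by (rule one_forms_sum[OF \<omega> V'(2) top]) (use frame_tangent p in auto)
      show "dir_deriv M p u (\<lambda>q. \<omega> q (Y q)) = D V' \<omega> p u (Y p) + \<omega> p ?w"
        unfolding 1 2 conn_at_expansion[OF D V'(1,2) p(2) \<omega> u Yp] sum.distrib[symmetric]
        by (rule sum.cong) (auto simp: algebra_simps)
    qed
  next
    fix w assume "w \<in> tangent M p \<and> (\<forall>V' \<omega>. openin (mtop M) V' \<and> p \<in> V' \<and> V' \<subseteq> V \<and> \<omega> \<in> one_forms M V' \<longrightarrow>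
        dir_deriv M p u (\<lambda>q. \<omega> q (Y q)) = D V' \<omega> p u (Y p) + \<omega> p w)"
    then have w: "w \<in> tangent M p" and w_eq: "\<And>V' \<omega>. openin (mtop M) V' \<Longrightarrow> p \<in> V' \<Longrightarrow> V' \<subseteq> V \<Longrightarrow> \<omega> \<in> one_forms M V' \<Longrightarrow>
        dir_deriv M p u (\<lambda>q. \<omega> q (Y q)) = D V' \<omega> p u (Y p) + \<omega> p w" by auto
    let ?V = "V \<inter> W"
    have oV: "openin (mtop M) ?V" "p \<in> ?V" using V is_frameD(1) p by auto
    have "\<epsilon> a p w = dir_deriv M p u (\<lambda>q. \<epsilon> a q (Y q)) - D W (\<epsilon> a) p u (Y p)" if a: "a < m" for a
    proof -
      have "restr ?V (\<epsilon> a) \<in> one_forms M ?V"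
        by (rule one_forms_restr[OF is_frameD(3)[OF a] oV(1)]) auto
      from w_eq[OF oV _ this]
      have "dir_deriv M p u (\<lambda>q. restr ?V (\<epsilon> a) q (Y q)) = D ?V (restr ?V (\<epsilon> a)) p u (Y p) + restr ?V (\<epsilon> a) p w"
        by auto
      moreover have "D ?V (restr ?V (\<epsilon> a)) p u (Y p) = D W (\<epsilon> a) p u (Y p)"
        by (rule conn_atD(1)[OF D is_frameD(1) p(2) is_frameD(3)[OF a] u Yp oV]) auto
      moreover have "dir_deriv M p u (\<lambda>q. restr ?V (\<epsilon> a) q (Y q)) = dir_deriv M p u (\<lambda>q. \<epsilon> a q (Y q))"
        by (rule dir_deriv_cong[OF oV]) auto
      ultimately show ?thesis using oV by simp
    qed
    then have "(\<Sum>a<m. \<epsilon> a p w *\<^sub>R F a p) = ?w" by (intro sum.cong) auto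
    then show "w = ?w" using is_frameD(5)[OF p(2) w] by simp
  qed
qed

lemma frame_coeff:
  assumes "p \<in> W" "a < m"
  shows "\<epsilon> a p (\<Sum>b<m. r b *\<^sub>R F b p) = r a"
proof -
  have "\<epsilon> a p (\<Sum>b<m. r b *\<^sub>R F b p) = (\<Sum>b<m. r b * \<epsilon> a p (F b p))"
    by (rule one_forms_sum[OF is_frameD(3)[OF assms(2)] assms(1) openin_point[OF is_frameD(1) assms(1)]])
      (use frame_tangent assms in auto)
  also have "\<dots> = (\<Sum>b<m. if b = a then r b else 0)"
    by (rule sum.cong) (auto simp: is_frameD(4)[OF assms])
  finally show ?thesis using assms(2) by simp
qed

lemma induced_TM_coframe:
  assumes "conn_at p D" "openin (mtop M) V" "p \<in> V" "p \<in> W" "Y \<in> vfields M V" "u \<in> H p" "a < m"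
  shows "\<epsilon> a p (induced_TM M D V Y p u) = dir_deriv M p u (\<lambda>q. \<epsilon> a q (Y q)) - D W (\<epsilon> a) p u (Y p)"
  unfolding induced_TM_frame[OF assms(1-6)] by (rule frame_coeff[OF assms(4,7)])

lemma induced_TM_tangent:
  assumes "conn_at p D" "openin (mtop M) V" "p \<in> V" "p \<in> W" "Y \<in> vfields M V" "u \<in> H p"
  shows "induced_TM M D V Y p u \<in> tangent M p"
  unfolding induced_TM_frame[OF assms]
  by (rule tangent_sum[OF openin_point[OF assms(2,3)]]) (use frame_tangent assms in auto)

lemma frame_eq_zeroI: "p \<in> W \<Longrightarrow> v \<in> tangent M p \<Longrightarrow> (\<And>a. a < m \<Longrightarrow> \<epsilon> a p v = 0) \<Longrightarrow> v = 0"
  using is_frameD(5)[of p v] by simp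

text \<open>The formula of \<open>conn_at_expansion\<close> turned into a definition, with
  \<open>G a\<close> as the prescribed derivative of the form \<open>\<epsilon> a\<close>.\<close>

definition frame_conn :: "(nat \<Rightarrow> ('a, 'e) bilin) \<Rightarrow> ('a, 'e) form_operator" where
  "frame_conn G V \<sigma> p u v = (\<Sum>a<m. dir_deriv M p u (\<lambda>q. \<sigma> q (F a q)) * \<epsilon> a p v + \<sigma> p (F a p) * G a p u v)"

text \<open>The terms with derivatives are those of \<open>conn_at_expansion\<close>
  antisymmetrised, so they cancel in the torsion, which can therefore be checked on the
  coframe.\<close>

lemma ext_deriv_expansion:
  assumes \<sigma>: "\<sigma> \<in> one_forms M V" and V: "openin (mtop M) V" and p: "p \<in> V" "p \<in> W"
    and u: "u \<in> tangent M p" and v: "v \<in> tangent M p"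
  shows "ext_deriv M \<sigma> p u v = (\<Sum>a<m. \<sigma> p (F a p) * ext_deriv M (\<epsilon> a) p u v +
    dir_deriv M p u (\<lambda>q. \<sigma> q (F a q)) * \<epsilon> a p v - dir_deriv M p v (\<lambda>q. \<sigma> q (F a q)) * \<epsilon> a p u)"
proof -
  let ?V = "V \<inter> W"
  have oV: "openin (mtop M) ?V" "p \<in> ?V" using V is_frameD(1) p by auto
  have res: "restr ?V (\<epsilon> a) \<in> one_forms M ?V" if "a < m" for a
    by (rule one_forms_restr[OF is_frameD(3)[OF that] oV(1)]) auto
  have "ext_deriv M \<sigma> p u v = ext_deriv M (restr ?V \<sigma>) p u v"
    by (rule ext_deriv_cong[OF oV]) simp
  also have "\<dots> = (\<Sum>a<m. ext_deriv M (\<lambda>q. \<sigma> q (F a q) *\<^sub>R restr ?V (\<epsilon> a) q) p u v)"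
    unfolding form_restr_expansion[OF \<sigma>]
    by (rule ext_deriv_sum[OF oV]) (auto intro!: one_forms_scale oV res smooth_form_frame \<sigma> V)
  also have "\<dots> = (\<Sum>a<m. \<sigma> p (F a p) * ext_deriv M (\<epsilon> a) p u v +
    dir_deriv M p u (\<lambda>q. \<sigma> q (F a q)) * \<epsilon> a p v - dir_deriv M p v (\<lambda>q. \<sigma> q (F a q)) * \<epsilon> a p u)"
  proof (rule sum.cong[OF refl])
    fix a assume "a \<in> {..<m}"
    then have a: "a < m" by simp
    have "ext_deriv M (restr ?V (\<epsilon> a)) p u v = ext_deriv M (\<epsilon> a) p u v" by (rule ext_deriv_cong[OF oV]) simp
    then show "ext_deriv M (\<lambda>q. \<sigma> q (F a q) *\<^sub>R restr ?V (\<epsilon> a) q) p u v = \<sigma> p (F a p) * ext_deriv M (\<epsilon> a) p u v +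
      dir_deriv M p u (\<lambda>q. \<sigma> q (F a q)) * \<epsilon> a p v - dir_deriv M p v (\<lambda>q. \<sigma> q (F a q)) * \<epsilon> a p u"
      using ext_deriv_scale[OF oV smooth_form_frame[OF \<sigma> V a] res[OF a] u v] oV(2) by simp
  qed
  finally show ?thesis .
qed

lemma frame_conn_coframe:
  assumes "p \<in> W" "a < m"
  shows "frame_conn G V (\<epsilon> a) p u v = G a p u v"
proof -
  have "dir_deriv M p u (\<lambda>q. \<epsilon> a q (F b q)) = 0" if "b < m" for b
    by (rule dir_deriv_eq_const[OF is_frameD(1) assms(1) is_frameD(4)[OF _ assms(2) that]])
  then have "frame_conn G V (\<epsilon> a) p u v = (\<Sum>b<m. if b = a then G b p u v else 0)"
    unfolding frame_conn_def by (intro sum.cong) (auto simp: is_frameD(4)[OF assms])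
  then show ?thesis using assms(2) by simp
qed

lemma frame_conn_cong:
  assumes "openin (mtop M) V'" "p \<in> V'" "\<And>q. q \<in> V' \<Longrightarrow> \<sigma> q = \<tau> q"
  shows "frame_conn G V \<sigma> p u v = frame_conn G V'' \<tau> p u v"
  unfolding frame_conn_def using assms(3)[OF assms(2)]
  by (intro sum.cong refl) (simp add: dir_deriv_cong[OF assms(1,2), of "\<lambda>q. \<sigma> q (F a q)" "\<lambda>q. \<tau> q (F a q)" for a] assms(3))

lemma conn_at_frame_conn:
  assumes p: "p \<in> W"
    and G1: "\<And>a u. a < m \<Longrightarrow> u \<in> H p \<Longrightarrow> linear_on (tangent M p) (G a p u)"
    and G2: "\<And>a v. a < m \<Longrightarrow> v \<in> tangent M p \<Longrightarrow> linear_on (H p) (\<lambda>u. G a p u v)"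
  shows "conn_at p (frame_conn G)"
  unfolding conn_at_def
proof (intro allI impI, goal_cases)
  case (1 V \<sigma>)
  then have V: "openin (mtop M) V" "p \<in> V" and \<sigma>: "\<sigma> \<in> one_forms M V" by auto
  let ?V = "V \<inter> W"
  have oV: "openin (mtop M) ?V" "p \<in> ?V" using V is_frameD(1) p by auto
  note sm = smooth_form_frame[OF \<sigma> V(1)]
  have smd: "linear (\<lambda>u. dir_deriv M p u (\<lambda>q. \<sigma> q (F a q)))" if "a < m" for a
    by (rule dir_deriv_linear[OF oV sm[OF that]])
  have \<epsilon>l: "linear_on (tangent M p) (\<epsilon> a p)" if "a < m" for a
    using one_forms_cotangent[OF is_frameD(3)[OF that] p] by (simp add: cotangent_def)
  have c1: "\<forall>V'. openin (mtop M) V' \<and> p \<in> V' \<and> V' \<subseteq> V \<longrightarrow>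
     (\<forall>u\<in>H p. \<forall>v\<in>tangent M p. frame_conn G V' (restr V' \<sigma>) p u v = frame_conn G V \<sigma> p u v)"
    using frame_conn_cong[of _ p] by auto
  have c2: "frame_conn G V (\<lambda>q. \<sigma> q + \<tau> q) p u v = frame_conn G V \<sigma> p u v + frame_conn G V \<tau> p u v"
    if \<tau>: "\<tau> \<in> one_forms M V" for \<tau> u v
    unfolding frame_conn_def sum.distrib[symmetric]
    by (rule sum.cong) (auto simp: dir_deriv_add[OF oV sm smooth_form_frame[OF \<tau> V(1)]] algebra_simps)
  have c3: "frame_conn G V (\<lambda>q. f q *\<^sub>R \<sigma> q) p u v = f p * frame_conn G V \<sigma> p u v + dir_deriv M p u f * \<sigma> p v"
    if f: "smooth_fun M V f" and v: "v \<in> tangent M p" for f u v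
  proof -
    have f': "smooth_fun M ?V f" by (rule smooth_fun_subset[OF f]) auto
    show ?thesis
      unfolding frame_conn_def form_expansion[OF \<sigma> V(2) p v] sum_distrib_left sum.distrib[symmetric]
      by (rule sum.cong) (auto simp: dir_deriv_mult[OF oV f' sm] algebra_simps)
  qed
  have c4: "linear_on (tangent M p) (frame_conn G V \<sigma> p u)" if u: "u \<in> H p" for u
    unfolding linear_on_def frame_conn_def sum_distrib_left sum.distrib[symmetric]
    by (intro ballI allI sum.cong refl)
      (use \<epsilon>l G1[OF _ u] in \<open>auto simp: linear_on_def algebra_simps\<close>)
  have c5: "linear_on (H p) (\<lambda>u. frame_conn G V \<sigma> p u v)" if v: "v \<in> tangent M p" for v
    unfolding linear_on_def frame_conn_def sum_distrib_left sum.distrib[symmetric]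
    by (intro ballI allI sum.cong refl)
      (use G2[OF _ v] in \<open>auto simp: linear_on_def algebra_simps linear_add[OF smd] linear_scale[OF smd]\<close>)
  show ?case
    by (rule conjI[OF c1 conjI]; intro conjI ballI allI impI) (simp_all only: c2 c3 c4 c5)
qed

end

section \<open>The connection of an adapted frame\<close>

text \<open>Asks for \<open>conn_at\<close> and not for \<open>partial_connection\<close>, so that
  it applies to the operator of a single frame at the points of its domain, and solutions from
  different frames can be compared at a common point.\<close>

definition lc_at :: "'a \<Rightarrow> 'a set \<Rightarrow> ('a, 'e) oneform \<Rightarrow> ('a, 'e) vfield \<Rightarrow> ('a, 'e) form_operator \<Rightarrow> bool" where
  "lc_at p U \<theta> T D \<longleftrightarrow> conn_at p D \<and>
     (\<forall>u\<in>H p. induced_TM M D U T p u = 0) \<and>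
     (\<forall>u\<in>H p. \<forall>v\<in>tangent M p. D U \<theta> p u v = 1/2 * ext_deriv M \<theta> p u v) \<and>
     (\<forall>V \<omega>. openin (mtop M) V \<and> p \<in> V \<and> V \<subseteq> U \<and> \<omega> \<in> one_forms M V \<longrightarrow>
        (\<forall>u\<in>H p. \<forall>v\<in>H p. partial_torsion M D V \<omega> p u v = 0)) \<and>
     (\<forall>V Y Z. openin (mtop M) V \<and> p \<in> V \<and> V \<subseteq> U \<and> Y \<in> vfields M V \<and> Z \<in> vfields M V \<longrightarrow>
        (\<forall>u\<in>H p. induced_bilin M D V (reeb_extend \<theta> T g) Y Z p u = 0))"

end

text \<open>In the signed cyclic sum of the torsion equations the pairs
  \<open>L j i k + L j k i\<close> and \<open>L k j i + L k i j\<close> vanish by skewness, and the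
  rest \<open>L i j k - L i k j\<close> is twice \<open>L i j k\<close>.\<close>

lemma koszul_unique:
  fixes L :: "nat \<Rightarrow> nat \<Rightarrow> nat \<Rightarrow> real"
  assumes "\<And>i j k. i < m \<Longrightarrow> j < m \<Longrightarrow> k < m \<Longrightarrow> L i j k + L i k j = 0"
    and "\<And>i j k. i < m \<Longrightarrow> j < m \<Longrightarrow> k < m \<Longrightarrow> d i j k = L i j k - L j i k"
    and "i < m" "j < m" "k < m"
  shows "L i j k = (d i j k - d j k i + d k i j) / 2"
  using assms(1)[of i j k] assms(1)[of j k i] assms(1)[of k i j]
    assms(2)[of i j k] assms(2)[of j k i] assms(2)[of k i j] assms(3-5) by simp

locale adapted = sub_riem_contact M H g n
  for M :: "('a, 'e::euclidean_space) manifold" and H g n +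
  fixes U :: "'a set" and \<theta> T W E
  assumes normalized: "normalized U \<theta> T" and H_frame: "H_frame_on W E"
    and openin_W: "openin (mtop M) W" and W_subset: "W \<subseteq> U"
begin

lemmas cf = contact_formD[OF normalizedD(1)[OF normalized]]
  and rf = reeb_fieldD[OF normalizedD(3)[OF normalized]]
  and EH = H_frame_onD[OF H_frame]

lemma WU: "q \<in> W \<Longrightarrow> q \<in> U" and W_top: "q \<in> W \<Longrightarrow> q \<in> topspace (mtop M)"
  using W_subset openin_point[OF openin_W] by auto

definition frm :: "nat \<Rightarrow> ('a, 'e) vfield" where
  "frm a = restr W (case a of 0 \<Rightarrow> T | Suc k \<Rightarrow> E k)"

text \<open>The coframe dual to \<open>frm\<close>. As \<open>g\<close> is meaningful on
  \<open>H\<close> only, the component along \<open>T\<close> is removed before pairing with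
  \<open>E k\<close>, and orthonormality makes g(., E_k) dual to the frame of
  \<open>H\<close>.\<close>

definition cofr :: "nat \<Rightarrow> ('a, 'e) oneform" where
  "cofr a = restr W (\<lambda>q v. if v \<in> tangent M q then
     (case a of 0 \<Rightarrow> \<theta> q v | Suc k \<Rightarrow> g q (v - \<theta> q v *\<^sub>R T q) (E k q)) else 0)"

lemma frm_simps: "q \<in> W \<Longrightarrow> frm 0 q = T q" "q \<in> W \<Longrightarrow> frm (Suc k) q = E k q"
  by (simp_all add: frm_def)

lemma cofr_0: "cofr 0 = restr W \<theta>"
proof (intro ext)
  fix q v show "cofr 0 q v = restr W \<theta> q v"
    using one_forms_off_tangent[OF cf(2), of v q] by (cases "q \<in> W") (auto simp: cofr_def)
qed

lemma cofr_Suc: "q \<in> W \<Longrightarrow> v \<in> tangent M q \<Longrightarrow> cofr (Suc k) q v = g q (v - \<theta> q v *\<^sub>R T q) (E k q)"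
  by (simp add: cofr_def)

lemma T_tangent: "q \<in> W \<Longrightarrow> T q \<in> tangent M q"
  by (rule vfields_tangent[OF rf(1) WU])

lemma E_H: "q \<in> W \<Longrightarrow> k < 2 * n \<Longrightarrow> E k q \<in> H q"
  by (rule H_fields_H[OF EH(1)])

lemma proj_H: "q \<in> W \<Longrightarrow> v \<in> tangent M q \<Longrightarrow> v - \<theta> q v *\<^sub>R T q \<in> H q"
  by (rule reeb_projection_H[OF normalizedD(1)[OF normalized] WU T_tangent rf(2)[OF WU]])

lemma proj_id: "q \<in> W \<Longrightarrow> v \<in> H q \<Longrightarrow> v - \<theta> q v *\<^sub>R T q = v"
  using cf(4)[OF WU] by simp

lemma frm_vfields: "a < Suc (2 * n) \<Longrightarrow> frm a \<in> vfields M W"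
  using vfields_restr[OF rf(1) openin_W W_subset] vfields_restr[OF H_fields_vfields[OF EH(1)] openin_W order_refl]
  by (auto simp: frm_def split: nat.split)

lemma cofr_one_form:
  assumes "a < Suc (2 * n)"
  shows "cofr a \<in> one_forms M W"
proof (cases a)
  case 0
  then show ?thesis using one_forms_restr[OF cf(2) openin_W W_subset] by (simp add: cofr_0)
next
  case (Suc k)
  then have k: "k < 2 * n" using assms by simp
  have "smooth_fun M V (\<lambda>q. cofr a q (Y q))" if V: "openin (mtop M) V" "V \<subseteq> W" and Y: "Y \<in> vfields M V" for V Y
  proof -
    have VW: "q \<in> W" if "q \<in> V" for q using that V(2) by blast
    define Z where "Z = (\<lambda>q. Y q - \<theta> q (Y q) *\<^sub>R restr V T q)"
    have sm: "smooth_fun M V (\<lambda>q. \<theta> q (Y q))"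
      by (rule one_forms_smooth[OF cf(2) V(1) _ Y]) (use V(2) W_subset in auto)
    have TV: "restr V T \<in> vfields M V" by (rule vfields_restr[OF rf(1) V(1)]) (use V(2) W_subset in auto)
    have "Z \<in> H_fields M H V"
    proof (rule H_fieldsI)
      show "Z \<in> vfields M V" unfolding Z_def by (rule vfields_diff[OF V(1) Y vfields_scale[OF V(1) sm TV]])
      show "Z q \<in> H q" if "q \<in> V" for q
        using proj_H[OF VW[OF that] vfields_tangent[OF Y that]] that by (simp add: Z_def)
    qed
    from metric_smooth[OF V(1) this H_fields_restr[OF EH(1)[OF k] V]]
    show ?thesis
    proof (rule iffD1[OF smooth_fun_cong[OF V(1)], rotated])
      fix q assume q: "q \<in> V"
      show "g q (Z q) (restr V (E k) q) = cofr a q (Y q)"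
        using cofr_Suc[OF VW[OF q] vfields_tangent[OF Y q]] q by (simp add: Z_def Suc)
    qed
  qed
  moreover have "cofr a q \<in> cotangent M q" if q: "q \<in> W" for q
  proof -
    interpret inner_on "H q" "g q" by (rule metric_inner_on[OF W_top[OF q]])
    note L = lin_left[OF E_H[OF q k]] and tan = subspace_tangent[OF W_top[OF q]]
    have "cofr a q (r *\<^sub>R u + s *\<^sub>R v) = r * cofr a q u + s * cofr a q v"
      if u: "u \<in> tangent M q" and v: "v \<in> tangent M q" for u v r s
    proof -
      have t: "r *\<^sub>R u + s *\<^sub>R v \<in> tangent M q" using tan u v by (simp add: subspace_add subspace_scale)
      have "(r *\<^sub>R u + s *\<^sub>R v) - \<theta> q (r *\<^sub>R u + s *\<^sub>R v) *\<^sub>R T q =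
          r *\<^sub>R (u - \<theta> q u *\<^sub>R T q) + s *\<^sub>R (v - \<theta> q v *\<^sub>R T q)"
        unfolding one_forms_lincomb[OF cf(2) WU[OF q] u v]
        by (simp only: scaleR_add_left scaleR_scaleR scaleR_diff_right) simp
      then show ?thesis
        using L[unfolded linear_on_def, rule_format, OF proj_H[OF q u] proj_H[OF q v], of r s]
        by (simp only: Suc cofr_Suc[OF q t] cofr_Suc[OF q u] cofr_Suc[OF q v])
    qed
    moreover have "cofr a q v = 0" if "v \<notin> tangent M q" for v using q that by (simp add: cofr_def)
    ultimately show ?thesis by (auto simp: cotangent_def linear_on_def)
  qed
  moreover have "cofr a q = 0" if "q \<notin> W" for q using that by (simp add: cofr_def)
  ultimately show ?thesis by (auto simp: one_forms_def)
qed

lemma is_frame: "is_frame W (Suc (2 * n)) frm cofr"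
proof -
  have dual: "cofr a q (frm b q) = (if a = b then 1 else 0)"
    if q: "q \<in> W" and a: "a < Suc (2 * n)" and b: "b < Suc (2 * n)" for q a b
  proof -
    interpret inner_on "H q" "g q" by (rule metric_inner_on[OF W_top[OF q]])
    have "cofr (Suc k) q (T q) = 0" if "k < 2 * n" for k
      using linear_on_0[OF subspace_V lin_left[OF E_H[OF q that]]]
      by (simp add: cofr_Suc[OF q T_tangent[OF q]] rf(2)[OF WU[OF q]])
    moreover have "cofr (Suc k) q (E j q) = (if k = j then 1 else 0)" if "k < 2 * n" "j < 2 * n" for k j
      using EH(2)[OF q that(2,1)]
      by (simp only: cofr_Suc[OF q H_tangent[OF W_top[OF q] E_H[OF q that(2)]]] proj_id[OF q E_H[OF q that(2)]]) auto
    ultimately show ?thesis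
      using a b q rf(2)[OF WU[OF q]] cf(4)[OF WU[OF q] E_H[OF q]]
      by (cases a; cases b) (auto simp: frm_simps cofr_0)
  qed
  have exp: "v = (\<Sum>a<Suc (2 * n). cofr a q v *\<^sub>R frm a q)" if q: "q \<in> W" and v: "v \<in> tangent M q" for q v
  proof -
    interpret inner_on "H q" "g q" by (rule metric_inner_on[OF W_top[OF q]])
    have "v - \<theta> q v *\<^sub>R T q = (\<Sum>k<2 * n. g q (v - \<theta> q v *\<^sub>R T q) (E k q) *\<^sub>R E k q)"
      by (rule orthonormal_expansion[of "{..<2 * n}" "\<lambda>k. E k q"])
        (use E_H[OF q] EH(2)[OF q] EH(3)[OF q] proj_H[OF q v] in auto)
    also have "\<dots> = (\<Sum>k<2 * n. cofr (Suc k) q v *\<^sub>R frm (Suc k) q)"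
      by (simp only: cofr_Suc[OF q v] frm_simps[OF q])
    finally have 1: "v = \<theta> q v *\<^sub>R T q + (\<Sum>k<2 * n. cofr (Suc k) q v *\<^sub>R frm (Suc k) q)"
      by (simp only: diff_eq_eq add.commute)
    have "\<theta> q v *\<^sub>R T q = cofr 0 q v *\<^sub>R frm 0 q" by (simp only: cofr_0 restr_apply(1)[OF q] frm_simps[OF q])
    with 1 show ?thesis by (simp only: sum.lessThan_Suc_shift)
  qed
  show ?thesis
    unfolding is_frame_def
    by (intro conjI openin_W allI impI ballI frm_vfields cofr_one_form dual exp)
qed

lemma cofr_H: "q \<in> W \<Longrightarrow> u \<in> H q \<Longrightarrow> cofr 0 q u = 0"
  using cf(4)[OF WU] by (simp add: cofr_0)

lemma frm_H: "q \<in> W \<Longrightarrow> k < 2 * n \<Longrightarrow> frm (Suc k) q \<in> H q"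
  by (simp add: frm_simps E_H)

lemma cofr_linear: "a < Suc (2 * n) \<Longrightarrow> q \<in> W \<Longrightarrow> linear_on (tangent M q) (cofr a q)"
  using one_forms_cotangent[OF cofr_one_form] by (simp add: cotangent_def)

lemma H_expansion: "q \<in> W \<Longrightarrow> u \<in> H q \<Longrightarrow> u = (\<Sum>k<2 * n. cofr (Suc k) q u *\<^sub>R frm (Suc k) q)"
  using is_frameD(5)[OF is_frame _ H_tangent[OF W_top], of q u] cofr_H[of q u]
  by (simp only: sum.lessThan_Suc_shift scaleR_zero_left add_0)

text \<open>The extended metric is the sum of the tensor squares of the coframe forms other than
  \<theta>; parallelism of \<open>g\<close> thereby becomes a skewness condition on the derivatives
  of these forms.\<close>

lemma reeb_extend_sum:
  assumes q: "q \<in> W" and v: "v \<in> tangent M q" and w: "w \<in> tangent M q"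
  shows "reeb_extend \<theta> T g q v w = (\<Sum>k<2 * n. cofr (Suc k) q v * cofr (Suc k) q w)"
proof -
  interpret inner_on "H q" "g q" by (rule metric_inner_on[OF W_top[OF q]])
  let ?v = "v - \<theta> q v *\<^sub>R T q" and ?w = "w - \<theta> q w *\<^sub>R T q"
  have "?w = (\<Sum>k<2 * n. g q ?w (E k q) *\<^sub>R E k q)"
    by (rule orthonormal_expansion[of "{..<2 * n}" "\<lambda>k. E k q"])
      (use E_H[OF q] EH(2)[OF q] EH(3)[OF q] proj_H[OF q w] in auto)
  then have "g q ?v ?w = g q ?v (\<Sum>k<2 * n. g q ?w (E k q) *\<^sub>R E k q)" by simp
  also have "\<dots> = (\<Sum>k<2 * n. g q ?w (E k q) * g q ?v (E k q))"
    by (rule linear_on_sum_scale[OF subspace_V lin[OF proj_H[OF q v]]]) (use E_H[OF q] in auto)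
  finally show ?thesis
    by (simp only: reeb_extend_def cofr_Suc[OF q v] cofr_Suc[OF q w] mult.commute)
qed

text \<open>Index 0 of the frame is the Reeb field, so the indices of the frame of H are shifted by one.
  \<open>dcof i j k\<close> is minus the k-th component of the bracket of the i-th and the j-th frame field of H,
  which makes \<open>chr\<close> the Koszul formula.\<close>

definition dcof :: "nat \<Rightarrow> nat \<Rightarrow> nat \<Rightarrow> 'a \<Rightarrow> real" where
  "dcof i j k q = ext_deriv M (cofr (Suc k)) q (frm (Suc i) q) (frm (Suc j) q)"

definition chr :: "nat \<Rightarrow> nat \<Rightarrow> nat \<Rightarrow> 'a \<Rightarrow> real" where
  "chr i j k q = (dcof i j k q - dcof j k i q + dcof k i j q) / 2"

text \<open>\<open>Gam a\<close> is the intended derivative of \<open>cofr a\<close>. Index 0 is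
  condition (2). For the other indices the sum omits the component of \<open>v\<close> along
  \<open>T\<close>, which expresses that \<open>T\<close> is parallel, and \<open>chr i j k\<close>
  is minus the usual Christoffel symbol, since forms and not fields are differentiated.\<close>

definition Gam :: "nat \<Rightarrow> ('a, 'e) bilin" where
  "Gam a q u v = (case a of 0 \<Rightarrow> 1/2 * ext_deriv M (cofr 0) q u v
     | Suc k \<Rightarrow> (\<Sum>i<2 * n. \<Sum>j<2 * n. cofr (Suc i) q u * cofr (Suc j) q v * chr i j k q))"

definition conn :: "('a, 'e) form_operator" where
  "conn = frame_conn (Suc (2 * n)) frm cofr Gam"

lemma dcof_antisym: "dcof i j k q = - dcof j i k q"
  unfolding dcof_def by (rule ext_deriv_antisym)

text \<open>With \<open>chr_torsion\<close> this is the converse of \<open>koszul_unique\<close>: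
  the Koszul combination satisfies both equations whenever \<open>dcof\<close> is antisymmetric in
  its first two indices.\<close>

lemma chr_metric: "chr i j k q + chr i k j q = 0"
  using dcof_antisym[of i j k q] dcof_antisym[of j k i q] dcof_antisym[of k i j q] unfolding chr_def by argo

lemma chr_torsion: "chr i j k q - chr j i k q = dcof i j k q"
  using dcof_antisym[of i j k q] dcof_antisym[of j k i q] dcof_antisym[of k i j q] unfolding chr_def by argo

lemma Gam_linear:
  assumes p: "p \<in> W" and a: "a < Suc (2 * n)"
  shows "linear_on (tangent M p) (Gam a p u)" "linear_on (tangent M p) (\<lambda>u. Gam a p u v)"
proof -
  note L0 = linear_imp_linear_on[OF ext_deriv_linear(1)[OF openin_W p cofr_one_form]]
    linear_imp_linear_on[OF ext_deriv_linear(2)[OF openin_W p cofr_one_form]]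
  have Lc: "linear_on (tangent M p) (cofr (Suc i) p)" if "i < 2 * n" for i
    using cofr_linear[OF _ p] that by simp
  show "linear_on (tangent M p) (Gam a p u)"
  proof (cases a)
    case 0
    then show ?thesis using L0(2)[of 0 "tangent M p" u] by (auto simp: Gam_def linear_on_def algebra_simps)
  next
    case (Suc k)
    show ?thesis
      unfolding Suc Gam_def nat.case linear_on_def sum_distrib_left sum.distrib[symmetric]
      by (intro ballI allI sum.cong refl) (use Lc in \<open>auto simp: linear_on_def algebra_simps\<close>)
  qed
  show "linear_on (tangent M p) (\<lambda>u. Gam a p u v)"
  proof (cases a)
    case 0
    then show ?thesis using L0(1)[of 0 "tangent M p" v] by (auto simp: Gam_def linear_on_def algebra_simps)
  next
    case (Suc k)
    show ?thesis
      unfolding Suc Gam_def nat.case linear_on_def sum_distrib_left sum.distrib[symmetric]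
      by (intro ballI allI sum.cong refl) (use Lc in \<open>auto simp: linear_on_def algebra_simps\<close>)
  qed
qed

lemma conn_at_conn: "p \<in> W \<Longrightarrow> conn_at p conn"
  unfolding conn_def
  by (rule conn_at_frame_conn[OF is_frame])
    (use Gam_linear H_tangent[OF W_top] in \<open>auto simp: linear_on_def\<close>)

lemma ext_deriv_cofr_0:
  assumes "p \<in> W"
  shows "ext_deriv M (cofr 0) p u v = ext_deriv M \<theta> p u v"
  by (rule ext_deriv_cong[OF openin_W assms]) (simp add: cofr_0)

text \<open>For index 0 because d\<theta>(T, .) = 0, for the others because the forms
  \<open>cofr (Suc j)\<close> vanish on \<open>T\<close>. This is condition (1) for the connection
  under construction.\<close>

lemma Gam_T: "p \<in> W \<Longrightarrow> u \<in> tangent M p \<Longrightarrow> a < Suc (2 * n) \<Longrightarrow> Gam a p u (T p) = 0"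
  using rf(3)[OF WU, of p u] ext_deriv_antisym[of \<theta> p u "T p"] is_frameD(4)[OF is_frame, of p _ 0]
  by (auto simp: Gam_def ext_deriv_cofr_0 frm_simps split: nat.split intro!: sum.neutral)

lemma dir_deriv_cofr_frm:
  assumes "p \<in> W" "a < Suc (2 * n)" "b < Suc (2 * n)"
  shows "dir_deriv M p u (\<lambda>q. cofr a q (frm b q)) = 0"
  by (rule dir_deriv_eq_const[OF openin_W assms(1) is_frameD(4)[OF is_frame _ assms(2,3)]])

text \<open>\<open>cofr a\<close> is constant on \<open>T\<close>, so differentiating the pairing
  leaves only the derivative of the form.\<close>

lemma induced_TM_restr_T:
  assumes D: "conn_at p D" and p: "p \<in> W" and u: "u \<in> H p" and a: "a < Suc (2 * n)"
  shows "cofr a p (induced_TM M D U T p u) = - D W (cofr a) p u (T p)"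
proof -
  have "dir_deriv M p u (\<lambda>q. cofr a q (T q)) = dir_deriv M p u (\<lambda>q. cofr a q (frm 0 q))"
    by (rule dir_deriv_cong[OF openin_W p]) (simp add: frm_simps)
  then show ?thesis
    using induced_TM_coframe[OF is_frame D cf(1) WU[OF p] p rf(1) u a] dir_deriv_cofr_frm[OF p a, of 0] by simp
qed

lemma ext_deriv_bilinear_expansion:
  assumes p: "p \<in> W" and \<omega>: "\<omega> \<in> one_forms M W" and u: "u \<in> H p" and v: "v \<in> H p"
  shows "ext_deriv M \<omega> p u v = (\<Sum>i<2 * n. \<Sum>j<2 * n. cofr (Suc i) p u * cofr (Suc j) p v *
    ext_deriv M \<omega> p (frm (Suc i) p) (frm (Suc j) p))"
proof -
  note L1 = ext_deriv_linear(1)[OF openin_W p \<omega>] and L2 = ext_deriv_linear(2)[OF openin_W p \<omega>]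
  have "ext_deriv M \<omega> p u v = ext_deriv M \<omega> p (\<Sum>i<2 * n. cofr (Suc i) p u *\<^sub>R frm (Suc i) p) v"
    using H_expansion[OF p u] by simp
  also have "\<dots> = (\<Sum>i<2 * n. cofr (Suc i) p u * ext_deriv M \<omega> p (frm (Suc i) p) v)"
    by (subst linear_sum[OF L1]) (simp only: linear_scale[OF L1] real_scaleR_def)
  also have "\<dots> = (\<Sum>i<2 * n. cofr (Suc i) p u *
      ext_deriv M \<omega> p (frm (Suc i) p) (\<Sum>j<2 * n. cofr (Suc j) p v *\<^sub>R frm (Suc j) p))"
    using H_expansion[OF p v] by simp
  also have "\<dots> = (\<Sum>i<2 * n. \<Sum>j<2 * n. cofr (Suc i) p u * cofr (Suc j) p v *
      ext_deriv M \<omega> p (frm (Suc i) p) (frm (Suc j) p))"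
    by (subst linear_sum[OF L2]) (simp only: linear_scale[OF L2] real_scaleR_def sum_distrib_left mult.assoc)
  finally show ?thesis .
qed

text \<open>For index 0 the two halves of the skew form d\<theta> add up to d\<theta>: here the
  factor 1/2 meets the torsion condition. For the others it is \<open>chr_torsion\<close> contracted
  with \<open>u\<close> and \<open>v\<close>.\<close>

lemma Gam_torsion:
  assumes p: "p \<in> W" and u: "u \<in> H p" and v: "v \<in> H p" and a: "a < Suc (2 * n)"
  shows "ext_deriv M (cofr a) p u v = Gam a p u v - Gam a p v u"
proof (cases a)
  case 0
  then show ?thesis using ext_deriv_antisym[of "cofr 0" p u v] by (simp add: Gam_def)
next
  case (Suc k)
  have "Gam a p v u = (\<Sum>i<2 * n. \<Sum>j<2 * n. cofr (Suc i) p u * cofr (Suc j) p v * chr j i k p)"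
    unfolding Suc Gam_def nat.case by (subst sum.swap) (simp only: mult_ac)
  then have "Gam a p u v - Gam a p v u =
      (\<Sum>i<2 * n. \<Sum>j<2 * n. cofr (Suc i) p u * cofr (Suc j) p v * (chr i j k p - chr j i k p))"
    unfolding Suc Gam_def nat.case by (simp only: right_diff_distrib sum_subtractf)
  also have "\<dots> = ext_deriv M (cofr a) p u v"
    unfolding ext_deriv_bilinear_expansion[OF p cofr_one_form[OF a] u v] chr_torsion
    by (simp only: dcof_def Suc)
  finally show ?thesis by simp
qed

text \<open>After renaming summation indices both sums contract the same coefficients, once with
  \<open>chr i j k\<close> and once with \<open>chr i k j\<close>, whose sum vanishes.\<close>

lemma Gam_metric:
  "(\<Sum>k<2 * n. Gam (Suc k) p u y * cofr (Suc k) p z + cofr (Suc k) p y * Gam (Suc k) p u z) = 0"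
proof -
  have "(\<Sum>k<2 * n. Gam (Suc k) p u y * cofr (Suc k) p z) =
      (\<Sum>k<2 * n. \<Sum>i<2 * n. \<Sum>j<2 * n. cofr (Suc i) p u * cofr (Suc j) p y * cofr (Suc k) p z * chr i j k p)"
    unfolding Gam_def nat.case sum_distrib_right by (simp only: mult_ac)
  also have "\<dots> = (\<Sum>i<2 * n. \<Sum>k<2 * n. \<Sum>j<2 * n. cofr (Suc i) p u * cofr (Suc j) p y * cofr (Suc k) p z * chr i j k p)"
    by (rule sum.swap)
  finally have 1: "(\<Sum>k<2 * n. Gam (Suc k) p u y * cofr (Suc k) p z) = \<dots>" .
  have "(\<Sum>k<2 * n. cofr (Suc k) p y * Gam (Suc k) p u z) =
      (\<Sum>k<2 * n. \<Sum>i<2 * n. \<Sum>j<2 * n. cofr (Suc i) p u * cofr (Suc k) p y * cofr (Suc j) p z * chr i j k p)"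
    unfolding Gam_def nat.case sum_distrib_left by (simp only: mult_ac)
  also have "\<dots> = (\<Sum>i<2 * n. \<Sum>k<2 * n. \<Sum>j<2 * n. cofr (Suc i) p u * cofr (Suc k) p y * cofr (Suc j) p z * chr i j k p)"
    by (rule sum.swap)
  also have "\<dots> = (\<Sum>i<2 * n. \<Sum>k<2 * n. \<Sum>j<2 * n. cofr (Suc i) p u * cofr (Suc j) p y * cofr (Suc k) p z * chr i k j p)"
    by (rule sum.cong[OF refl], rule sum.swap)
  finally have 2: "(\<Sum>k<2 * n. cofr (Suc k) p y * Gam (Suc k) p u z) = \<dots>" .
  show ?thesis
    unfolding sum.distrib 1 2 by (simp only: sum.distrib[symmetric] distrib_left[symmetric] chr_metric) simp
qed

lemma dir_deriv_reeb_extend: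
  assumes V: "openin (mtop M) V" and p: "p \<in> V" "p \<in> W" and Y: "Y \<in> vfields M V" and Z: "Z \<in> vfields M V"
  shows "dir_deriv M p u (\<lambda>q. reeb_extend \<theta> T g q (Y q) (Z q)) =
    (\<Sum>k<2 * n. cofr (Suc k) p (Y p) * dir_deriv M p u (\<lambda>q. cofr (Suc k) q (Z q)) +
       dir_deriv M p u (\<lambda>q. cofr (Suc k) q (Y q)) * cofr (Suc k) p (Z p))"
proof -
  have oV: "openin (mtop M) (V \<inter> W)" "p \<in> V \<inter> W" using V openin_W p by auto
  have "dir_deriv M p u (\<lambda>q. reeb_extend \<theta> T g q (Y q) (Z q)) =
    dir_deriv M p u (\<lambda>q. \<Sum>k<2 * n. cofr (Suc k) q (Y q) * cofr (Suc k) q (Z q))"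
    by (rule dir_deriv_cong[OF oV], rule reeb_extend_sum)
      (use vfields_tangent[OF Y] vfields_tangent[OF Z] in auto)
  also have "\<dots> = (\<Sum>k<2 * n. cofr (Suc k) p (Y p) * dir_deriv M p u (\<lambda>q. cofr (Suc k) q (Z q)) +
       dir_deriv M p u (\<lambda>q. cofr (Suc k) q (Y q)) * cofr (Suc k) p (Z p))"
    by (rule dir_deriv_sum_mult[OF oV]) (use smooth_coframe[OF is_frame Y V] smooth_coframe[OF is_frame Z V] in auto)
  finally show ?thesis .
qed

text \<open>The Leibniz rule for the sum of squares in \<open>reeb_extend_sum\<close>: the
  derivatives of the components of \<open>Y\<close> and \<open>Z\<close> cancel, and only values of
  \<open>D\<close> on the coframe remain. It is stated for any \<open>D\<close>, as it serves
  existence and uniqueness alike.\<close>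

lemma induced_bilin_reeb_extend:
  assumes D: "conn_at p D" and V: "openin (mtop M) V" and p: "p \<in> V" "p \<in> W"
    and Y: "Y \<in> vfields M V" and Z: "Z \<in> vfields M V" and u: "u \<in> H p"
  shows "induced_bilin M D V (reeb_extend \<theta> T g) Y Z p u =
    (\<Sum>k<2 * n. D W (cofr (Suc k)) p u (Y p) * cofr (Suc k) p (Z p) + cofr (Suc k) p (Y p) * D W (cofr (Suc k)) p u (Z p))"
proof -
  note IT = induced_TM_tangent[OF is_frame D V p _ u]
  have IC: "cofr (Suc k) p (induced_TM M D V X p u) = dir_deriv M p u (\<lambda>q. cofr (Suc k) q (X q)) - D W (cofr (Suc k)) p u (X p)"
    if "X \<in> vfields M V" "k < 2 * n" for X k
    by (rule induced_TM_coframe[OF is_frame D V p that(1) u]) (use that in simp)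
  have "induced_bilin M D V (reeb_extend \<theta> T g) Y Z p u =
    (\<Sum>k<2 * n. cofr (Suc k) p (Y p) * dir_deriv M p u (\<lambda>q. cofr (Suc k) q (Z q)) +
       dir_deriv M p u (\<lambda>q. cofr (Suc k) q (Y q)) * cofr (Suc k) p (Z p)) -
    (\<Sum>k<2 * n. cofr (Suc k) p (induced_TM M D V Y p u) * cofr (Suc k) p (Z p)) -
    (\<Sum>k<2 * n. cofr (Suc k) p (Y p) * cofr (Suc k) p (induced_TM M D V Z p u))"
    unfolding induced_bilin_def dir_deriv_reeb_extend[OF V p Y Z]
      reeb_extend_sum[OF p(2) IT[OF Y] vfields_tangent[OF Z p(1)]]
      reeb_extend_sum[OF p(2) vfields_tangent[OF Y p(1)] IT[OF Z]] ..
  also have "\<dots> = (\<Sum>k<2 * n. D W (cofr (Suc k)) p u (Y p) * cofr (Suc k) p (Z p) + cofr (Suc k) p (Y p) * D W (cofr (Suc k)) p u (Z p))"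
    unfolding sum_subtractf[symmetric] by (rule sum.cong) (auto simp: IC[OF Y] IC[OF Z] algebra_simps)
  finally show ?thesis .
qed

section \<open>Existence and uniqueness at a point, relative to one adapted frame\<close>

lemma lc_at_conn:
  assumes p: "p \<in> W"
  shows "lc_at p U \<theta> T conn"
proof -
  note top = W_top[OF p]
  have D: "conn_at p conn" by (rule conn_at_conn[OF p])
  have cG: "conn V (cofr a) p u v = Gam a p u v" if "a < Suc (2 * n)" for V a u v
    unfolding conn_def by (rule frame_conn_coframe[OF is_frame p that])
  have c1: "induced_TM M conn U T p u = 0" if u: "u \<in> H p" for u
  proof (rule frame_eq_zeroI[OF is_frame p])
    show "induced_TM M conn U T p u \<in> tangent M p"
      by (rule induced_TM_tangent[OF is_frame D cf(1) WU[OF p] p rf(1) u])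
    show "cofr a p (induced_TM M conn U T p u) = 0" if "a < Suc (2 * n)" for a
      using induced_TM_restr_T[OF D p u that] cG[OF that] Gam_T[OF p H_tangent[OF top u] that] by simp
  qed
  have c2: "conn U \<theta> p u v = 1/2 * ext_deriv M \<theta> p u v" if u: "u \<in> H p" and v: "v \<in> tangent M p" for u v
  proof -
    have "conn U \<theta> p u v = conn W (cofr 0) p u v"
      unfolding cofr_0 by (rule conn_atD(1)[OF D cf(1) WU[OF p] cf(2) u v openin_W p W_subset, symmetric])
    then show ?thesis using cG[of 0] ext_deriv_cofr_0[OF p] by (simp add: Gam_def)
  qed
  have c3: "partial_torsion M conn V \<omega> p u v = 0"
    if V: "openin (mtop M) V" "p \<in> V" and \<omega>: "\<omega> \<in> one_forms M V" and u: "u \<in> H p" and v: "v \<in> H p" for V \<omega> u v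
  proof -
    \<comment> \<open>The derivative terms of both expansions agree after antisymmetrisation;
      \<open>Gam_torsion\<close> compares what is left.\<close>
    have "ext_deriv M \<omega> p u v = conn V \<omega> p u v - conn V \<omega> p v u"
      unfolding ext_deriv_expansion[OF is_frame \<omega> V p H_tangent[OF top u] H_tangent[OF top v]]
        conn_def frame_conn_def[OF is_frame] sum_subtractf[symmetric]
      by (rule sum.cong) (auto simp: Gam_torsion[OF p u v] algebra_simps)
    then show ?thesis by (simp add: partial_torsion_def)
  qed
  have c4: "induced_bilin M conn V (reeb_extend \<theta> T g) Y Z p u = 0"
    if V: "openin (mtop M) V" "p \<in> V" and Y: "Y \<in> vfields M V" and Z: "Z \<in> vfields M V" and u: "u \<in> H p" for V Y Z u
  proof -
    have "induced_bilin M conn V (reeb_extend \<theta> T g) Y Z p u =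
      (\<Sum>k<2 * n. Gam (Suc k) p u (Y p) * cofr (Suc k) p (Z p) + cofr (Suc k) p (Y p) * Gam (Suc k) p u (Z p))"
      unfolding induced_bilin_reeb_extend[OF D V p Y Z u] by (rule sum.cong) (auto simp: cG)
    then show ?thesis by (simp only: Gam_metric)
  qed
  show ?thesis
    unfolding lc_at_def
    by (intro conjI D ballI allI impI; (elim conjE)?) (simp_all only: c1 c2 c3 c4)
qed

text \<open>By \<open>conn_at_expansion\<close> only the values on the coframe matter. Condition (2)
  gives the one on \<open>cofr 0\<close> and (1) the values on \<open>T\<close>; the remaining
  components \<open>L\<close> satisfy the hypotheses of \<open>koszul_unique\<close>, by (3) tested
  on the coframe and (4) tested on the frame fields.\<close>

lemma lc_at_unique:
  assumes lc: "lc_at p U \<theta> T D" and p: "p \<in> W" and V: "openin (mtop M) V" "p \<in> V" and \<sigma>: "\<sigma> \<in> one_forms M V"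
    and u: "u \<in> H p" and v: "v \<in> tangent M p"
  shows "D V \<sigma> p u v = conn V' \<sigma> p u v"
proof -
  note top = W_top[OF p]
  have D: "conn_at p D" and c1: "\<And>u. u \<in> H p \<Longrightarrow> induced_TM M D U T p u = 0"
    and c2: "\<And>u v. u \<in> H p \<Longrightarrow> v \<in> tangent M p \<Longrightarrow> D U \<theta> p u v = 1/2 * ext_deriv M \<theta> p u v"
    and c3: "\<And>V \<omega> u v. openin (mtop M) V \<Longrightarrow> p \<in> V \<Longrightarrow> V \<subseteq> U \<Longrightarrow> \<omega> \<in> one_forms M V \<Longrightarrow> u \<in> H p \<Longrightarrow> v \<in> H p \<Longrightarrow>
        partial_torsion M D V \<omega> p u v = 0"
    and c4: "\<And>V Y Z u. openin (mtop M) V \<Longrightarrow> p \<in> V \<Longrightarrow> V \<subseteq> U \<Longrightarrow> Y \<in> vfields M V \<Longrightarrow> Z \<in> vfields M V \<Longrightarrow> u \<in> H p \<Longrightarrow>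
        induced_bilin M D V (reeb_extend \<theta> T g) Y Z p u = 0"
    using lc unfolding lc_at_def by simp_all
  define \<Lambda> where "\<Lambda> a = D W (cofr a) p" for a
  define L where "L i j k = \<Lambda> (Suc k) (frm (Suc i) p) (frm (Suc j) p)" for i j k
  have FH: "frm (Suc i) p \<in> H p" if "i < 2 * n" for i by (rule frm_H[OF p that])
  have torsion: "dcof i j k p = L i j k - L j i k" if "i < 2 * n" "j < 2 * n" "k < 2 * n" for i j k
    using c3[OF openin_W p W_subset cofr_one_form FH[OF that(1)] FH[OF that(2)], of "Suc k"] that
    by (simp add: partial_torsion_def dcof_def L_def \<Lambda>_def)
  \<comment> \<open>For frame fields the pairings with the coframe are Kronecker deltas, so the sum
    of \<open>induced_bilin_reeb_extend\<close> collapses to two terms.\<close>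
  have metric: "L i j k + L i k j = 0" if i: "i < 2 * n" and j: "j < 2 * n" and k: "k < 2 * n" for i j k
  proof -
    have b: "frm (Suc j) \<in> vfields M W" "frm (Suc k) \<in> vfields M W" using frm_vfields j k by auto
    have dl: "cofr (Suc l) p (frm (Suc b) p) = (if l = b then 1 else 0)" if "l < 2 * n" "b < 2 * n" for l b
      using is_frameD(4)[OF is_frame p, of "Suc l" "Suc b"] that by simp
    have "0 = induced_bilin M D W (reeb_extend \<theta> T g) (frm (Suc j)) (frm (Suc k)) p (frm (Suc i) p)"
      using c4[OF openin_W p W_subset b FH[OF i]] by simp
    also have "\<dots> = (\<Sum>l<2 * n. L i j l * cofr (Suc l) p (frm (Suc k) p) + cofr (Suc l) p (frm (Suc j) p) * L i k l)"
      unfolding induced_bilin_reeb_extend[OF D openin_W p p b FH[OF i]] L_def \<Lambda>_def ..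
    also have "\<dots> = (\<Sum>l<2 * n. (if l = k then L i j l else 0) + (if l = j then L i k l else 0))"
      by (rule sum.cong) (auto simp: dl j k)
    also have "\<dots> = L i j k + L i k j" using j k by (simp add: sum.distrib)
    finally show ?thesis by simp
  qed
  have LL: "L i j k = chr i j k p" if "i < 2 * n" "j < 2 * n" "k < 2 * n" for i j k
    unfolding chr_def by (rule koszul_unique[OF metric torsion that])
  have "\<Lambda> a u v = Gam a p u v" if a: "a < Suc (2 * n)" for a
  proof (cases a)
    case 0
    have "D W (restr W \<theta>) p u v = D U \<theta> p u v"
      by (rule conn_atD(1)[OF D cf(1) WU[OF p] cf(2) u v openin_W p W_subset])
    then show ?thesis using c2[OF u v] ext_deriv_cofr_0[OF p] by (simp add: 0 \<Lambda>_def cofr_0 Gam_def)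
  next
    case (Suc k)
    have k: "k < 2 * n" using a Suc by simp
    note lin1 = conn_atD(4)[OF D openin_W p cofr_one_form[OF a] _ v]
      and lin2 = conn_atD(5)[OF D openin_W p cofr_one_form[OF a] u]
    note tanS = subspace_tangent[OF top]
    have frt: "frm b p \<in> tangent M p" if "b < Suc (2 * n)" for b
      by (rule frame_tangent[OF is_frame that p])
    \<comment> \<open>Condition (1) read through the coframe: the derivative of
      \<open>cofr a\<close> has no component along \<open>T\<close>.\<close>
    have "\<Lambda> a w (T p) = 0" if w: "w \<in> H p" for w
    proof -
      have "cofr a p 0 = 0" by (rule linear_on_0[OF tanS cofr_linear[OF a p]])
      then show ?thesis using induced_TM_restr_T[OF D p w a] c1[OF w] by (simp add: \<Lambda>_def)
    qed
    then have wT: "\<Lambda> a w (frm 0 p) = 0" if "w \<in> H p" for w using that frm_simps(1)[OF p] by simp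
    have wv: "\<Lambda> a w v = (\<Sum>j<2 * n. cofr (Suc j) p v * \<Lambda> a w (frm (Suc j) p))" if w: "w \<in> H p" for w
    proof -
      have "\<Lambda> a w v = \<Lambda> a w (\<Sum>b<Suc (2 * n). cofr b p v *\<^sub>R frm b p)"
        using is_frameD(5)[OF is_frame p v] by simp
      also have "\<dots> = (\<Sum>b<Suc (2 * n). cofr b p v * \<Lambda> a w (frm b p))"
        unfolding \<Lambda>_def by (rule linear_on_sum_scale[OF tanS lin1[OF w]]) (use frt in auto)
      finally show ?thesis using wT[OF w] by (simp only: sum.lessThan_Suc_shift mult_zero_right add_0)
    qed
    have "\<Lambda> a u v = \<Lambda> a (\<Sum>i<2 * n. cofr (Suc i) p u *\<^sub>R frm (Suc i) p) v"
      using H_expansion[OF p u] by simp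
    also have "\<dots> = (\<Sum>i<2 * n. cofr (Suc i) p u * \<Lambda> a (frm (Suc i) p) v)"
      unfolding \<Lambda>_def by (rule linear_on_sum_scale[OF H_subspace[OF top] lin2[OF v]]) (use FH in auto)
    also have "\<dots> = (\<Sum>i<2 * n. \<Sum>j<2 * n. cofr (Suc i) p u * cofr (Suc j) p v * chr i j k p)"
    proof (rule sum.cong[OF refl])
      fix i assume "i \<in> {..<2 * n}"
      then have i: "i < 2 * n" by simp
      show "cofr (Suc i) p u * \<Lambda> a (frm (Suc i) p) v = (\<Sum>j<2 * n. cofr (Suc i) p u * cofr (Suc j) p v * chr i j k p)"
        unfolding wv[OF FH[OF i]] sum_distrib_left
        by (rule sum.cong) (use LL[OF i _ k] in \<open>auto simp: L_def Suc\<close>)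
    qed
    finally show ?thesis by (simp add: Suc Gam_def)
  qed
  then show ?thesis
    unfolding conn_at_expansion[OF is_frame D V p \<sigma> u v] conn_def frame_conn_def[OF is_frame] \<Lambda>_def
    by (intro sum.cong) auto
qed

lemma smooth_fun_conn:
  assumes V: "openin (mtop M) V" and \<sigma>: "\<sigma> \<in> one_forms M V" and X: "X \<in> vfields M V" and Y: "Y \<in> vfields M V"
  shows "smooth_fun M (V \<inter> W) (\<lambda>q. conn V' \<sigma> q (X q) (Y q))"
proof -
  let ?V = "V \<inter> W"
  have oV: "openin (mtop M) ?V" using V openin_W by auto
  have Xr: "restr ?V X \<in> vfields M ?V" and Yr: "restr ?V Y \<in> vfields M ?V"
    using vfields_restr[OF X oV] vfields_restr[OF Y oV] by auto
  note smF = smooth_form_frame[OF is_frame \<sigma> V] and smX = smooth_coframe[OF is_frame X V]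
    and smY = smooth_coframe[OF is_frame Y V]
  \<comment> \<open>\<open>smooth_fun_ext_deriv\<close> wants the form and both fields over one open
    set, while coframe, frame and arguments come with different domains.\<close>
  have sd: "smooth_fun M ?V (\<lambda>q. ext_deriv M (cofr a) q (A q) (B q))"
    if a: "a < Suc (2 * n)" and A: "A \<in> vfields M V'" "?V \<subseteq> V'" and B: "B \<in> vfields M V''" "?V \<subseteq> V''" for a A B V' V''
  proof (rule iffD1[OF smooth_fun_cong[OF oV]])
    show "smooth_fun M ?V (\<lambda>q. ext_deriv M (restr ?V (cofr a)) q (restr ?V A q) (restr ?V B q))"
      by (rule smooth_fun_ext_deriv[OF one_forms_restr[OF cofr_one_form[OF a] oV] oV
            vfields_restr[OF A(1) oV A(2)] vfields_restr[OF B(1) oV B(2)]]) auto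
    show "ext_deriv M (restr ?V (cofr a)) q (restr ?V A q) (restr ?V B q) = ext_deriv M (cofr a) q (A q) (B q)"
      if "q \<in> ?V" for q
      using ext_deriv_cong[OF oV that, of "restr ?V (cofr a)" "cofr a"] that by simp
  qed
  have sdc: "smooth_fun M ?V (\<lambda>q. dcof i j k q)" if "i < 2 * n" "j < 2 * n" "k < 2 * n" for i j k
    unfolding dcof_def by (rule sd[OF _ frm_vfields _ frm_vfields]) (use that in auto)
  have sch: "smooth_fun M ?V (\<lambda>q. chr i j k q)" if "i < 2 * n" "j < 2 * n" "k < 2 * n" for i j k
    unfolding chr_def divide_inverse
    by (intro smooth_fun_mult smooth_fun_add smooth_fun_diff smooth_fun_const oV sdc that)
  have sG: "smooth_fun M ?V (\<lambda>q. Gam a q (X q) (Y q))" if a: "a < Suc (2 * n)" for a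
  proof (cases a)
    case 0
    show ?thesis
      unfolding 0 Gam_def nat.case
      by (rule smooth_fun_mult[OF oV smooth_fun_const[OF oV] sd[OF _ X _ Y]]) auto
  next
    case (Suc k)
    have "k < 2 * n" using a Suc by simp
    then show ?thesis
      unfolding Suc Gam_def nat.case
      by (intro smooth_fun_sum smooth_fun_mult oV smX smY sch) auto
  qed
  have sdir: "smooth_fun M ?V (\<lambda>q. dir_deriv M q (X q) (\<lambda>x. \<sigma> x (frm a x)))" if a: "a < Suc (2 * n)" for a
    by (rule iffD1[OF smooth_fun_cong[OF oV] smooth_fun_dir_deriv[OF oV smF[OF a] Xr]]) simp
  show ?thesis
    unfolding conn_def frame_conn_def[OF is_frame]
    by (intro smooth_fun_sum[OF oV] smooth_fun_add[OF oV] smooth_fun_mult[OF oV] sdir smY smF sG) auto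
qed

end

section \<open>The canonical partial connection\<close>

context sub_riem_contact
begin

text \<open>The two frames differ only at index 0, where \<theta>' = a\<theta> and T' = aT with a a
  = 1 and da = 0. The factor \<open>a\<close> occurs twice in every term of index 0, and the
  projections to \<open>H\<close> along T and T' coincide, so the other coframe forms and their
  coefficients are the same.\<close>

lemma adapted_conn_sign:
  assumes A: "adapted M H g n U \<theta> T W E" and B: "adapted M H g n U' \<theta>' T' W E"
    and p: "p \<in> W" and V: "openin (mtop M) V" "p \<in> V" and \<sigma>: "\<sigma> \<in> one_forms M V" and u: "u \<in> H p" and v: "v \<in> tangent M p"
  shows "adapted.conn M g n \<theta>' T' W E V \<sigma> p u v = adapted.conn M g n \<theta> T W E V \<sigma> p u v"
proof -
  interpret A: adapted M H g n U \<theta> T W E by (rule A)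
  interpret B: adapted M H g n U' \<theta>' T' W E by (rule B)
  note W = A.openin_W
  obtain a where sma: "smooth_fun M W a" and a2: "\<forall>q\<in>W. a q * a q = 1"
    and \<theta>': "\<forall>q\<in>W. restr W \<theta>' q = a q *\<^sub>R restr W \<theta> q" and T': "\<forall>q\<in>W. restr W T' q = a q *\<^sub>R restr W T q"
    and da: "\<forall>q\<in>W. \<forall>v. dir_deriv M q v a = 0"
    and d\<theta>': "\<forall>q\<in>W. \<forall>u\<in>tangent M q. \<forall>v\<in>tangent M q. ext_deriv M (restr W \<theta>') q u v = a q * ext_deriv M (restr W \<theta>) q u v"
    by (rule normalized_sign[OF normalized_restr[OF A.normalized W A.W_subset]
          normalized_restr[OF B.normalized W B.W_subset]])
  have ut: "u \<in> tangent M p" by (rule H_tangent[OF A.W_top[OF p] u])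
  have frm: "B.frm (Suc k) = A.frm (Suc k)" for k
    by (simp add: A.frm_def B.frm_def)
  have cofr: "B.cofr (Suc k) = A.cofr (Suc k)" for k
  proof
    fix q
    show "B.cofr (Suc k) q = A.cofr (Suc k) q"
    proof (cases "q \<in> W")
      case True
      have "\<theta>' q v *\<^sub>R T' q = (a q * a q) *\<^sub>R (\<theta> q v *\<^sub>R T q)" for v
        using \<theta>' T' True by (simp add: fun_eq_iff mult_ac)
      then have "\<theta>' q v *\<^sub>R T' q = \<theta> q v *\<^sub>R T q" for v using a2 True by simp
      then show ?thesis by (simp only: A.cofr_def B.cofr_def restr_apply(1)[OF True] nat.case)
    qed (simp add: A.cofr_def B.cofr_def)
  qed
  have chr: "B.chr = A.chr"
    unfolding A.chr_def[abs_def] B.chr_def[abs_def] A.dcof_def B.dcof_def frm cofr ..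
  have Gam: "B.Gam (Suc k) = A.Gam (Suc k)" for k
    unfolding fun_eq_iff A.Gam_def B.Gam_def nat.case cofr chr by simp
  have Gam0: "B.Gam 0 p u v = a p * A.Gam 0 p u v"
    using d\<theta>' p ut v by (simp add: A.Gam_def B.Gam_def A.cofr_0 B.cofr_0)
  have cofr0: "B.cofr 0 p v = a p * A.cofr 0 p v" using \<theta>' p by (simp add: A.cofr_0 B.cofr_0)
  have frm0: "B.frm 0 q = a q *\<^sub>R A.frm 0 q" if "q \<in> W" for q
    using T' that by (simp add: A.frm_def B.frm_def)
  let ?V = "V \<inter> W"
  have oV: "openin (mtop M) ?V" "p \<in> ?V" using V W p by auto
  have sma': "smooth_fun M ?V a" by (rule smooth_fun_subset[OF sma]) auto
  have s0: "\<sigma> q (B.frm 0 q) = a q * \<sigma> q (A.frm 0 q)" if "q \<in> ?V" for q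
  proof -
    have t: "A.frm 0 q \<in> tangent M q" by (rule frame_tangent[OF A.is_frame]) (use that in auto)
    show ?thesis using one_forms_lincomb[OF \<sigma> _ t t, of "a q" 0] frm0 that by simp
  qed
  have "dir_deriv M p u (\<lambda>q. \<sigma> q (B.frm 0 q)) = dir_deriv M p u (\<lambda>q. a q * \<sigma> q (A.frm 0 q))"
    by (rule dir_deriv_cong[OF oV s0])
  \<comment> \<open>The product rule also produces a term with the derivative of \<open>a\<close>,
    which is zero.\<close>
  also have "\<dots> = a p * dir_deriv M p u (\<lambda>q. \<sigma> q (A.frm 0 q))"
    using dir_deriv_mult[OF oV sma' smooth_form_frame[OF A.is_frame \<sigma> V(1)], of 0 u] da p by simp
  finally have d0: "dir_deriv M p u (\<lambda>q. \<sigma> q (B.frm 0 q)) = a p * dir_deriv M p u (\<lambda>q. \<sigma> q (A.frm 0 q))" .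
  have aa: "a p * x * (a p * y) = x * y" for x y using a2 p by (metis mult.assoc mult.left_commute mult_1)
  show ?thesis
    unfolding A.conn_def B.conn_def frame_conn_def[OF A.is_frame] frame_conn_def[OF B.is_frame]
      sum.lessThan_Suc_shift frm cofr Gam Gam0 cofr0 s0[OF oV(2)] d0 aa ..
qed

lemma adapted_exists:
  assumes N: "normalized U \<theta> T" and p: "p \<in> U"
  obtains W E where "p \<in> W" "adapted M H g n U \<theta> T W E"
proof -
  note U = contact_formD(1)[OF normalizedD(1)[OF N]]
  obtain W E where W: "openin (mtop M) W" "p \<in> W" and E: "H_frame_on W E"
    by (rule orthonormal_frame[OF openin_point[OF U p]])
  have o: "openin (mtop M) (U \<inter> W)" using U W by auto
  have "adapted M H g n U \<theta> T (U \<inter> W) (\<lambda>i. restr (U \<inter> W) (E i))"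
    by unfold_locales (use N H_frame_on_restr[OF E o] o in auto)
  then show ?thesis using that p W by blast
qed

text \<open>The value at \<open>p\<close> does not depend on the frame, so any choice of frames will do.\<close>

definition conn_pt :: "'a \<Rightarrow> ('a, 'e) form_operator" where
  "conn_pt p = (SOME D. \<exists>U \<theta> T W E. p \<in> W \<and> adapted M H g n U \<theta> T W E \<and> D = adapted.conn M g n \<theta> T W E)"

text \<open>The guard supplies the zero values that \<open>partial_connection\<close> and
  \<open>H_tensors\<close> prescribe for arguments that are not sections over open sets or lie
  outside \<open>H p\<close> and the tangent space.\<close>

definition canonical_conn :: "('a, 'e) form_operator" where
  "canonical_conn U \<sigma> p u v =
     (if openin (mtop M) U \<and> \<sigma> \<in> one_forms M U \<and> p \<in> U \<and> u \<in> H p \<and> v \<in> tangent M p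
      then conn_pt p U \<sigma> p u v else 0)"

text \<open>The chosen and the given data differ both in the contact form and in the frame of
  \<open>H\<close>. Uniqueness for one form allows a change of the frame, and
  \<open>adapted_conn_sign\<close> a change of the form with the frame kept; hence the passage
  through \<open>E1\<close> on the common domain.\<close>

lemma canonical_conn_eq:
  assumes A: "adapted M H g n U \<theta> T W E" and p: "p \<in> W" and V: "openin (mtop M) V" "p \<in> V"
    and \<sigma>: "\<sigma> \<in> one_forms M V" and u: "u \<in> H p" and v: "v \<in> tangent M p"
  shows "canonical_conn V \<sigma> p u v = adapted.conn M g n \<theta> T W E V \<sigma> p u v"
proof -
  interpret A: adapted M H g n U \<theta> T W E by (rule A)
  have "\<exists>D U \<theta> T W E. p \<in> W \<and> adapted M H g n U \<theta> T W E \<and> D = adapted.conn M g n \<theta> T W E"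
    using A p by blast
  from someI_ex[OF this, folded conn_pt_def]
  obtain U0 \<theta>0 T0 W0 E0 where p0: "p \<in> W0" and B: "adapted M H g n U0 \<theta>0 T0 W0 E0"
    and c: "conn_pt p = adapted.conn M g n \<theta>0 T0 W0 E0" by blast
  interpret B: adapted M H g n U0 \<theta>0 T0 W0 E0 by (rule B)
  let ?W = "W \<inter> W0"
  define E1 where "E1 = (\<lambda>i. restr ?W (E0 i))"
  have oW: "openin (mtop M) ?W" using A.openin_W B.openin_W by auto
  have E1: "H_frame_on ?W E1" unfolding E1_def by (rule H_frame_on_restr[OF B.H_frame oW]) auto
  have A1: "adapted M H g n U \<theta> T ?W E1" and B1: "adapted M H g n U0 \<theta>0 T0 ?W E1"
    by (unfold_locales; use A.normalized B.normalized E1 oW A.W_subset B.W_subset in auto)+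
  have p1: "p \<in> ?W" using p p0 by simp
  have "canonical_conn V \<sigma> p u v = adapted.conn M g n \<theta>0 T0 W0 E0 V \<sigma> p u v"
    using V \<sigma> u v by (simp add: canonical_conn_def c)
  also have "\<dots> = adapted.conn M g n \<theta>0 T0 ?W E1 V \<sigma> p u v"
    by (rule B.lc_at_unique[OF adapted.lc_at_conn[OF B1 p1] p0 V \<sigma> u v, symmetric])
  also have "\<dots> = adapted.conn M g n \<theta> T ?W E1 V \<sigma> p u v"
    by (rule adapted_conn_sign[OF A1 B1 p1 V \<sigma> u v])
  also have "\<dots> = adapted.conn M g n \<theta> T W E V \<sigma> p u v"
    by (rule A.lc_at_unique[OF adapted.lc_at_conn[OF A1 p1] p V \<sigma> u v])
  finally show ?thesis .
qed

text \<open>\<open>lc_at\<close> sees an operator only through its values at \<open>p\<close> on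
  sections near \<open>p\<close>; the same is true of the definite description in
  \<open>induced_TM\<close>.\<close>

lemma lc_at_cong:
  assumes eq: "\<And>V \<sigma> u v. openin (mtop M) V \<Longrightarrow> p \<in> V \<Longrightarrow> \<sigma> \<in> one_forms M V \<Longrightarrow> u \<in> H p \<Longrightarrow> v \<in> tangent M p \<Longrightarrow>
      D V \<sigma> p u v = D' V \<sigma> p u v"
    and U: "openin (mtop M) U" "p \<in> U" and \<theta>: "\<theta> \<in> one_forms M U" and T: "T \<in> vfields M U"
    and lc: "lc_at p U \<theta> T D'"
  shows "lc_at p U \<theta> T D"
proof -
  note top = openin_point[OF U]
  have D': "conn_at p D'" using lc by (simp add: lc_at_def)
  have c: "conn_at p D"
    unfolding conn_at_def
  proof (intro allI impI, goal_cases)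
    case (1 V \<sigma>)
    then have V: "openin (mtop M) V" "p \<in> V" and \<sigma>: "\<sigma> \<in> one_forms M V" by auto
    have c1: "D V' (restr V' \<sigma>) p u v = D V \<sigma> p u v"
      if "openin (mtop M) V'" "p \<in> V'" "V' \<subseteq> V" "u \<in> H p" "v \<in> tangent M p" for V' u v
      using conn_atD(1)[OF D' V \<sigma> that(4,5,1,2,3)] eq[OF that(1,2) one_forms_restr[OF \<sigma> that(1,3)] that(4,5)]
        eq[OF V \<sigma> that(4,5)] by simp
    have c2: "D V (\<lambda>q. \<sigma> q + \<tau> q) p u v = D V \<sigma> p u v + D V \<tau> p u v"
      if "\<tau> \<in> one_forms M V" "u \<in> H p" "v \<in> tangent M p" for \<tau> u v
      using conn_atD(2)[OF D' V \<sigma> that(2,3,1)] eq[OF V one_forms_add[OF V(1) \<sigma> that(1)] that(2,3)]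
        eq[OF V \<sigma> that(2,3)] eq[OF V that] by simp
    have c3: "D V (\<lambda>q. f q *\<^sub>R \<sigma> q) p u v = f p * D V \<sigma> p u v + dir_deriv M p u f * \<sigma> p v"
      if "smooth_fun M V f" "u \<in> H p" "v \<in> tangent M p" for f u v
      using conn_atD(3)[OF D' V \<sigma> that(2,3,1)] eq[OF V one_forms_scale[OF V(1) that(1) \<sigma>] that(2,3)]
        eq[OF V \<sigma> that(2,3)] by simp
    have c4: "linear_on (tangent M p) (D V \<sigma> p u)" if u: "u \<in> H p" for u
      using conn_atD(4)[OF D' V \<sigma> u subspace_0[OF subspace_tangent[OF top]]] eq[OF V \<sigma> u]
        subspace_add[OF subspace_tangent[OF top]] subspace_scale[OF subspace_tangent[OF top]]
      unfolding linear_on_def by simp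
    have c5: "linear_on (H p) (\<lambda>u. D V \<sigma> p u v)" if v: "v \<in> tangent M p" for v
      using conn_atD(5)[OF D' V \<sigma> subspace_0[OF H_subspace[OF top]] v] eq[OF V \<sigma> _ v]
        subspace_add[OF H_subspace[OF top]] subspace_scale[OF H_subspace[OF top]]
      unfolding linear_on_def by simp
    show ?case
      by (intro conjI ballI allI impI; (elim conjE)?) (simp_all only: c1 c2 c3 c4 c5)
  qed
  have ind: "induced_TM M D V Y p u = induced_TM M D' V Y p u"
    if V: "p \<in> V" and Y: "Y \<in> vfields M V" and u: "u \<in> H p" for V Y u
    unfolding induced_TM_def using eq[OF _ _ _ u vfields_tangent[OF Y V]]
    by (intro arg_cong[of _ _ The] ext) (simp cong: conj_cong imp_cong)
  have bil: "induced_bilin M D V B Y Z p u = induced_bilin M D' V B Y Z p u"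
    if "p \<in> V" "Y \<in> vfields M V" "Z \<in> vfields M V" "u \<in> H p" for V B Y Z u
    using that by (simp add: induced_bilin_def ind)
  have tor: "partial_torsion M D V \<omega> p u v = partial_torsion M D' V \<omega> p u v"
    if "openin (mtop M) V" "p \<in> V" "\<omega> \<in> one_forms M V" "u \<in> H p" "v \<in> H p" for V \<omega> u v
    using eq[OF that(1,2,3)] that(4,5) H_tangent[OF top] by (simp add: partial_torsion_def)
  show ?thesis
    using lc ind[OF U(2) T] eq[OF U \<theta>] bil tor c unfolding lc_at_def by simp
qed

lemma lc_at_canonical:
  assumes "normalized U \<theta> T" "p \<in> U"
  shows "lc_at p U \<theta> T canonical_conn"
proof -
  obtain W E where p: "p \<in> W" and A: "adapted M H g n U \<theta> T W E"
    by (rule adapted_exists[OF assms])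
  note cf = contact_formD[OF normalizedD(1)[OF assms(1)]]
  show ?thesis
    by (rule lc_at_cong[where D = canonical_conn and D' = "adapted.conn M g n \<theta> T W E" and p = p,
          OF canonical_conn_eq[OF A p] cf(1) assms(2) cf(2)
          reeb_fieldD(1)[OF normalizedD(3)[OF assms(1)]] adapted.lc_at_conn[OF A p]])
qed

lemma adapted_at:
  assumes "p \<in> topspace (mtop M)"
  obtains U \<theta> T W E where "p \<in> W" "normalized U \<theta> T" "adapted M H g n U \<theta> T W E"
proof -
  obtain W \<theta> T E where W: "p \<in> W" "normalized W \<theta> T" "H_frame_on W E"
    by (rule normalized_frame_exists[OF assms])
  then have "adapted M H g n W \<theta> T W E"
    by unfold_locales (auto dest: normalizedD(1) contact_formD(1))
  then show ?thesis using that W by blast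
qed

lemma conn_at_canonical:
  assumes "p \<in> topspace (mtop M)"
  shows "conn_at p canonical_conn"
proof -
  obtain U \<theta> T W E where p: "p \<in> W" and N: "normalized U \<theta> T" and A: "adapted M H g n U \<theta> T W E"
    by (rule adapted_at[OF assms])
  show ?thesis using lc_at_canonical[OF N adapted.WU[OF A p]] by (simp add: lc_at_def)
qed

section \<open>The glued operator is a partial connection\<close>

lemma canonical_conn_off:
  "\<not> (openin (mtop M) U \<and> \<sigma> \<in> one_forms M U \<and> p \<in> U \<and> u \<in> H p \<and> v \<in> tangent M p) \<Longrightarrow> canonical_conn U \<sigma> p u v = 0"
  by (simp only: canonical_conn_def if_False)

lemma H_tensors_canonical:
  assumes U: "openin (mtop M) U" and \<sigma>: "\<sigma> \<in> one_forms M U"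
  shows "canonical_conn U \<sigma> \<in> H_tensors M H U"
proof -
  note cD = conn_atD[OF conn_at_canonical[OF openin_point[OF U]] U _ \<sigma>]
  have zero: "canonical_conn U \<sigma> p u v = 0" if "\<not> (p \<in> U \<and> u \<in> H p \<and> v \<in> tangent M p)" for p u v
    by (rule canonical_conn_off) (use that in blast)
  have lin1: "linear_on (tangent M p) (\<lambda>v. canonical_conn U \<sigma> p u v)" if "p \<in> U" "u \<in> H p" for p u
    by (rule cD(4)[OF that(1,1,2) subspace_0[OF subspace_tangent[OF openin_point[OF U that(1)]]]])
  have lin2: "linear_on (H p) (\<lambda>u. canonical_conn U \<sigma> p u v)" if "p \<in> U" "v \<in> tangent M p" for p v
    by (rule cD(5)[OF that(1,1) subspace_0[OF H_subspace[OF openin_point[OF U that(1)]]] that(2)])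
  have smooth: "smooth_fun M V (\<lambda>p. canonical_conn U \<sigma> p (X p) (Y p))"
    if V: "openin (mtop M) V" "V \<subseteq> U" and X: "X \<in> H_fields M H V" and Y: "Y \<in> vfields M V" for V X Y
  \<comment> \<open>Near \<open>p\<close> the operator is that of a single frame, even though the
    frames in its definition were chosen point by point.\<close>
  proof (rule smooth_fun_local)
    fix p assume p: "p \<in> V"
    obtain U' \<theta> T W E where pW: "p \<in> W" and A: "adapted M H g n U' \<theta> T W E"
      by (rule adapted_at[OF openin_point[OF V(1) p]])
    interpret A: adapted M H g n U' \<theta> T W E by (rule A)
    have oV: "openin (mtop M) (V \<inter> W)" using V A.openin_W by auto
    have \<sigma>V: "restr V \<sigma> \<in> one_forms M V" by (rule one_forms_restr[OF \<sigma> V])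
    have "smooth_fun M (V \<inter> W) (\<lambda>p. canonical_conn U \<sigma> p (X p) (Y p))"
    proof (rule iffD1[OF smooth_fun_cong[OF oV] A.smooth_fun_conn[OF V(1) \<sigma>V H_fields_vfields[OF X] Y, of V]])
      fix q assume "q \<in> V \<inter> W"
      then have q: "q \<in> V" "q \<in> W" "q \<in> U" using V(2) by auto
      have "A.conn V (restr V \<sigma>) q (X q) (Y q) = canonical_conn V (restr V \<sigma>) q (X q) (Y q)"
        by (rule canonical_conn_eq[OF A q(2) V(1) q(1) \<sigma>V H_fields_H[OF X q(1)] vfields_tangent[OF Y q(1)], symmetric])
      also have "\<dots> = canonical_conn U \<sigma> q (X q) (Y q)"
        by (rule cD(1)[OF q(3,3) H_fields_H[OF X q(1)] vfields_tangent[OF Y q(1)] V(1) q(1) V(2)])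
      finally show "A.conn V (restr V \<sigma>) q (X q) (Y q) = canonical_conn U \<sigma> q (X q) (Y q)" .
    qed
    then show "\<exists>W. openin (mtop M) W \<and> p \<in> W \<and> smooth_fun M W (\<lambda>p. canonical_conn U \<sigma> p (X p) (Y p))"
      using oV p pW by blast
  qed
  show ?thesis
    unfolding H_tensors_def
  proof (intro CollectI conjI allI impI ballI)
    show "canonical_conn U \<sigma> p u v = 0" if "\<not> (p \<in> U \<and> u \<in> H p \<and> v \<in> tangent M p)" for p u v
      by (rule zero[OF that])
    show "smooth_fun M V (\<lambda>p. canonical_conn U \<sigma> p (X p) (Y p))"
      if "openin (mtop M) V \<and> V \<subseteq> U \<and> X \<in> H_fields M H V \<and> Y \<in> vfields M V" for V X Y
      by (rule smooth) (use that in auto)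
  qed (rule lin1 lin2; assumption)+
qed

lemma partial_connection_canonical: "partial_connection M H canonical_conn"
proof -
  have z1: "canonical_conn U = 0" if "\<not> openin (mtop M) U" for U
    using that by (simp add: fun_eq_iff canonical_conn_def)
  have z2: "canonical_conn U \<sigma> = 0" if "\<sigma> \<notin> one_forms M U" for U \<sigma>
    using that by (simp add: fun_eq_iff canonical_conn_def)
  have main: "(\<forall>\<sigma>\<in>one_forms M U. canonical_conn U \<sigma> \<in> H_tensors M H U) \<and>
        (\<forall>\<sigma>\<in>one_forms M U. \<forall>V. openin (mtop M) V \<and> V \<subseteq> U \<longrightarrow>
           canonical_conn V (restr V \<sigma>) = restr V (canonical_conn U \<sigma>)) \<and>
        (\<forall>\<sigma>\<in>one_forms M U. \<forall>\<tau>\<in>one_forms M U. \<forall>a b.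
           canonical_conn U (a *\<^sub>R \<sigma> + b *\<^sub>R \<tau>) = a *\<^sub>R canonical_conn U \<sigma> + b *\<^sub>R canonical_conn U \<tau>) \<and>
        (\<forall>\<sigma>\<in>one_forms M U. \<forall>f. smooth_fun M U f \<longrightarrow>
           (\<forall>p\<in>U. \<forall>u\<in>H p. \<forall>v\<in>tangent M p.
              canonical_conn U (\<lambda>q. f q *\<^sub>R \<sigma> q) p u v = f p * canonical_conn U \<sigma> p u v + dir_deriv M p u f * \<sigma> p v))"
    if U: "openin (mtop M) U" for U
  proof (intro conjI ballI allI impI)
    note cD = conn_atD[OF conn_at_canonical[OF openin_point[OF U]] U]
    fix \<sigma> assume \<sigma>: "\<sigma> \<in> one_forms M U"
    show "canonical_conn U \<sigma> \<in> H_tensors M H U" by (rule H_tensors_canonical[OF U \<sigma>])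
    show "canonical_conn V (restr V \<sigma>) = restr V (canonical_conn U \<sigma>)" if "openin (mtop M) V \<and> V \<subseteq> U" for V
    proof (intro ext)
      fix p u v
      have V: "openin (mtop M) V" "V \<subseteq> U" using that by auto
      show "canonical_conn V (restr V \<sigma>) p u v = restr V (canonical_conn U \<sigma>) p u v"
      proof (cases "p \<in> V \<and> u \<in> H p \<and> v \<in> tangent M p")
        case True
        then show ?thesis using cD(1)[of p \<sigma> u v V] V \<sigma> by auto
      next
        case False
        then show ?thesis by (cases "p \<in> V") (auto simp: canonical_conn_def)
      qed
    qed
    show "canonical_conn U (a *\<^sub>R \<sigma> + b *\<^sub>R \<tau>) = a *\<^sub>R canonical_conn U \<sigma> + b *\<^sub>R canonical_conn U \<tau>"
      if \<tau>: "\<tau> \<in> one_forms M U" for \<tau> a b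
    proof (intro ext)
      fix p u v
      have eq: "a *\<^sub>R \<sigma> + b *\<^sub>R \<tau> = (\<lambda>q. a *\<^sub>R \<sigma> q + b *\<^sub>R \<tau> q)" by (simp add: fun_eq_iff)
      note sc = one_forms_scale[OF U smooth_fun_const[OF U]]
      show "canonical_conn U (a *\<^sub>R \<sigma> + b *\<^sub>R \<tau>) p u v = (a *\<^sub>R canonical_conn U \<sigma> + b *\<^sub>R canonical_conn U \<tau>) p u v"
      proof (cases "p \<in> U \<and> u \<in> H p \<and> v \<in> tangent M p")
        case True
        then have p: "p \<in> U" and u: "u \<in> H p" and v: "v \<in> tangent M p" by auto
        have "canonical_conn U (\<lambda>q. a *\<^sub>R \<sigma> q + b *\<^sub>R \<tau> q) p u v =
            canonical_conn U (\<lambda>q. a *\<^sub>R \<sigma> q) p u v + canonical_conn U (\<lambda>q. b *\<^sub>R \<tau> q) p u v"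
          by (rule cD(2)[OF p p sc[OF \<sigma>] u v sc[OF \<tau>]])
        then show ?thesis
          unfolding eq cD(3)[OF p p \<sigma> u v smooth_fun_const[OF U]] cD(3)[OF p p \<tau> u v smooth_fun_const[OF U]]
          by simp
      next
        case False
        then show ?thesis by (auto simp: canonical_conn_def)
      qed
    qed
    show "canonical_conn U (\<lambda>q. f q *\<^sub>R \<sigma> q) p u v = f p * canonical_conn U \<sigma> p u v + dir_deriv M p u f * \<sigma> p v"
      if "smooth_fun M U f" "p \<in> U" "u \<in> H p" "v \<in> tangent M p" for f p u v
      by (rule cD(3)[OF that(2,2) \<sigma> that(3,4,1)])
  qed
  show ?thesis
    unfolding partial_connection_def using z1 z2 main by simp
qed

lemma partial_connection_conn_at:
  assumes D: "partial_connection M H D"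
  shows "conn_at p D"
  unfolding conn_at_def
proof (intro allI impI, goal_cases)
  case (1 V \<sigma>)
  then have V: "openin (mtop M) V" "p \<in> V" and \<sigma>: "\<sigma> \<in> one_forms M V" by auto
  note pc = D[unfolded partial_connection_def, THEN conjunct2, THEN conjunct2, rule_format, OF V(1)]
  have H: "D V \<sigma> \<in> H_tensors M H V" using pc \<sigma> by blast
  have c1: "D V' (restr V' \<sigma>) p u v = D V \<sigma> p u v" if "openin (mtop M) V'" "p \<in> V'" "V' \<subseteq> V" for V' u v
    using pc[THEN conjunct2, THEN conjunct1, rule_format, OF \<sigma>, of V'] that by simp
  have c2: "D V (\<lambda>q. \<sigma> q + \<tau> q) p u v = D V \<sigma> p u v + D V \<tau> p u v" if "\<tau> \<in> one_forms M V" for \<tau> u v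
  proof -
    have "(\<lambda>q. \<sigma> q + \<tau> q) = 1 *\<^sub>R \<sigma> + 1 *\<^sub>R \<tau>" by (simp add: fun_eq_iff)
    then have "D V (\<lambda>q. \<sigma> q + \<tau> q) = 1 *\<^sub>R D V \<sigma> + 1 *\<^sub>R D V \<tau>"
      using pc[THEN conjunct2, THEN conjunct2, THEN conjunct1, rule_format, OF \<sigma> that, of 1 1] by simp
    then show ?thesis by simp
  qed
  have c3: "D V (\<lambda>q. f q *\<^sub>R \<sigma> q) p u v = f p * D V \<sigma> p u v + dir_deriv M p u f * \<sigma> p v"
    if "smooth_fun M V f" "u \<in> H p" "v \<in> tangent M p" for f u v
    by (rule pc[THEN conjunct2, THEN conjunct2, THEN conjunct2, rule_format, OF \<sigma> that(1) V(2) that(2,3)])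
  have c4: "linear_on (tangent M p) (D V \<sigma> p u)" if "u \<in> H p" for u
    using H V(2) that unfolding H_tensors_def by auto
  have c5: "linear_on (H p) (\<lambda>u. D V \<sigma> p u v)" if "v \<in> tangent M p" for v
    using H V(2) that unfolding H_tensors_def by auto
  show ?case
    by (intro conjI ballI allI impI; (elim conjE)?) (simp_all only: c1 c2 c3 c4 c5)
qed

section \<open>From pointwise conditions to the global statement\<close>

definition lc_conditions :: "('a, 'e) form_operator \<Rightarrow> 'a set \<Rightarrow> ('a, 'e) oneform \<Rightarrow> ('a, 'e) vfield \<Rightarrow> bool" where
  "lc_conditions D U \<theta> T \<longleftrightarrow> reeb_parallel M H D U T \<and> contact_form_eq M H D U \<theta> \<and>
     torsion_free M H D U \<and> metric_parallel M H g D U \<theta> T"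

text \<open>The conditions over \<open>U\<close> quantify over open sets before points,
  \<open>lc_at\<close> over points before open sets; the remaining requirement
  \<open>conn_at\<close> holds for every partial connection.\<close>

lemma lc_conditions_iff:
  assumes "partial_connection M H D"
  shows "lc_conditions D U \<theta> T \<longleftrightarrow> (\<forall>p\<in>U. lc_at p U \<theta> T D)"
proof
  assume L: "lc_conditions D U \<theta> T"
  show "\<forall>p\<in>U. lc_at p U \<theta> T D"
  proof
    fix p assume p: "p \<in> U"
    have 1: "\<forall>u\<in>H p. induced_TM M D U T p u = 0"
      using L p unfolding lc_conditions_def reeb_parallel_def by simp
    have 2: "\<forall>u\<in>H p. \<forall>v\<in>tangent M p. D U \<theta> p u v = 1/2 * ext_deriv M \<theta> p u v"
      using L p unfolding lc_conditions_def contact_form_eq_def by simp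
    have 3: "\<forall>V \<omega>. openin (mtop M) V \<and> p \<in> V \<and> V \<subseteq> U \<and> \<omega> \<in> one_forms M V \<longrightarrow>
        (\<forall>u\<in>H p. \<forall>v\<in>H p. partial_torsion M D V \<omega> p u v = 0)"
      using L unfolding lc_conditions_def torsion_free_def by simp
    have 4: "\<forall>V Y Z. openin (mtop M) V \<and> p \<in> V \<and> V \<subseteq> U \<and> Y \<in> vfields M V \<and> Z \<in> vfields M V \<longrightarrow>
        (\<forall>u\<in>H p. induced_bilin M D V (reeb_extend \<theta> T g) Y Z p u = 0)"
      using L unfolding lc_conditions_def metric_parallel_def by simp
    show "lc_at p U \<theta> T D"
      unfolding lc_at_def by (intro conjI partial_connection_conn_at[OF assms] 1 2 3 4)
  qed
next
  assume L: "\<forall>p\<in>U. lc_at p U \<theta> T D"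
  have "reeb_parallel M H D U T"
    using L unfolding lc_at_def reeb_parallel_def by simp
  moreover have "contact_form_eq M H D U \<theta>"
    using L unfolding lc_at_def contact_form_eq_def by simp
  moreover have "torsion_free M H D U"
    unfolding torsion_free_def
  proof (intro allI impI ballI)
    fix V \<omega> p u v
    assume "openin (mtop M) V \<and> V \<subseteq> U \<and> \<omega> \<in> one_forms M V" "p \<in> V" "u \<in> H p" "v \<in> H p"
    moreover from this have "lc_at p U \<theta> T D" using L by blast
    ultimately show "partial_torsion M D V \<omega> p u v = 0" unfolding lc_at_def by simp
  qed
  moreover have "metric_parallel M H g D U \<theta> T"
    unfolding metric_parallel_def
  proof (intro allI impI ballI)
    fix V Y Z p u
    assume "openin (mtop M) V \<and> V \<subseteq> U \<and> Y \<in> vfields M V \<and> Z \<in> vfields M V" "p \<in> V" "u \<in> H p"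
    moreover from this have "lc_at p U \<theta> T D" using L by blast
    ultimately show "induced_bilin M D V (reeb_extend \<theta> T g) Y Z p u = 0" unfolding lc_at_def by simp
  qed
  ultimately show "lc_conditions D U \<theta> T" unfolding lc_conditions_def by simp
qed

text \<open>Equality is between functions of all arguments. At genuine sections and vectors it is
  uniqueness at a point, for a normalised form near \<open>p\<close>; elsewhere the conventions in
  \<open>partial_connection\<close> and \<open>H_tensors\<close> force the value 0 on both
  sides.\<close>

lemma canonical_unique:
  assumes D: "partial_connection M H D" and lc: "\<And>U \<theta> T. normalized U \<theta> T \<Longrightarrow> lc_conditions D U \<theta> T"
  shows "D = canonical_conn"
proof (intro ext)
  fix V \<sigma> p u v
  note pc = D[unfolded partial_connection_def]
  show "D V \<sigma> p u v = canonical_conn V \<sigma> p u v"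
  proof (cases "openin (mtop M) V \<and> \<sigma> \<in> one_forms M V \<and> p \<in> V \<and> u \<in> H p \<and> v \<in> tangent M p")
    case True
    then have V: "openin (mtop M) V" "p \<in> V" and \<sigma>: "\<sigma> \<in> one_forms M V" and u: "u \<in> H p" and v: "v \<in> tangent M p"
      by auto
    obtain U \<theta> T W E where p: "p \<in> W" and N: "normalized U \<theta> T" and A: "adapted M H g n U \<theta> T W E"
      by (rule adapted_at[OF openin_point[OF V]])
    have "lc_at p U \<theta> T D"
      using lc[OF N] adapted.WU[OF A p] unfolding lc_conditions_iff[OF D] by blast
    then have "D V \<sigma> p u v = adapted.conn M g n \<theta> T W E V \<sigma> p u v"
      by (rule adapted.lc_at_unique[OF A _ p V \<sigma> u v])
    then show ?thesis using canonical_conn_eq[OF A p V \<sigma> u v] by simp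
  next
    case False
    have "D V \<sigma> p u v = 0"
    proof (cases "openin (mtop M) V \<and> \<sigma> \<in> one_forms M V")
      case True
      then have "D V \<sigma> \<in> H_tensors M H V"
        using pc[THEN conjunct2, THEN conjunct2, rule_format, of V, THEN conjunct1] by simp
      then show ?thesis using False True unfolding H_tensors_def by auto
    next
      case no: False
      then have "D V \<sigma> = 0"
        using pc[THEN conjunct1, rule_format, of V] pc[THEN conjunct2, THEN conjunct1, rule_format, of \<sigma> V]
        by (auto simp: fun_eq_iff)
      then show ?thesis by simp
    qed
    then show ?thesis using canonical_conn_off[OF False] by simp
  qed
qed

end

theorem theorem4p1:
  fixes M :: "('a, 'e::euclidean_space) manifold"
    and H :: "'a \<Rightarrow> ('a, 'e) tvec set"
    and g :: "('a, 'e) bilin"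
    and n :: nat
  assumes "smooth_manifold M"
    and "n \<ge> 1"
    and "DIM('e) = 2 * n + 1"
    and "sub_riemannian_contact M H g"
  shows "\<exists>!D. partial_connection M H D \<and>
    (\<forall>U \<theta> T. contact_form M H U \<theta> \<and> (\<forall>p\<in>U. Omega_norm_sq M H g \<theta> p = 2 * real n) \<and>
       reeb_field M U \<theta> T \<longrightarrow>
         reeb_parallel M H D U T \<and>
         contact_form_eq M H D U \<theta> \<and>
         torsion_free M H D U \<and>
         metric_parallel M H g D U \<theta> T)"
proof -
  interpret sub_riem_contact M H g n
    by unfold_locales (use assms in auto)
  \<comment> \<open>\<open>normalized\<close> and \<open>lc_conditions\<close> bundle the hypotheses
    on a form and the four conditions, so that unfolding them gives the claim literally.\<close>
  have "\<exists>!D. partial_connection M H D \<and> (\<forall>U \<theta> T. normalized U \<theta> T \<longrightarrow> lc_conditions D U \<theta> T)"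
  proof (rule ex1I[of _ canonical_conn])
    show "partial_connection M H canonical_conn \<and> (\<forall>U \<theta> T. normalized U \<theta> T \<longrightarrow> lc_conditions canonical_conn U \<theta> T)"
      by (simp add: partial_connection_canonical lc_conditions_iff lc_at_canonical)
  qed (auto intro: canonical_unique)
  then show ?thesis unfolding normalized_def lc_conditions_def .
qed

end
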